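(* Assume the standing assumptions in the context, and let $u_1\in(0,c_* )$ be the unique number with $\rho(u_1)u_1\sin\theta_1=\rho(u_0)u_0\sin\theta_0$. Assume $\partial_\theta\phi\ge0$ on $\partial\Omega$. Then problem (P) with exit data $c_{\theta_1}\in(0,c_* )$ admits a transonic shock solution (in the sense defined in the context) if and only if $c_{\theta_1}=u_1$. Moreover, in that case the solution is unique modulo a translation of the shock: if $\phi$ is any transonic shock solution of (P), then its shock function is constant, $\theta_s\equiv\theta_b$ for some $\theta_b\in(\theta_0,\theta_1)$, and $\phi$ coincides (up to an additive constant) with the radially symmetric solution $\phi_b$ whose shock is $\{\theta=\theta_b\}$; conversely every $\theta_b\in(\theta_0,\theta_1)$ gives such a solution $\phi_b$.
   Context: Constants: $\gamma>1$, $c_0>0$, $c_*:=\sqrt{2c_0^2/(\gamma+1)}$, $0<\theta_0<\theta_1<\pi$, $u_0\in\big(c_*,\sqrt{2c_0^2/(\gamma-1)}\big)$. For a speed $q\in[0,\sqrt{2c_0^2/(\gamma-1)})$ put $\rho(q)=\big(\frac1\gamma(c_0^2-\frac{\gamma-1}{2}q^2)\big)^{1/(\gamma-1)}$ and sonic speed $c^2=\gamma\rho^{\gamma-1}=c_0^2-\frac{\gamma-1}{2}q^2$. Standing assumption: $\rho(u_0)u_0\sin\theta_0<\rho(c_* )c_*\sin\theta_1$. Setting: unit sphere $\mathbf S^2$ with coordinates $(\theta,\varphi)$, metric $\mathrm d\theta^2+\sin^2\theta\,\mathrm d\varphi^2$; $\Omega=\{\theta_0\le\theta\le\theta_1\}$,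 $\Sigma_0=\{\theta=\theta_0\}$, $\Sigma_1=\{\theta=\theta_1\}$, $\partial\Omega=\Sigma_0\cup\Sigma_1$. For a potential $\phi$ (distinct from the longitude $\varphi$), $\nabla\phi=(\partial_\theta\phi,\frac1{\sin\theta}\partial_\varphi\phi)$, $|\nabla\phi|^2=(\partial_\theta\phi)^2+\frac{(\partial_\varphi\phi)^2}{\sin^2\theta}$. Potential flow equation: $\mathrm{div}(\rho(|\nabla\phi|)\nabla\phi)=\frac1{\sin\theta}\big(\partial_\theta(\sin\theta\,\rho\,\partial_\theta\phi)+\partial_\varphi(\frac{\rho}{\sin\theta}\partial_\varphi\phi)\big)=0$. Supersonic: $|\nabla\phi|>c_*$; subsonic: $|\nabla\phi|<c_*$. Problem (P): the equation in $\Omega$, $\nabla\phi=(u_0,0)$ on $\Sigma_0$, $|\nabla\phi|=c_{\theta_1}$ on $\Sigma_1$. Transonic shock solution: $\phi\in C^{0,1}(\Omega)\cap C^2(\Omega^-\cup\Omega^+)$, where for a $C^1$ function $\theta_s(\varphi)$ with values in $(\theta_0,\theta_1)$, $S=\{\theta=\theta_s(\varphi)\}$, $\Omega^-=\{\theta_0<\theta<\theta_s(\varphi)\}$, $\Omega^+=\{\theta_s(\varphi)<\theta<\theta_1\}$, such that $\phi$ is supersonic in $\Omega^-$ and subsonic in $\Omega^+$, solves the equation in $\Omega^-\cup\Omega^+$, satisfies the boundary conditions pointwise, and on $S$ satisfies the Rankine–Hugoniot conditions $(\rho(|\nabla\phi_-|)\nabla\phi_--\rho(|\nabla\phi_+|)\nabla\phi_+)\cdot\mathbf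 n_s=0$ and $\frac12|\nabla\phi_-|^2+\frac{c_-^2}{\gamma-1}=\frac12|\nabla\phi_+|^2+\frac{c_+^2}{\gamma-1}$ ($\phi_\mp$ the one-sided limits from $\Omega^\mp$, $c_\mp$ the corresponding sonic speeds, $\mathbf n_s$ the unit normal of $S$). Radially symmetric solution $\phi_b$ with shock at $\theta_b$: $\phi_b=\phi_b(\theta)$, $u=\phi_b'$ solves $u'=\cot\theta\,\frac{c^2u}{u^2-c^2}$ on $(\theta_0,\theta_b)$ with $u(\theta_0)=u_0$ (supersonic), jumps at $\theta_b$ to the subsonic value $u_+<c_*$ with $\rho(u_+)u_+=\rho(u_-)u_-$, and solves the same ODE subsonically on $(\theta_b,\theta_1]$; $\phi_b$ is continuous across $\theta_b$. *)

theory Defs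
  imports "HOL-Analysis.Analysis"
begin

definition rho :: "real \<Rightarrow> real \<Rightarrow> real \<Rightarrow> real" where
  "rho \<gamma> c0 q = ((c0\<^sup>2 - (\<gamma> - 1) / 2 * q\<^sup>2) / \<gamma>) powr (1 / (\<gamma> - 1))"

text \<open>Square of the sonic speed, c^2 = gamma rho^(gamma-1) = c0^2 - (gamma-1)/2 q^2.\<close>
definition csq :: "real \<Rightarrow> real \<Rightarrow> real \<Rightarrow> real" where
  "csq \<gamma> c0 q = c0\<^sup>2 - (\<gamma> - 1) / 2 * q\<^sup>2"

definition cstar :: "real \<Rightarrow> real \<Rightarrow> real" where
  "cstar \<gamma> c0 = sqrt (2 * c0\<^sup>2 / (\<gamma> + 1))"

definition qmax :: "real \<Rightarrow> real \<Rightarrow> real" where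
  "qmax \<gamma> c0 = sqrt (2 * c0\<^sup>2 / (\<gamma> - 1))"

text \<open>Points are pairs (theta, varphi); functions are 2 pi-periodic in varphi.
  Coordinate partial derivatives.\<close>
definition dth :: "(real \<times> real \<Rightarrow> real) \<Rightarrow> real \<times> real \<Rightarrow> real" where
  "dth f x = deriv (\<lambda>s. f (s, snd x)) (fst x)"

definition dph :: "(real \<times> real \<Rightarrow> real) \<Rightarrow> real \<times> real \<Rightarrow> real" where
  "dph f x = deriv (\<lambda>s. f (fst x, s)) (snd x)"

definition cgrad :: "(real \<times> real \<Rightarrow> real) \<Rightarrow> real \<times> real \<Rightarrow> real \<times> real" where
  "cgrad f x = (dth f x, dph f x)"

text \<open>Components of nabla f in the orthonormal frame (e_theta, e_varphi) at colatitude t,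
  given the coordinate gradient g = (d_theta f, d_varphi f).\<close>
definition onb :: "real \<Rightarrow> real \<times> real \<Rightarrow> real \<times> real" where
  "onb t g = (fst g, snd g / sin t)"

definition gnorm :: "real \<Rightarrow> real \<times> real \<Rightarrow> real" where
  "gnorm t g = norm (onb t g)"

definition C1_on :: "(real \<times> real) set \<Rightarrow> (real \<times> real \<Rightarrow> real) \<Rightarrow> bool" where
  "C1_on S f \<longleftrightarrow> (\<forall>x\<in>S. f differentiable (at x)) \<and>
      continuous_on S (dth f) \<and> continuous_on S (dph f)"

definition C2_on :: "(real \<times> real) set \<Rightarrow> (real \<times> real \<Rightarrow> real) \<Rightarrow> bool" where
  "C2_on S f \<longleftrightarrow> C1_on S f \<and> C1_on S (dth f) \<and> C1_on S (dph f)"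

text \<open>The potential flow equation div(rho(|nabla phi|) nabla phi) = 0 at x, in coordinates.\<close>
definition flow_eq :: "real \<Rightarrow> real \<Rightarrow> (real \<times> real \<Rightarrow> real) \<Rightarrow> real \<times> real \<Rightarrow> bool" where
  "flow_eq \<gamma> c0 \<phi> x \<longleftrightarrow>
     1 / sin (fst x) *
       (dth (\<lambda>y. sin (fst y) * rho \<gamma> c0 (gnorm (fst y) (cgrad \<phi> y)) * dth \<phi> y) x
      + dph (\<lambda>y. rho \<gamma> c0 (gnorm (fst y) (cgrad \<phi> y)) / sin (fst y) * dph \<phi> y) x) = 0"

definition Omega :: "real \<Rightarrow> real \<Rightarrow> (real \<times> real) set" where
  "Omega \<theta>0 \<theta>1 = {x. \<theta>0 \<le> fst x \<and> fst x \<le> \<theta>1}"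

definition Om_minus :: "real \<Rightarrow> (real \<Rightarrow> real) \<Rightarrow> (real \<times> real) set" where
  "Om_minus \<theta>0 \<theta>s = {x. \<theta>0 < fst x \<and> fst x < \<theta>s (snd x)}"

definition Om_plus :: "real \<Rightarrow> (real \<Rightarrow> real) \<Rightarrow> (real \<times> real) set" where
  "Om_plus \<theta>1 \<theta>s = {x. \<theta>s (snd x) < fst x \<and> fst x < \<theta>1}"

definition Cl_minus :: "real \<Rightarrow> (real \<Rightarrow> real) \<Rightarrow> (real \<times> real) set" where
  "Cl_minus \<theta>0 \<theta>s = {x. \<theta>0 \<le> fst x \<and> fst x \<le> \<theta>s (snd x)}"

definition Cl_plus :: "real \<Rightarrow> (real \<Rightarrow> real) \<Rightarrow> (real \<times> real) set" where
  "Cl_plus \<theta>1 \<theta>s = {x. \<theta>s (snd x) \<le> fst x \<and> fst x \<le> \<theta>1}"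

text \<open>Unit normal of the shock S = {theta = theta_s(varphi)} at varphi, in the orthonormal
  frame (e_theta, e_varphi): the normalisation of (1, -theta_s'(varphi)/sin theta_s(varphi)).\<close>
definition shock_normal :: "(real \<Rightarrow> real) \<Rightarrow> real \<Rightarrow> real \<times> real" where
  "shock_normal \<theta>s p =
     (let v = (1::real, - deriv \<theta>s p / sin (\<theta>s p)) in (1 / norm v) *\<^sub>R v)"

text \<open>phi is a transonic shock solution of (P) with exit datum c1 and shock function theta_s,
  and moreover d_theta phi >= 0 on the boundary of Omega. Gm / Gp are the one-sided limits of
  the coordinate gradient from Omega^- / Omega^+, which are required to exist on the closures.\<close>
definition transonic_shock_sol ::
  "real \<Rightarrow> real \<Rightarrow> real \<Rightarrow> real \<Rightarrow> real \<Rightarrow> real \<Rightarrow>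
   (real \<times> real \<Rightarrow> real) \<Rightarrow> (real \<Rightarrow> real) \<Rightarrow> bool" where
  "transonic_shock_sol \<gamma> c0 \<theta>0 \<theta>1 u0 c1 \<phi> \<theta>s \<longleftrightarrow>
     \<comment> \<open>shock function: C^1, periodic, values in (theta0, theta1)\<close>
     \<theta>s C1_differentiable_on UNIV \<and>
     (\<forall>p. \<theta>s (p + 2 * pi) = \<theta>s p) \<and>
     (\<forall>p. \<theta>0 < \<theta>s p \<and> \<theta>s p < \<theta>1) \<and>
     \<comment> \<open>phi is a function on the sphere, Lipschitz on Omega, C^2 off the shock\<close>
     (\<forall>t p. \<phi> (t, p + 2 * pi) = \<phi> (t, p)) \<and>
     (\<exists>L. L-lipschitz_on (Omega \<theta>0 \<theta>1) \<phi>) \<and>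
     C2_on (Om_minus \<theta>0 \<theta>s \<union> Om_plus \<theta>1 \<theta>s) \<phi> \<and>
     \<comment> \<open>supersonic before, subsonic behind the shock\<close>
     (\<forall>x\<in>Om_minus \<theta>0 \<theta>s. cstar \<gamma> c0 < gnorm (fst x) (cgrad \<phi> x)
                          \<and> gnorm (fst x) (cgrad \<phi> x) < qmax \<gamma> c0) \<and>
     (\<forall>x\<in>Om_plus \<theta>1 \<theta>s. gnorm (fst x) (cgrad \<phi> x) < cstar \<gamma> c0) \<and>
     \<comment> \<open>the equation\<close>
     (\<forall>x\<in>Om_minus \<theta>0 \<theta>s \<union> Om_plus \<theta>1 \<theta>s. flow_eq \<gamma> c0 \<phi> x) \<and>
     (\<exists>Gm Gp.
        (\<forall>x\<in>Cl_minus \<theta>0 \<theta>s. (cgrad \<phi> \<longlongrightarrow> Gm x) (at x within Om_minus \<theta>0 \<theta>s)) \<and>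
        (\<forall>x\<in>Cl_plus \<theta>1 \<theta>s. (cgrad \<phi> \<longlongrightarrow> Gp x) (at x within Om_plus \<theta>1 \<theta>s)) \<and>
        \<comment> \<open>boundary conditions\<close>
        (\<forall>p. onb \<theta>0 (Gm (\<theta>0, p)) = (u0, 0)) \<and>
        (\<forall>p. gnorm \<theta>1 (Gp (\<theta>1, p)) = c1) \<and>
        \<comment> \<open>d_theta phi >= 0 on the boundary\<close>
        (\<forall>p. fst (Gm (\<theta>0, p)) \<ge> 0) \<and>
        (\<forall>p. fst (Gp (\<theta>1, p)) \<ge> 0) \<and>
        \<comment> \<open>Rankine--Hugoniot conditions on S\<close>
        (\<forall>p. let x = (\<theta>s p, p); t = \<theta>s p;
                  qm = gnorm t (Gm x); qp = gnorm t (Gp x) in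
             (rho \<gamma> c0 qm *\<^sub>R onb t (Gm x) - rho \<gamma> c0 qp *\<^sub>R onb t (Gp x)) \<bullet> shock_normal \<theta>s p = 0
           \<and> qm\<^sup>2 / 2 + csq \<gamma> c0 qm / (\<gamma> - 1) = qp\<^sup>2 / 2 + csq \<gamma> c0 qp / (\<gamma> - 1)))"

definition radial_shock_sol ::
  "real \<Rightarrow> real \<Rightarrow> real \<Rightarrow> real \<Rightarrow> real \<Rightarrow> real \<Rightarrow> (real \<Rightarrow> real) \<Rightarrow> bool" where
  "radial_shock_sol \<gamma> c0 \<theta>0 \<theta>1 u0 \<theta>b \<phi>b \<longleftrightarrow>
     \<theta>0 < \<theta>b \<and> \<theta>b < \<theta>1 \<and>
     continuous_on {\<theta>0..\<theta>1} \<phi>b \<and>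
     (\<exists>u um up.
        (\<forall>t\<in>{\<theta>0..<\<theta>b} \<union> {\<theta>b<..\<theta>1}.
           (\<phi>b has_real_derivative u t) (at t within {\<theta>0..\<theta>1})) \<and>
        (\<forall>t\<in>{\<theta>0..<\<theta>b} \<union> {\<theta>b<..\<theta>1}.
           (u has_real_derivative
              (cot t * csq \<gamma> c0 (u t) * u t / ((u t)\<^sup>2 - csq \<gamma> c0 (u t))))
           (at t within {\<theta>0..\<theta>1})) \<and>
        u \<theta>0 = u0 \<and>
        (\<forall>t\<in>{\<theta>0..<\<theta>b}. cstar \<gamma> c0 < \<bar>u t\<bar> \<and> \<bar>u t\<bar> < qmax \<gamma> c0) \<and>
        (\<forall>t\<in>{\<theta>b<..\<theta>1}. \<bar>u t\<bar> < cstar \<gamma> c0) \<and>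
        (u \<longlongrightarrow> um) (at_left \<theta>b) \<and>
        (u \<longlongrightarrow> up) (at_right \<theta>b) \<and>
        up < cstar \<gamma> c0 \<and>
        rho \<gamma> c0 up * up = rho \<gamma> c0 um * um)"

end

theory Submission
  imports Defs
begin

text \<open>
  Upstream of the shock the equation is hyperbolic. The Rankine-Hugoniot conditions force the
  normal velocity there to be supersonic, so the shock is space-like for the upstream flow and
  data on the inlet determine it: comparing the Riemann invariants (Prandtl-Meyer function plus
  or minus flow angle) with those of the radial flow, a maximum principle along
  characteristics shows that the upstream flow is radial. This only needs second derivatives in
  the open region.

  Downstream, the flux condition on the shock is a conormal condition satisfied by every radial
  flow with the same mass flux \<open>K\<close>. Radial flows with mass flux \<open>K + \<epsilon> \<theta>\<close> are strict sub- or
  supersolutions, for the equation as well as for the shock condition, so the difference of the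
  potentials attains its extrema at the outlet, which yields the exit speed. Conservation of
  mass between the shock and the outlet makes the outlet velocity purely radial; hence the
  potential is constant there and \<open>\<epsilon> \<longrightarrow> 0\<close> identifies the flow. Finally the shock is
  the set where the upstream and the downstream potential agree, and their difference is
  strictly monotone in \<open>\<theta>\<close>.
\<close>

section \<open>One-dimensional gas dynamics\<close>

text \<open>The gradient is only known to be continuous up to the shock and the boundary; second
  derivatives exist in the open regions and may blow up towards the shock. So nothing is
  differentiated twice there and no boundary point lemma is invoked. Both halves argue at one
  extremal point with strict inequalities. Upstream the maximum is taken on a region cut off shortly
  before the shock. Downstream the perturbation \<open>\<epsilon> * t\<close> of the mass flux turns
  the weak sign of a one-sided derivative into a contradiction: its derivative
  \<open>\<epsilon>\<close> enters the equation and its value \<open>\<epsilon> * t\<close> the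
  shock condition, with the same sign because \<open>t > 0\<close>. Supersonic speed alone does not
  make \<theta> time-like, so upstream the radial flow is continued in \<theta> by an open-closed
  argument. At the outlet only the speed is prescribed, neither the potential nor its normal
  derivative; hence the speed is identified first and the direction afterwards. The standing
  assumption keeps the radial mass flux below its sonic maximum throughout the nozzle, so both
  radial branches exist for all \<theta> and the shock may sit anywhere.\<close>

lemma the_inv_into_branch:
  fixes f f' :: "real \<Rightarrow> real"
  assumes der: "\<And>x. x \<in> {a<..<b} \<Longrightarrow> (f has_real_derivative f' x) (at x)"
    and nz: "\<And>x. x \<in> {a<..<b} \<Longrightarrow> f' x \<noteq> 0"
    and inj: "inj_on f {a<..<b}"
    and img: "f ` {a<..<b} = {l<..<r}"
    and y: "y \<in> {l<..<r}"
  defines "g \<equiv> the_inv_into {a<..<b} f"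
  shows "g y \<in> {a<..<b}" "f (g y) = y" "(g has_real_derivative 1 / f' (g y)) (at y)"
proof -
  have gin: "g z \<in> {a<..<b}" and fg: "f (g z) = z" if "z \<in> {l<..<r}" for z
    using that img inj unfolding g_def
    by (metis f_the_inv_into_f the_inv_into_into order_refl)+
  show "g y \<in> {a<..<b}" "f (g y) = y" using gin fg y by auto
  have gf: "g (f x) = x" if "x \<in> {a<..<b}" for x
    unfolding g_def by (rule the_inv_into_f_f[OF inj that])
  define x where "x = g y"
  have x: "x \<in> {a<..<b}" "f x = y" using gin fg y by (auto simp: x_def)
  define d where "d = min (x - a) (b - x) / 2"
  have d: "d > 0" "\<And>z. \<bar>z - x\<bar> \<le> d \<Longrightarrow> z \<in> {a<..<b}"
    using x(1) by (auto simp: d_def min_def field_simps abs_if split: if_splits)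
  have "isCont g (f x)"
    by (rule isCont_inverse_function[OF d(1)]) (use d(2) gf der in \<open>auto intro!: DERIV_isCont\<close>)
  then have "isCont g y" using x by simp
  then have "(g has_real_derivative inverse (f' (g y))) (at y)"
    using DERIV_inverse_function[where f = f and g = g and x = y and D = "f' (g y)" and a = l and b = r]
      der nz gin fg y by auto
  then show "(g has_real_derivative 1 / f' (g y)) (at y)" by (simp add: inverse_eq_divide)
qed

lemma image_open_interval_mono:
  fixes f :: "real \<Rightarrow> real"
  assumes ab: "a < b" and cont: "continuous_on {a..b} f"
    and mono: "\<And>x y. a \<le> x \<Longrightarrow> x < y \<Longrightarrow> y \<le> b \<Longrightarrow> f x < f y"
  shows "inj_on f {a<..<b}" "f ` {a<..<b} = {f a<..<f b}"
proof -
  show "inj_on f {a<..<b}"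
  proof (rule inj_onI)
    fix x y assume "x \<in> {a<..<b}" "y \<in> {a<..<b}" "f x = f y"
    then show "x = y" using mono[of x y] mono[of y x] by (cases x y rule: linorder_cases) auto
  qed
  show "f ` {a<..<b} = {f a<..<f b}"
  proof (intro subset_antisym subsetI)
    fix y assume "y \<in> f ` {a<..<b}"
    then show "y \<in> {f a<..<f b}" using mono by auto
  next
    fix y assume y: "y \<in> {f a<..<f b}"
    then obtain x where x: "a \<le> x" "x \<le> b" "f x = y"
      using IVT'[of f a y b] cont ab by auto
    then have "x \<noteq> a" "x \<noteq> b" using y by auto
    then show "y \<in> f ` {a<..<b}" using x by force
  qed
qed

text \<open>The density and the squared sonic speed as functions of the squared speed; unlike
  \<open>rho\<close>, they can be differentiated at stagnation points without a square root.\<close>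

definition csq2 :: "real \<Rightarrow> real \<Rightarrow> real \<Rightarrow> real" where
  "csq2 \<gamma> c0 y = c0\<^sup>2 - (\<gamma> - 1) / 2 * y"

definition rho2 :: "real \<Rightarrow> real \<Rightarrow> real \<Rightarrow> real" where
  "rho2 \<gamma> c0 y = (csq2 \<gamma> c0 y / \<gamma>) powr (1 / (\<gamma> - 1))"

lemma rho_eq_rho2: "rho \<gamma> c0 q = rho2 \<gamma> c0 (q\<^sup>2)"
  by (simp add: rho_def rho2_def csq2_def)

lemma csq_eq_csq2: "csq \<gamma> c0 q = csq2 \<gamma> c0 (q\<^sup>2)"
  by (simp add: csq_def csq2_def)

locale gas =
  fixes \<gamma> c0 :: real
  assumes gamma: "\<gamma> > 1" and c0: "c0 > 0"
begin

abbreviation "cs \<equiv> cstar \<gamma> c0"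
abbreviation "qm \<equiv> qmax \<gamma> c0"
abbreviation "cc \<equiv> csq2 \<gamma> c0"
abbreviation "rr \<equiv> rho2 \<gamma> c0"

definition mflux :: "real \<Rightarrow> real" where "mflux q = rr (q\<^sup>2) * q"

lemma cs_sq: "cs\<^sup>2 = 2 * c0\<^sup>2 / (\<gamma> + 1)" using gamma by (simp add: cstar_def)
lemma qm_sq: "qm\<^sup>2 = 2 * c0\<^sup>2 / (\<gamma> - 1)" using gamma by (simp add: qmax_def)

lemma cs_pos: "0 < cs" using gamma c0 by (simp add: cstar_def)
lemma qm_pos: "0 < qm" using gamma c0 by (simp add: qmax_def)

lemma cs_less_qm: "cs < qm"
  unfolding cstar_def qmax_def real_sqrt_less_iff
  by (rule divide_strict_left_mono) (use gamma c0 in auto)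

lemma cc_pos_iff: "0 < cc y \<longleftrightarrow> y < qm\<^sup>2"
  unfolding qm_sq csq2_def using gamma by (simp add: field_simps)

text \<open>The critical speed \<open>cs\<close> is the one speed that equals its own sonic
  speed.\<close>

lemma less_cc_iff: "y < cc y \<longleftrightarrow> y < cs\<^sup>2"
  and cc_less_iff: "cc y < y \<longleftrightarrow> cs\<^sup>2 < y"
  and le_cc_iff: "y \<le> cc y \<longleftrightarrow> y \<le> cs\<^sup>2"
  unfolding cs_sq csq2_def using gamma by (simp_all add: field_simps)

lemma cc_qm: "cc (qm\<^sup>2) = 0"
  unfolding qm_sq csq2_def using gamma by (simp add: field_simps)

lemma sq_less_qm: "\<bar>q\<bar> < qm \<Longrightarrow> q\<^sup>2 < qm\<^sup>2"
  by (metis abs_ge_zero power2_abs power_strict_mono zero_less_numeral)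

lemma rr_pos: "y < qm\<^sup>2 \<Longrightarrow> 0 < rr y"
  using gamma cc_pos_iff[of y] by (auto simp: rho2_def)

lemma DERIV_cc: "(cc has_real_derivative - (\<gamma> - 1) / 2) (at y)"
  unfolding csq2_def by (auto intro!: derivative_eq_intros simp: field_simps)

text \<open>Bernoulli's law in differential form, d rho / rho = - q dq / c^2, written in the
  variable \<open>y\<close> = q^2.\<close>

lemma DERIV_rr:
  assumes "y < qm\<^sup>2"
  shows "(rr has_real_derivative - rr y / (2 * cc y)) (at y)"
proof -
  have p: "cc y > 0" using assms cc_pos_iff by simp
  have "(rr has_real_derivative rr y * (0 * ln (cc y / \<gamma>) + (- (\<gamma> - 1) / 2 / \<gamma>) * (1 / (\<gamma> - 1)) / (cc y / \<gamma>))) (at y)"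
    unfolding rho2_def
    by (rule DERIV_powr[where g = "\<lambda>y. cc y / \<gamma>"])
      (use p gamma DERIV_cdivide[OF DERIV_cc, of \<gamma> y] in auto)
  moreover have "rr y * (0 * ln (cc y / \<gamma>) + (- (\<gamma> - 1) / 2 / \<gamma>) * (1 / (\<gamma> - 1)) / (cc y / \<gamma>)) = - rr y / (2 * cc y)"
    using gamma p by (simp add: field_simps)
  ultimately show ?thesis by metis
qed

lemma DERIV_rr_square:
  assumes "z\<^sup>2 + k < qm\<^sup>2"
  shows "((\<lambda>z. rr (z\<^sup>2 + k)) has_real_derivative - (rr (z\<^sup>2 + k) * z / cc (z\<^sup>2 + k))) (at z)"
proof -
  have "((\<lambda>z. rr (z\<^sup>2 + k)) has_real_derivative - rr (z\<^sup>2 + k) / (2 * cc (z\<^sup>2 + k)) * (2 * z)) (at z)"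
    by (rule DERIV_chain2[where f = rr and g = "\<lambda>z. z\<^sup>2 + k", OF DERIV_rr[OF assms]]) (auto intro!: derivative_eq_intros)
  then show ?thesis by (simp add: field_simps)
qed

lemma continuous_on_rr: "continuous_on {..qm\<^sup>2} rr"
proof -
  have "0 \<le> cc y" if "y \<le> qm\<^sup>2" for y
    using that cc_pos_iff[of y] cc_qm by (cases "y = qm\<^sup>2") auto
  moreover have "continuous_on {..qm\<^sup>2} cc" unfolding csq2_def by (intro continuous_intros)
  ultimately show ?thesis
    unfolding rho2_def using gamma by (intro continuous_on_powr' continuous_intros) auto
qed

text \<open>Here \<open>x\<close>, \<open>y\<close> are normal velocities and \<open>t\<close> is the common tangential velocity.\<close>
lemma normal_flux_strict_mono:
  assumes xy: "x < y" and x: "x\<^sup>2 \<le> cc (x\<^sup>2 + t\<^sup>2)" and y: "y\<^sup>2 \<le> cc (y\<^sup>2 + t\<^sup>2)"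
  shows "rr (x\<^sup>2 + t\<^sup>2) * x < rr (y\<^sup>2 + t\<^sup>2) * y"
proof -
  \<comment> \<open>For fixed \<open>t\<close> the condition bounds \<open>z\<^sup>2\<close> alone,
    so it passes, and strictly, to every \<open>z\<close> between \<open>x\<close> and
    \<open>y\<close>.\<close>
  have crit: "z\<^sup>2 \<le> cc (z\<^sup>2 + t\<^sup>2) \<longleftrightarrow> (\<gamma> + 1) / 2 * z\<^sup>2 \<le> c0\<^sup>2 - (\<gamma> - 1) / 2 * t\<^sup>2"
       "z\<^sup>2 < cc (z\<^sup>2 + t\<^sup>2) \<longleftrightarrow> (\<gamma> + 1) / 2 * z\<^sup>2 < c0\<^sup>2 - (\<gamma> - 1) / 2 * t\<^sup>2" for z
    unfolding csq2_def by (auto simp: field_simps)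
  have sub: "z\<^sup>2 < cc (z\<^sup>2 + t\<^sup>2)" if "x < z" "z < y" for z
  proof -
    have "\<bar>z\<bar> < max \<bar>x\<bar> \<bar>y\<bar>" using that by auto
    then have "z\<^sup>2 < x\<^sup>2 \<or> z\<^sup>2 < y\<^sup>2"
      by (metis abs_ge_zero less_max_iff_disj power2_abs power_strict_mono zero_less_numeral)
    then have "(\<gamma> + 1) / 2 * z\<^sup>2 < (\<gamma> + 1) / 2 * x\<^sup>2 \<or> (\<gamma> + 1) / 2 * z\<^sup>2 < (\<gamma> + 1) / 2 * y\<^sup>2"
      using gamma by auto
    then show ?thesis using x y unfolding crit by linarith
  qed
  have le: "z\<^sup>2 + t\<^sup>2 \<le> qm\<^sup>2" if "z\<^sup>2 \<le> cc (z\<^sup>2 + t\<^sup>2)" for z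
  proof -
    have "0 \<le> cc (z\<^sup>2 + t\<^sup>2)" using that zero_le_power2[of z] by linarith
    then show ?thesis
      unfolding qm_sq csq2_def using gamma by (simp add: field_simps)
  qed
  show ?thesis
  \<comment> \<open>At an endpoint the normal velocity may be exactly sonic and the derivative zero,
    so only interior derivatives are examined.\<close>
  proof (rule DERIV_pos_imp_increasing_open[OF xy])
    fix z assume z: "x < z" "z < y"
    note s = sub[OF z]
    have pos: "cc (z\<^sup>2 + t\<^sup>2) > 0" using s by (smt (verit) zero_le_power2)
    then have q: "z\<^sup>2 + t\<^sup>2 < qm\<^sup>2" using cc_pos_iff by blast
    have "((\<lambda>z. rr (z\<^sup>2 + t\<^sup>2) * z) has_real_derivative
        rr (z\<^sup>2 + t\<^sup>2) * (1 - z\<^sup>2 / cc (z\<^sup>2 + t\<^sup>2))) (at z)"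
      by (rule DERIV_cong[OF DERIV_mult[OF DERIV_rr_square[OF q] DERIV_ident]])
        (use pos in \<open>simp add: field_simps power2_eq_square\<close>)
    moreover have "rr (z\<^sup>2 + t\<^sup>2) * (1 - z\<^sup>2 / cc (z\<^sup>2 + t\<^sup>2)) > 0"
      using s pos rr_pos[OF q] by (simp add: field_simps)
    ultimately show "\<exists>d. ((\<lambda>z. rr (z\<^sup>2 + t\<^sup>2) * z) has_real_derivative d) (at z) \<and> 0 < d" by blast
  next
    have "z\<^sup>2 + t\<^sup>2 \<le> qm\<^sup>2" if "z \<in> {x..y}" for z
      using that sub le x y by (metis atLeastAtMost_iff less_eq_real_def)
    then show "continuous_on {x..y} (\<lambda>z. rr (z\<^sup>2 + t\<^sup>2) * z)"
      by (intro continuous_intros continuous_on_compose2[OF continuous_on_rr]) auto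
  qed
qed

lemma mflux_DERIV:
  assumes "\<bar>q\<bar> < qm"
  shows "(mflux has_real_derivative rr (q\<^sup>2) * (1 - q\<^sup>2 / cc (q\<^sup>2))) (at q)"
proof -
  note q = sq_less_qm[OF assms]
  then have pos: "cc (q\<^sup>2) > 0" using cc_pos_iff by blast
  from pos show ?thesis unfolding mflux_def
    using DERIV_cong[OF DERIV_mult[OF DERIV_rr_square[of q 0] DERIV_ident]] q
    by (simp add: field_simps power2_eq_square)
qed

lemma continuous_on_mflux: "continuous_on {0..qm} mflux"
  unfolding mflux_def
  by (intro continuous_intros continuous_on_compose2[OF continuous_on_rr]) auto

lemma mflux_mono: "0 \<le> x \<Longrightarrow> x < y \<Longrightarrow> y \<le> cs \<Longrightarrow> mflux x < mflux y"
  using normal_flux_strict_mono[of x y 0] le_cc_iff[of "x\<^sup>2"] le_cc_iff[of "y\<^sup>2"]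
  by (simp add: mflux_def power_mono)

lemma mflux_antimono: "cs \<le> x \<Longrightarrow> x < y \<Longrightarrow> y \<le> qm \<Longrightarrow> mflux y < mflux x"
proof (rule DERIV_neg_imp_decreasing_open[of x y])
  fix z assume z: "cs \<le> x" "y \<le> qm" "x < z" "z < y"
  then have q: "\<bar>z\<bar> < qm" "cs < z" using cs_pos by auto
  then have "cs\<^sup>2 < z\<^sup>2" using cs_pos by (simp add: power_strict_mono)
  moreover have "0 < cc (z\<^sup>2)" "0 < rr (z\<^sup>2)" using sq_less_qm[OF q(1)] cc_pos_iff rr_pos by auto
  ultimately have "rr (z\<^sup>2) * (1 - z\<^sup>2 / cc (z\<^sup>2)) < 0"
    using cc_less_iff[of "z\<^sup>2"] by (simp add: mult_less_0_iff field_simps)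
  then show "\<exists>d. (mflux has_real_derivative d) (at z) \<and> d < 0" using mflux_DERIV[OF q(1)] by blast
next
  assume "cs \<le> x" "x < y" "y \<le> qm" then show "continuous_on {x..y} mflux"
    using cs_pos by (intro continuous_on_subset[OF continuous_on_mflux]) auto
qed auto

text \<open>The mass flux density rises from 0 to its maximum at \<open>cs\<close> and falls back to
  0 at \<open>qm\<close>; these are the inverses of the two monotone branches.\<close>

definition qsub :: "real \<Rightarrow> real" where "qsub = the_inv_into {0<..<cs} mflux"
definition qsup :: "real \<Rightarrow> real" where "qsup = the_inv_into {cs<..<qm} mflux"

lemma mflux_zero [simp]: "mflux 0 = 0" by (simp add: mflux_def)
lemma mflux_qm [simp]: "mflux qm = 0" by (simp add: mflux_def rho2_def cc_qm)

lemma qsub: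
  assumes "y \<in> {0<..<mflux cs}"
  shows "qsub y \<in> {0<..<cs}" "mflux (qsub y) = y"
    "(qsub has_real_derivative 1 / (rr ((qsub y)\<^sup>2) * (1 - (qsub y)\<^sup>2 / cc ((qsub y)\<^sup>2)))) (at y)"
proof -
  note im = image_open_interval_mono[OF cs_pos continuous_on_subset[OF continuous_on_mflux] mflux_mono]
  have nz: "rr (q\<^sup>2) * (1 - q\<^sup>2 / cc (q\<^sup>2)) \<noteq> 0" and der: "(mflux has_real_derivative rr (q\<^sup>2) * (1 - q\<^sup>2 / cc (q\<^sup>2))) (at q)"
    if "q \<in> {0<..<cs}" for q
  proof -
    have q: "\<bar>q\<bar> < qm" "q\<^sup>2 < cs\<^sup>2" using that cs_less_qm by (auto simp: power_strict_mono)
    then show "rr (q\<^sup>2) * (1 - q\<^sup>2 / cc (q\<^sup>2)) \<noteq> 0"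
      using sq_less_qm[OF q(1)] rr_pos[of "q\<^sup>2"] less_cc_iff[of "q\<^sup>2"] by force
    show "(mflux has_real_derivative rr (q\<^sup>2) * (1 - q\<^sup>2 / cc (q\<^sup>2))) (at q)" by (rule mflux_DERIV[OF q(1)])
  qed
  have im': "inj_on mflux {0<..<cs}" "mflux ` {0<..<cs} = {0<..<mflux cs}"
    using im cs_less_qm by auto
  show "qsub y \<in> {0<..<cs}" "mflux (qsub y) = y"
    "(qsub has_real_derivative 1 / (rr ((qsub y)\<^sup>2) * (1 - (qsub y)\<^sup>2 / cc ((qsub y)\<^sup>2)))) (at y)"
    unfolding qsub_def using the_inv_into_branch[OF der nz im' assms] by auto
qed

lemma qsup:
  assumes "y \<in> {0<..<mflux cs}"
  shows "qsup y \<in> {cs<..<qm}" "mflux (qsup y) = y"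
    "(qsup has_real_derivative 1 / (rr ((qsup y)\<^sup>2) * (1 - (qsup y)\<^sup>2 / cc ((qsup y)\<^sup>2)))) (at y)"
proof -
  \<comment> \<open>Negated, because the flux decreases on the supersonic range while the image
    lemma is stated for increasing functions.\<close>
  have "continuous_on {cs..qm} (\<lambda>q. - mflux q)"
    using cs_pos by (intro continuous_intros continuous_on_subset[OF continuous_on_mflux]) auto
  note im = image_open_interval_mono[OF cs_less_qm this]
  have nz: "rr (q\<^sup>2) * (1 - q\<^sup>2 / cc (q\<^sup>2)) \<noteq> 0" and der: "(mflux has_real_derivative rr (q\<^sup>2) * (1 - q\<^sup>2 / cc (q\<^sup>2))) (at q)"
    if "q \<in> {cs<..<qm}" for q
  proof -
    have q: "\<bar>q\<bar> < qm" "cs\<^sup>2 < q\<^sup>2" using that cs_pos by (auto simp: power_strict_mono)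
    then show "rr (q\<^sup>2) * (1 - q\<^sup>2 / cc (q\<^sup>2)) \<noteq> 0"
      using sq_less_qm[OF q(1)] rr_pos[of "q\<^sup>2"] cc_less_iff[of "q\<^sup>2"] by force
    show "(mflux has_real_derivative rr (q\<^sup>2) * (1 - q\<^sup>2 / cc (q\<^sup>2))) (at q)" by (rule mflux_DERIV[OF q(1)])
  qed
  have i1: "inj_on (\<lambda>q. - mflux q) {cs<..<qm}" "(\<lambda>q. - mflux q) ` {cs<..<qm} = {- mflux cs<..<- mflux qm}"
    using im mflux_antimono by auto
  have im': "inj_on mflux {cs<..<qm}" using i1(1) by (auto simp: inj_on_def)
  have "mflux ` {cs<..<qm} = uminus ` ((\<lambda>q. - mflux q) ` {cs<..<qm})" by (simp add: image_image)
  also have "\<dots> = {0<..<mflux cs}" unfolding i1(2) by simp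
  finally have im2: "mflux ` {cs<..<qm} = {0<..<mflux cs}" .
  show "qsup y \<in> {cs<..<qm}" "mflux (qsup y) = y"
    "(qsup has_real_derivative 1 / (rr ((qsup y)\<^sup>2) * (1 - (qsup y)\<^sup>2 / cc ((qsup y)\<^sup>2)))) (at y)"
    unfolding qsup_def using the_inv_into_branch[OF der nz im' im2 assms] by auto
qed

lemma mflux_inj_sub: "0 \<le> x \<Longrightarrow> x \<le> cs \<Longrightarrow> 0 \<le> y \<Longrightarrow> y \<le> cs \<Longrightarrow> mflux x = mflux y \<Longrightarrow> x = y"
  using mflux_mono by (metis less_irrefl linorder_neqE_linordered_idom)

lemma mflux_le_iff: "0 \<le> x \<Longrightarrow> x \<le> cs \<Longrightarrow> 0 \<le> y \<Longrightarrow> y \<le> cs \<Longrightarrow> mflux x \<le> mflux y \<longleftrightarrow> x \<le> y"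
  using mflux_mono[of x y] mflux_mono[of y x] by (cases x y rule: linorder_cases) auto

lemma mflux_inj_sup: "cs \<le> x \<Longrightarrow> x \<le> qm \<Longrightarrow> cs \<le> y \<Longrightarrow> y \<le> qm \<Longrightarrow> mflux x = mflux y \<Longrightarrow> x = y"
  using mflux_antimono by (metis less_irrefl linorder_neqE_linordered_idom)

end

section \<open>Calculus on strips with a free boundary\<close>

text \<open>A solution comes with limits of the gradient at single points of the closed region.
  Their joint continuity is derived: \<open>G y\<close> is approximated by values \<open>f z\<close>
  at points \<open>z\<close> of \<open>U\<close> near \<open>y\<close>, and these are already close
  to \<open>G x\<close>.\<close>

lemma continuous_on_limit_extension:
  fixes f :: "'a::metric_space \<Rightarrow> 'b::metric_space"
  assumes lim: "\<And>x. x \<in> C \<Longrightarrow> (f \<longlongrightarrow> G x) (at x within U)"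
    and limpt: "\<And>x. x \<in> C \<Longrightarrow> x islimpt U"
    and sub: "U \<subseteq> C" and cont: "continuous_on U f"
  shows "continuous_on C G" "x \<in> U \<Longrightarrow> G x = f x"
proof -
  have Gf: "G x = f x" if "x \<in> U" for x
    using that lim sub cont limpt tendsto_unique trivial_limit_within
    unfolding continuous_on_def by blast
  then show "x \<in> U \<Longrightarrow> G x = f x" .
  show "continuous_on C G"
    unfolding continuous_on_iff
  proof (intro ballI allI impI)
    fix x and e :: real assume x: "x \<in> C" and e: "0 < e"
    obtain d where d: "d > 0" "\<And>y. y \<in> U \<Longrightarrow> y \<noteq> x \<Longrightarrow> dist y x < d \<Longrightarrow> dist (f y) (G x) < e / 2"
      using lim[OF x, unfolded tendsto_iff eventually_at] e by (metis half_gt_zero)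
    have d': "dist (f y) (G x) < e / 2" if "y \<in> U" "dist y x < d" for y
      using d Gf that e by (cases "y = x") auto
    show "\<exists>d>0. \<forall>y\<in>C. dist y x < d \<longrightarrow> dist (G y) (G x) < e"
    proof (intro exI[of _ d] conjI ballI impI d(1))
      fix y assume y: "y \<in> C" "dist y x < d"
      have "\<forall>\<^sub>F z in at y within U. dist (f z) (G y) < e / 2"
        using lim[OF y(1)] e unfolding tendsto_iff by (meson half_gt_zero)
      moreover have "\<forall>\<^sub>F z in at y within U. dist z y < d - dist y x"
        using y(2) by (auto simp: eventually_at intro!: exI[of _ "d - dist y x"])
      moreover have "\<forall>\<^sub>F z in at y within U. z \<in> U" by (simp add: eventually_at_filter)
      ultimately have "\<forall>\<^sub>F z in at y within U. dist (f z) (G y) < e / 2 \<and> dist z y < d - dist y x \<and> z \<in> U"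
        by eventually_elim auto
      then obtain z where z: "dist (f z) (G y) < e / 2" "dist z y < d - dist y x" "z \<in> U"
        using limpt[OF y(1)] by (metis (no_types, lifting) eventually_happens trivial_limit_within)
      have "dist z x < d" using z(2) dist_triangle[of z x y] by linarith
      then have "dist (f z) (G x) < e / 2" using d' z by blast
      then show "dist (G y) (G x) < e" using z(1) dist_triangle2[of "G y" "G x" "f z"]
        by (smt (verit) dist_commute dist_triangle field_sum_of_halves)
    qed
  qed
qed

lemma periodic_add_int:
  fixes f :: "real \<Rightarrow> 'a"
  assumes "\<And>p. f (p + a) = f p"
  shows "f (p + a * of_int k) = f p"
proof (induction k rule: int_induct[where k = 0])
  case (step1 i)
  have "f (p + a * of_int (i + 1)) = f ((p + a * of_int i) + a)" by (simp add: algebra_simps)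
  then show ?case using step1 assms by metis
next
  case (step2 i)
  have "f (p + a * of_int i) = f ((p + a * of_int (i - 1)) + a)" by (simp add: algebra_simps)
  then show ?case using step2 assms by metis
qed simp

text \<open>The regions are unbounded in the longitude; compactness is recovered by restricting to
  one period.\<close>

lemma periodic_attains_sup:
  fixes f :: "real \<times> real \<Rightarrow> real"
  assumes cl: "closed K" and bd: "K \<subseteq> {a..b} \<times> UNIV" and ne: "K \<noteq> {}"
    and cont: "continuous_on K f"
    and perK: "\<And>t p. (t, p + 2 * pi) \<in> K \<longleftrightarrow> (t, p) \<in> K"
    and perf: "\<And>t p. (t, p) \<in> K \<Longrightarrow> f (t, p + 2 * pi) = f (t, p)"
  obtains x where "x \<in> K" "\<And>y. y \<in> K \<Longrightarrow> f y \<le> f x"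
proof -
  \<comment> \<open>Option values merge the periodicity of \<open>K\<close> and that of
    \<open>f\<close> on \<open>K\<close> into the periodicity of one total function, which can then
    be iterated over the integers.\<close>
  define g where "g t p = (if (t, p) \<in> K then Some (f (t, p)) else None)" for t p
  have g: "g t (p + 2 * pi * of_int k) = g t p" for t p k
    by (rule periodic_add_int) (auto simp: g_def perK perf)
  define K0 where "K0 = K \<inter> ({a..b} \<times> {0..2 * pi})"
  have repr: "\<exists>y\<in>K0. f y = f x" if "x \<in> K" for x
  proof -
    obtain t p where x: "x = (t, p)" by fastforce
    define k where "k = \<lfloor>p / (2 * pi)\<rfloor>"
    have k: "of_int k \<le> p / (2 * pi)" "p / (2 * pi) < of_int k + 1" unfolding k_def by linarith+
    define q where "q = p + 2 * pi * of_int (- k)"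
    have "g t q = g t p" unfolding q_def by (rule g)
    then have "(t, q) \<in> K" "f (t, q) = f (t, p)" using that unfolding x g_def by (auto split: if_splits)
    moreover have "q \<in> {0..2 * pi}" using k by (simp add: q_def field_simps)
    ultimately show ?thesis using bd unfolding K0_def x by blast
  qed
  have "compact K0" unfolding K0_def
    by (intro closed_Int_compact cl compact_Times compact_Icc)
  moreover have "K0 \<noteq> {}" using ne repr by blast
  moreover have "continuous_on K0 f" using cont by (rule continuous_on_subset) (auto simp: K0_def)
  ultimately obtain x where "x \<in> K0" "\<And>y. y \<in> K0 \<Longrightarrow> f y \<le> f x"
    using continuous_attains_sup by metis
  then show ?thesis using that[of x] repr by (metis IntD1 K0_def)
qed

text \<open>The device by which strict pointwise inequalities become uniform: bounds on speeds, on
  characteristic directions, and on distances to a bad set, which may be empty.\<close>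

lemma periodic_positive_lower_bound:
  fixes f :: "real \<times> real \<Rightarrow> real"
  assumes cl: "closed K" and bd: "K \<subseteq> {a..b} \<times> UNIV" and cont: "continuous_on K f"
    and perK: "\<And>t p. (t, p + 2 * pi) \<in> K \<longleftrightarrow> (t, p) \<in> K"
    and perf: "\<And>t p. (t, p) \<in> K \<Longrightarrow> f (t, p + 2 * pi) = f (t, p)"
    and pos: "\<And>x. x \<in> K \<Longrightarrow> 0 < f x"
  obtains m where "0 < m" "\<And>x. x \<in> K \<Longrightarrow> m \<le> f x"
proof (cases "K = {}")
  case False
  obtain x where "x \<in> K" "\<And>y. y \<in> K \<Longrightarrow> - f y \<le> - f x"
    by (rule periodic_attains_sup[OF cl bd False, of "\<lambda>x. - f x"]) (use cont perK perf in \<open>auto intro: continuous_intros\<close>)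
  then show ?thesis using that[of "f x"] pos by auto
qed (use that[of 1] in auto)

text \<open>With \<open>a\<close> the difference of Prandtl-Meyer functions and \<open>b\<close> the
  flow angle, the signs select the family of characteristics (\<open>\<sigma>\<close>) and the sign
  of its Riemann invariant (\<open>\<tau>\<close>) that realise the deviation.\<close>

lemma abs_add_abs_signs:
  fixes a b :: real
  obtains \<sigma> \<tau> :: real where "\<sigma> \<in> {1, -1}" "\<tau> \<in> {1, -1}" "\<bar>a\<bar> + \<bar>b\<bar> = \<tau> * (a + \<sigma> * b)"
proof (cases "0 \<le> a"; cases "0 \<le> b")
qed (use that[of 1 1] that[of "-1" 1] that[of 1 "-1"] that[of "-1" "-1"] in auto)

lemma islimpt_vertical:
  assumes ab: "a < b" and t: "t \<in> {a..b}" and V: "\<And>s. a < s \<Longrightarrow> s < b \<Longrightarrow> (s, p) \<in> V"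
  shows "(t, p::real) islimpt (V :: (real \<times> real) set)"
proof (rule islimptI)
  fix T assume T: "(t, p) \<in> T" "open T"
  have lim: "t islimpt {a<..<b}" using ab t islimpt_greaterThanLessThan1 islimpt_greaterThanLessThan2
    by (metis closure_greaterThanLessThan greaterThanLessThan_iff atLeastAtMost_iff closure_def
        UnE mem_Collect_eq interior_limit_point interior_open open_greaterThanLessThan)
  have "open ((\<lambda>s. (s, p)) -` T)" by (intro open_vimage T continuous_intros)
  then obtain s where "s \<in> {a<..<b}" "s \<in> (\<lambda>s. (s, p)) -` T" "s \<noteq> t"
    using lim T unfolding islimpt_def by (metis vimageI2)
  then show "\<exists>y\<in>V. y \<in> T \<and> y \<noteq> (t, p)" using V by auto
qed

lemma agree_on_closed_interval:
  fixes f g :: "real \<Rightarrow> 'a::real_normed_vector"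
  assumes "a < b" "continuous_on {a..b} f" "continuous_on {a..b} g"
    and "\<And>t. a < t \<Longrightarrow> t < b \<Longrightarrow> f t = g t" and t: "t \<in> {a..b}"
  shows "f t = g t"
proof -
  have "f t - g t = 0"
    by (rule continuous_constant_on_closure[of "{a<..<b}" "\<lambda>t. f t - g t"])
      (use assms in \<open>auto intro!: continuous_intros\<close>)
  then show ?thesis by simp
qed

lemma DERIV_interior:
  fixes f :: "real \<Rightarrow> real"
  shows "(f has_real_derivative D) (at t within {a..b}) \<Longrightarrow> a < t \<Longrightarrow> t < b \<Longrightarrow> (f has_real_derivative D) (at t)"
  by (metis at_within_Icc_at)

section \<open>Derivative tests at extremal points\<close>

lemma second_derivative_nonneg_at_min:
  fixes f f' :: "real \<Rightarrow> real"
  assumes r: "r > 0" and der: "\<And>y. \<bar>x - y\<bar> < r \<Longrightarrow> (f has_real_derivative f' y) (at y)"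
    and der2: "(f' has_real_derivative D) (at x)"
    and min: "\<And>y. \<bar>x - y\<bar> < r \<Longrightarrow> f x \<le> f y"
  shows "f' x = 0" "0 \<le> D"
proof -
  show 0: "f' x = 0" using DERIV_local_min[OF der r] r min by auto
  show "0 \<le> D"
  proof (rule ccontr)
    assume "\<not> 0 \<le> D"
    then obtain d where d: "d > 0" "\<And>h. 0 < h \<Longrightarrow> h < d \<Longrightarrow> f' (x + h) < 0"
      using DERIV_neg_dec_right[OF der2] 0 by auto
    define h where "h = min d r / 2"
    have h: "0 < h" "h < d" "h < r" using d(1) r by (auto simp: h_def min_def)
    have "f (x + h) < f x"
    proof (rule DERIV_neg_imp_decreasing_open[of x "x + h" f])
      fix y assume "x < y" "y < x + h"
      then have "f' y < 0" "\<bar>x - y\<bar> < r" using d(2)[of "y - x"] h by auto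
      then show "\<exists>z. (f has_real_derivative z) (at y) \<and> z < 0" using der by blast
    next
      show "continuous_on {x..x + h} f"
        using h by (intro continuous_at_imp_continuous_on ballI DERIV_isCont[OF der]) auto
    qed (use h in auto)
    then show False using min[of "x + h"] h by auto
  qed
qed

text \<open>Made for minima on the shock or the outlet, where the gradient has a limit but the
  potential is not assumed differentiable.\<close>

lemma one_sided_derivative_nonneg:
  fixes f f' :: "real \<Rightarrow> real"
  assumes ab: "a < b" and cont: "continuous_on {a..b} f"
    and der: "\<And>t. a < t \<Longrightarrow> t < b \<Longrightarrow> (f has_real_derivative f' t) (at t)"
    and lim: "(f' \<longlongrightarrow> e) (at_right a)"
    and min: "\<And>t. a \<le> t \<Longrightarrow> t \<le> b \<Longrightarrow> f a \<le> f t"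
  shows "0 \<le> e"
proof (rule ccontr)
  assume "\<not> 0 \<le> e"
  then have "\<forall>\<^sub>F t in at_right a. f' t < 0" using order_tendstoD(2)[OF lim] by auto
  then obtain c where c: "a < c" "\<And>t. a < t \<Longrightarrow> t < c \<Longrightarrow> f' t < 0"
    unfolding eventually_at_right_field by blast
  define d where "d = min b c"
  have d: "a < d" "d \<le> b" "d \<le> c" using ab c(1) by (auto simp: d_def)
  have "f d < f a"
  proof (rule DERIV_neg_imp_decreasing_open[OF d(1)])
    show "\<exists>y. (f has_real_derivative y) (at t) \<and> y < 0" if "a < t" "t < d" for t
      using der[of t] c(2)[of t] that d by force
    show "continuous_on {a..d} f" using cont by (rule continuous_on_subset) (use d in auto)
  qed
  then show False using min[of d] d by auto
qed

section \<open>Partial derivatives and derivatives along curves\<close>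

lemma has_derivative_dth_dph:
  assumes "f differentiable (at x)"
  shows "(f has_derivative (\<lambda>h. dth f x * fst h + dph f x * snd h)) (at x)"
proof -
  obtain D where D: "(f has_derivative D) (at x)" using assms by (auto simp: differentiable_def)
  interpret D: bounded_linear D using D by (rule has_derivative_bounded_linear)
  have "((\<lambda>s. (s, snd x)) has_derivative (\<lambda>h. (h, 0))) (at (fst x))"
    by (intro has_derivative_Pair has_derivative_ident has_derivative_const)
  then have "((\<lambda>s. f (s, snd x)) has_derivative (\<lambda>h. D (h, 0))) (at (fst x))"
    by (rule has_derivative_compose[where g = f and g' = D]) (use D in simp)
  moreover have "(\<lambda>h. D (h, 0)) = (*) (D (1, 0))"
  proof
    fix h show "D (h, 0) = D (1, 0) * h" using D.scaleR[of h "(1, 0)"] by simp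
  qed
  ultimately have 1: "dth f x = D (1, 0)"
    unfolding dth_def by (intro DERIV_imp_deriv) (simp add: has_field_derivative_def)
  have "((\<lambda>s. (fst x, s)) has_derivative (\<lambda>h. (0, h))) (at (snd x))"
    by (intro has_derivative_Pair has_derivative_ident has_derivative_const)
  then have "((\<lambda>s. f (fst x, s)) has_derivative (\<lambda>h. D (0, h))) (at (snd x))"
    by (rule has_derivative_compose[where g = f and g' = D]) (use D in simp)
  moreover have "(\<lambda>h. D (0, h)) = (*) (D (0, 1))"
  proof
    fix h show "D (0, h) = D (0, 1) * h" using D.scaleR[of h "(0, 1)"] by simp
  qed
  ultimately have 2: "dph f x = D (0, 1)"
    unfolding dph_def by (intro DERIV_imp_deriv) (simp add: has_field_derivative_def)
  have "D h = dth f x * fst h + dph f x * snd h" for h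
  proof -
    have "D h = D (fst h *\<^sub>R (1, 0) + snd h *\<^sub>R (0, 1))" by simp
    then show ?thesis unfolding D.add D.scaleR 1 2 by (simp add: mult.commute)
  qed
  then have "D = (\<lambda>h. dth f x * fst h + dph f x * snd h)" by auto
  then show ?thesis using D by simp
qed

lemma DERIV_along_curve:
  assumes "f differentiable (at (a s, b s))"
    and "(a has_real_derivative a') (at s within X)" "(b has_real_derivative b') (at s within X)"
  shows "((\<lambda>s. f (a s, b s)) has_real_derivative dth f (a s, b s) * a' + dph f (a s, b s) * b') (at s within X)"
proof -
  have "((\<lambda>s. (a s, b s)) has_derivative (\<lambda>h. (a' * h, b' * h))) (at s within X)"
    using assms(2,3) unfolding has_field_derivative_def by (intro has_derivative_Pair)
  then have "((\<lambda>s. f (a s, b s)) has_derivative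
     (\<lambda>h. dth f (a s, b s) * fst (a' * h, b' * h) + dph f (a s, b s) * snd (a' * h, b' * h))) (at s within X)"
    by (rule has_derivative_compose[where f = "\<lambda>s. (a s, b s)" and g = f,
          OF _ has_derivative_dth_dph[OF assms(1)]])
  then show ?thesis unfolding has_field_derivative_def by (rule has_derivative_eq_rhs) (auto simp: algebra_simps)
qed

lemma DERIV_dth: "f differentiable (at (t, p)) \<Longrightarrow> ((\<lambda>s. f (s, p)) has_real_derivative dth f (t, p)) (at t)"
  using DERIV_along_curve[of f "\<lambda>s. s" t "\<lambda>s. p" 1 UNIV 0] by simp

lemma DERIV_dph: "f differentiable (at (t, p)) \<Longrightarrow> ((\<lambda>s. f (t, s)) has_real_derivative dph f (t, p)) (at p)"
  using DERIV_along_curve[of f "\<lambda>s. t" p "\<lambda>s. s" 0 UNIV 1] by simp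

lemma C1_on_continuous: "C1_on U f \<Longrightarrow> continuous_on U f"
  unfolding C1_on_def
  by (meson continuous_at_imp_continuous_on differentiable_imp_continuous_within)

text \<open>Schwarz's theorem: the second difference over a small square is evaluated by the mean
  value theorem in both orders, which gives equal mixed derivatives at two points near
  \<open>x\<close>.\<close>

lemma mixed_partials_commute:
  assumes U: "open U" and C2: "C2_on U f" and x: "x \<in> U"
  shows "dph (dth f) x = dth (dph f) x"
proof (rule ccontr)
  assume neq: "dph (dth f) x \<noteq> dth (dph f) x"
  define e where "e = \<bar>dph (dth f) x - dth (dph f) x\<bar> / 2"
  have e: "e > 0" using neq by (simp add: e_def)
  have diff: "f differentiable (at y)" "dth f differentiable (at y)" "dph f differentiable (at y)" if "y \<in> U" for y
    using C2 that by (auto simp: C2_on_def C1_on_def)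
  have "continuous (at x) (dph (dth f))" "continuous (at x) (dth (dph f))"
    using C2 x U by (auto simp: C2_on_def C1_on_def continuous_on_eq_continuous_at)
  note cont = this[unfolded continuous_at_eps_delta dist_real_def]
  obtain d1 where d1: "d1 > 0" "\<And>y. dist y x < d1 \<Longrightarrow> \<bar>dph (dth f) y - dph (dth f) x\<bar> < e"
    using cont(1) e by blast
  obtain d2 where d2: "d2 > 0" "\<And>y. dist y x < d2 \<Longrightarrow> \<bar>dth (dph f) y - dth (dph f) x\<bar> < e"
    using cont(2) e by blast
  note d = d1(1) d2(1) d1(2) d2(2)
  obtain d3 where d3: "d3 > 0" "ball x d3 \<subseteq> U" using U x openE by blast
  define h where "h = min d1 (min d2 d3) / 3"
  have h: "0 < h" "3 * h \<le> d1" "3 * h \<le> d2" "3 * h \<le> d3" using d d3 by (auto simp: h_def)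
  obtain a b where ab: "x = (a, b)" by fastforce
  have near: "dist (s, t) x < 3 * h" if "a \<le> s" "s \<le> a + h" "b \<le> t" "t \<le> b + h" for s t
  proof -
    have "dist (s, t) x \<le> \<bar>s - a\<bar> + \<bar>t - b\<bar>"
      unfolding ab dist_Pair_Pair dist_real_def by (rule sqrt_sum_squares_le_sum) auto
    then show ?thesis using that h(1) by auto
  qed
  have inU: "(s, t) \<in> U" if "a \<le> s" "s \<le> a + h" "b \<le> t" "t \<le> b + h" for s t
    using near[OF that] h(4) d3(2) by (auto simp: mem_ball dist_commute)
  define \<Delta> where "\<Delta> = f (a + h, b + h) - f (a + h, b) - f (a, b + h) + f (a, b)"
  have "\<exists>z. a < z \<and> z < a + h \<and> (f (a + h, b + h) - f (a + h, b)) - (f (a, b + h) - f (a, b))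
      = (a + h - a) * (dth f (z, b + h) - dth f (z, b))"
    using h(1) by (intro MVT2[of a "a + h" "\<lambda>s. f (s, b + h) - f (s, b)"])
      (auto intro!: DERIV_diff DERIV_dth diff inU)
  then obtain s1 where s1: "a < s1" "s1 < a + h" "\<Delta> = h * (dth f (s1, b + h) - dth f (s1, b))"
    by (auto simp: \<Delta>_def algebra_simps)
  have "\<exists>z. b < z \<and> z < b + h \<and> dth f (s1, b + h) - dth f (s1, b) = (b + h - b) * dph (dth f) (s1, z)"
    using h(1) s1 by (intro MVT2) (auto intro!: DERIV_dph diff inU)
  then obtain t1 where t1: "b < t1" "t1 < b + h" "\<Delta> = h * (h * dph (dth f) (s1, t1))"
    using s1 by auto
  have "\<exists>z. b < z \<and> z < b + h \<and> (f (a + h, b + h) - f (a, b + h)) - (f (a + h, b) - f (a, b))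
      = (b + h - b) * (dph f (a + h, z) - dph f (a, z))"
    using h(1) by (intro MVT2[of b "b + h" "\<lambda>s. f (a + h, s) - f (a, s)"])
      (auto intro!: DERIV_diff DERIV_dph diff inU)
  then obtain t2 where t2: "b < t2" "t2 < b + h" "\<Delta> = h * (dph f (a + h, t2) - dph f (a, t2))"
    by (auto simp: \<Delta>_def algebra_simps)
  have "\<exists>z. a < z \<and> z < a + h \<and> dph f (a + h, t2) - dph f (a, t2) = (a + h - a) * dth (dph f) (z, t2)"
    using h(1) t2 by (intro MVT2) (auto intro!: DERIV_dth diff inU)
  then obtain s2 where s2: "a < s2" "s2 < a + h" "\<Delta> = h * (h * dth (dph f) (s2, t2))"
    using t2 by auto
  have "dph (dth f) (s1, t1) = dth (dph f) (s2, t2)" using t1(3) s2(3) h(1) by simp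
  moreover have "dist (s1, t1) x < d1" "dist (s2, t2) x < d2"
    using near[of s1 t1] near[of s2 t2] s1 t1 s2 t2 h by auto
  ultimately have "\<bar>dph (dth f) x - dth (dph f) x\<bar> < e + e"
    using d(3)[of "(s1, t1)"] d(4)[of "(s2, t2)"] by linarith
  then show False by (simp add: e_def)
qed

text \<open>The boundary curve is approximated by its vertical translates into the region of
  differentiability.\<close>
lemma DERIV_along_boundary_curve:
  fixes f :: "real \<times> real \<Rightarrow> real" and G :: "real \<times> real \<Rightarrow> real \<times> real"
  assumes e: "e > 0"
    and inU: "\<And>h p. 0 < h \<Longrightarrow> h < e \<Longrightarrow> \<bar>p - p0\<bar> < e \<Longrightarrow> (c p + \<sigma> * h, p) \<in> U"
    and inC: "\<And>p. \<bar>p - p0\<bar> < e \<Longrightarrow> (c p, p) \<in> C"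
    and diff: "\<And>y. y \<in> U \<Longrightarrow> f differentiable (at y)"
    and G: "\<And>y. y \<in> U \<Longrightarrow> G y = cgrad f y" and contG: "continuous_on C G" and contf: "continuous_on C f"
    and UC: "U \<subseteq> C"
    and c: "\<And>p. (c has_real_derivative c' p) (at p)" and contc': "continuous_on UNIV c'"
  shows "((\<lambda>p. f (c p, p)) has_real_derivative fst (G (c p0, p0)) * c' p0 + snd (G (c p0, p0))) (at p0)"
proof -
  define L where "L = fst (G (c p0, p0)) * c' p0 + snd (G (c p0, p0))"
  define H where "H y = fst (G y) * c' (snd y) + snd (G y)" for y :: "real \<times> real"
  have contH: "continuous_on C H"
    unfolding H_def by (intro continuous_intros contG continuous_on_compose2[OF contc']) auto
  have cc: "continuous_on UNIV c" using c by (intro DERIV_continuous_on)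
  \<comment> \<open>The first coordinate of \<open>V\<close> is the distance of the translate, with
    0 for the curve itself; \<open>\<sigma>\<close> tells on which side of the curve
    \<open>U\<close> lies.\<close>
  define V where "V = {0..<e} \<times> {p. \<bar>p - p0\<bar> < e}"
  define sh where "sh y = (c (snd y) + \<sigma> * fst y, snd y)" for y :: "real \<times> real"
  have shC: "sh ` V \<subseteq> C"
  proof (rule image_subsetI)
    fix y assume "y \<in> V"
    then show "sh y \<in> C"
      using inU[of "fst y" "snd y"] inC[of "snd y"] UC
      by (cases "fst y = 0") (auto simp: V_def sh_def)
  qed
  have "continuous_on V sh" unfolding sh_def
    by (intro continuous_intros continuous_on_compose2[OF cc]) auto
  then have "continuous_on V (\<lambda>y. H (sh y))" "continuous_on V (\<lambda>y. f (sh y))"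
    using shC contH contf by (auto intro: continuous_on_compose2)
  note contV = this
  have LL: "H (sh (0, p0)) = L" by (simp add: H_def sh_def L_def)
  have p0V: "(0, p0) \<in> V" using e by (simp add: V_def)
  have main: "\<exists>d>0. \<forall>q. q \<noteq> p0 \<and> dist q p0 < d \<longrightarrow> dist ((f (c q, q) - f (c p0, p0)) / (q - p0)) L < \<epsilon>"
    if \<epsilon>: "\<epsilon> > 0" for \<epsilon>
  proof -
    obtain d where d: "d > 0" "\<And>y. y \<in> V \<Longrightarrow> dist y (0, p0) < d \<Longrightarrow> dist (H (sh y)) L < \<epsilon> / 2"
      using contV(1) p0V \<epsilon> unfolding continuous_on_iff LL[symmetric] by (meson half_gt_zero)
    define r where "r = min e (d / 2)"
    have r: "0 < r" "r \<le> e" "r \<le> d / 2" using e d by (auto simp: r_def)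
    have small: "dist (H (sh (h, p))) L < \<epsilon> / 2" if "0 \<le> h" "h < r" "\<bar>p - p0\<bar> < r" for h p
    proof (rule d(2))
      show "(h, p) \<in> V" using that r by (auto simp: V_def)
      have "dist (h, p) (0, p0) \<le> \<bar>h\<bar> + \<bar>p - p0\<bar>"
        unfolding dist_Pair_Pair dist_real_def using sqrt_sum_squares_le_sum_abs[of h "p - p0"] by simp
      then show "dist (h, p) (0, p0) < d" using that r by auto
    qed
    \<comment> \<open>On a translate inside \<open>U\<close> the mean value inequality applies. Its
      bound does not depend on \<open>h\<close>, so it survives the limit in
      \<open>est0\<close>.\<close>
    have est: "\<bar>f (sh (h, q)) - f (sh (h, p0)) - L * (q - p0)\<bar> \<le> \<epsilon> / 2 * \<bar>q - p0\<bar>"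
      if h: "0 < h" "h < r" and q: "\<bar>q - p0\<bar> < r" for h q
    proof -
      have der: "((\<lambda>p. f (sh (h, p))) has_real_derivative H (sh (h, p))) (at p)" if "\<bar>p - p0\<bar> < r" for p
      proof -
        have U: "(c p + \<sigma> * h, p) \<in> U" using inU h that r by auto
        have "((\<lambda>p. f (c p + \<sigma> * h, p)) has_real_derivative
          dth f (c p + \<sigma> * h, p) * (c' p + 0) + dph f (c p + \<sigma> * h, p) * 1) (at p)"
          by (rule DERIV_along_curve) (auto intro!: derivative_eq_intros c diff U)
        then show ?thesis using G[OF U] by (simp add: H_def sh_def cgrad_def)
      qed
      define g where "g p = f (sh (h, p)) - L * p" for p
      have gder: "(g has_real_derivative H (sh (h, p)) - L) (at p)" if "\<bar>p - p0\<bar> < r" for p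
        unfolding g_def using der[OF that] by (auto intro!: derivative_eq_intros)
      have "norm (g q - g p0) \<le> \<epsilon> / 2 * norm (q - p0)"
      proof (rule field_differentiable_bound[where S = "{p. \<bar>p - p0\<bar> < r}" and f = g
            and f' = "\<lambda>p. H (sh (h, p)) - L" and B = "\<epsilon> / 2"])
        have "{p. \<bar>p - p0\<bar> < r} = ball p0 r" by (auto simp: dist_real_def)
        then show "convex {p. \<bar>p - p0\<bar> < r}" by simp
        show "(g has_field_derivative H (sh (h, p)) - L) (at p within {p. \<bar>p - p0\<bar> < r})"
          if "p \<in> {p. \<bar>p - p0\<bar> < r}" for p
          using gder that by (auto intro: has_field_derivative_at_within)
        show "norm (H (sh (h, p)) - L) \<le> \<epsilon> / 2" if "p \<in> {p. \<bar>p - p0\<bar> < r}" for p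
          using small[of h p] that h by (auto simp: dist_real_def)
      qed (use q r in auto)
      then show ?thesis by (simp add: g_def algebra_simps)
    qed
    have est0: "\<bar>f (c q, q) - f (c p0, p0) - L * (q - p0)\<bar> \<le> \<epsilon> / 2 * \<bar>q - p0\<bar>" if q: "\<bar>q - p0\<bar> < r" for q
    proof -
      have lim: "((\<lambda>h. f (sh (h, p))) \<longlongrightarrow> f (sh (0, p))) (at_right 0)" if "\<bar>p - p0\<bar> < r" for p
      proof -
        have "continuous_on {0..<e} (\<lambda>h. f (sh (h, p)))"
          using that r by (intro continuous_on_compose2[OF contV(2)] continuous_intros) (auto simp: V_def)
        then have "((\<lambda>h. f (sh (h, p))) \<longlongrightarrow> f (sh (0, p))) (at 0 within {0..<e})"
          using e by (auto simp: continuous_on_def)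
        moreover have "at 0 within {0..<e} = at_right (0::real)"
          using e by (intro at_within_nhd[of _ "{-e<..<e}"]) auto
        ultimately show ?thesis by simp
      qed
      have "((\<lambda>h. \<bar>f (sh (h, q)) - f (sh (h, p0)) - L * (q - p0)\<bar>) \<longlongrightarrow>
         \<bar>f (sh (0, q)) - f (sh (0, p0)) - L * (q - p0)\<bar>) (at_right 0)"
        using q r by (intro tendsto_intros lim) auto
      moreover have "\<forall>\<^sub>F h in at_right 0. \<bar>f (sh (h, q)) - f (sh (h, p0)) - L * (q - p0)\<bar> \<le> \<epsilon> / 2 * \<bar>q - p0\<bar>"
        using r est q unfolding eventually_at_right_field by blast
      ultimately have "\<bar>f (sh (0, q)) - f (sh (0, p0)) - L * (q - p0)\<bar> \<le> \<epsilon> / 2 * \<bar>q - p0\<bar>"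
        by (intro tendsto_upperbound) auto
      then show ?thesis by (simp add: sh_def)
    qed
    show ?thesis
    proof (intro exI[of _ r] conjI allI impI r(1))
      fix q assume q: "q \<noteq> p0 \<and> dist q p0 < r"
      then have pos: "\<bar>q - p0\<bar> > 0" by simp
      have "\<bar>f (c q, q) - f (c p0, p0) - L * (q - p0)\<bar> \<le> \<epsilon> / 2 * \<bar>q - p0\<bar>"
        using est0[of q] q by (simp add: dist_real_def)
      also have "\<dots> < \<epsilon> * \<bar>q - p0\<bar>" using \<epsilon> pos by simp
      finally have lt: "\<bar>f (c q, q) - f (c p0, p0) - L * (q - p0)\<bar> / \<bar>q - p0\<bar> < \<epsilon>"
        using pos by (simp add: pos_divide_less_eq)
      have "(f (c q, q) - f (c p0, p0)) / (q - p0) - L = (f (c q, q) - f (c p0, p0) - L * (q - p0)) / (q - p0)"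
        using q by (simp add: field_simps)
      then show "dist ((f (c q, q) - f (c p0, p0)) / (q - p0)) L < \<epsilon>"
        using lt by (simp add: dist_real_def abs_divide)
    qed
  qed
  have "((\<lambda>q. (f (c q, q) - f (c p0, p0)) / (q - p0)) \<longlongrightarrow> L) (at p0)"
    using main unfolding LIM_def by blast
  then show ?thesis unfolding L_def has_field_derivative_iff .
qed

section \<open>The equation in non-divergence form\<close>

definition gsq :: "real \<Rightarrow> real \<times> real \<Rightarrow> real" where
  "gsq t g = (fst g)\<^sup>2 + (snd g / sin t)\<^sup>2"

lemma gnorm_sq: "(gnorm t g)\<^sup>2 = gsq t g"
  by (simp add: gnorm_def onb_def gsq_def norm_Pair power_divide)

lemma gnorm_nonneg: "0 \<le> gnorm t g" by (simp add: gnorm_def)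

lemma gsq_nonneg: "0 \<le> gsq t g" by (simp add: gsq_def)

context gas begin

lemma rho_gnorm: "rho \<gamma> c0 (gnorm t g) = rr (gsq t g)"
  by (simp add: rho_eq_rho2 gnorm_sq)

text \<open>Metric factors are absorbed, so that the equation becomes a plain divergence in the
  coordinates and mass flux through a curve is a line integral without further weights.\<close>

definition mflux_th :: "(real \<times> real \<Rightarrow> real) \<Rightarrow> real \<times> real \<Rightarrow> real" where
  "mflux_th f y = sin (fst y) * rr (gsq (fst y) (cgrad f y)) * dth f y"

definition mflux_ph :: "(real \<times> real \<Rightarrow> real) \<Rightarrow> real \<times> real \<Rightarrow> real" where
  "mflux_ph f y = rr (gsq (fst y) (cgrad f y)) / sin (fst y) * dph f y"

lemma flow_eq_iff:
  "sin (fst x) \<noteq> 0 \<Longrightarrow> flow_eq \<gamma> c0 f x \<longleftrightarrow> dth (mflux_th f) x + dph (mflux_ph f) x = 0"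
  unfolding flow_eq_def mflux_th_def[abs_def] mflux_ph_def[abs_def] rho_gnorm by simp

text \<open>One rule for both coordinate directions: \<open>S\<close> is the sine along a meridian
  and a constant along a parallel.\<close>

lemma DERIV_density_along:
  assumes u: "(u has_real_derivative u') (at s)" and w: "(w has_real_derivative w') (at s)"
    and S: "(S has_real_derivative S') (at s)" "S s \<noteq> 0"
    and y: "(u s)\<^sup>2 + (w s / S s)\<^sup>2 < qm\<^sup>2"
  shows "((\<lambda>s. rr ((u s)\<^sup>2 + (w s / S s)\<^sup>2)) has_real_derivative
     - (rr ((u s)\<^sup>2 + (w s / S s)\<^sup>2) / cc ((u s)\<^sup>2 + (w s / S s)\<^sup>2)) *
       (u s * u' + w s / S s * (w' / S s - w s * S' / (S s)\<^sup>2))) (at s)"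
proof -
  have "((\<lambda>s. (u s)\<^sup>2 + (w s / S s)\<^sup>2) has_real_derivative
     2 * (u s * u' + w s / S s * (w' / S s - w s * S' / (S s)\<^sup>2))) (at s)"
    using S(2) by (auto intro!: derivative_eq_intros u w S(1) simp: field_simps power2_eq_square)
  note D = DERIV_chain2[where f = rr, OF DERIV_rr[OF y] this]
  have cancel: "- r / (2 * c) * (2 * Z) = - (r / c) * Z" for r c Z :: real by simp
  from D show ?thesis
    by (rule DERIV_cong) (simp only: cancel)
qed

text \<open>The derivatives of \<open>mflux_th\<close> in \<theta> and of \<open>mflux_ph\<close> in
  the longitude give the non-divergence form; the derivative of \<open>mflux_ph\<close> in \<theta>
  is for differentiating the flux through a moving curve under the integral.\<close>

lemma mflux_partials:
  assumes U: "open U" and C2: "C2_on U f" and x: "(t, p) \<in> U" and S: "sin t \<noteq> 0"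
    and y: "gsq t (cgrad f (t, p)) < qm\<^sup>2"
  defines "u \<equiv> dth f (t, p)" and "w \<equiv> dph f (t, p)" and "a \<equiv> dth (dth f) (t, p)"
    and "b \<equiv> dth (dph f) (t, p)" and "d \<equiv> dph (dph f) (t, p)" and "Y \<equiv> gsq t (cgrad f (t, p))"
  shows "mflux_th f differentiable (at (t, p))" "mflux_ph f differentiable (at (t, p))"
    "dth (mflux_th f) (t, p) = rr Y * (cos t * u + sin t * a
        - sin t * u / cc Y * (u * a + w / sin t * (b / sin t - w * cos t / (sin t)\<^sup>2)))" (is ?A)
    "dth (mflux_ph f) (t, p) = rr Y * (b / sin t - w * cos t / (sin t)\<^sup>2
        - w / sin t / cc Y * (u * a + w / sin t * (b / sin t - w * cos t / (sin t)\<^sup>2)))" (is ?B)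
    "dph (mflux_ph f) (t, p) = rr Y * (d / sin t
        - w / sin t / cc Y * (u * b + w / sin t * (d / sin t)))" (is ?C)
proof -
  have diff: "dth f differentiable (at (t, p))" "dph f differentiable (at (t, p))"
    using C2 x by (auto simp: C2_on_def C1_on_def)
  have sd: "(\<lambda>y. sin (fst y)) differentiable (at (t, p))"
    unfolding differentiable_def by (rule exI, (rule derivative_eq_intros refl)+)
  have Yd: "(\<lambda>y. gsq (fst y) (cgrad f y)) differentiable (at (t, p))"
    unfolding gsq_def cgrad_def fst_conv snd_conv
    using diff sd S by (intro derivative_intros) auto
  have "rr differentiable (at Y)"
    using DERIV_rr[OF y] by (auto simp: Y_def real_differentiable_def)
  then have rd: "(\<lambda>y. rr (gsq (fst y) (cgrad f y))) differentiable (at (t, p))"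
    using differentiable_compose[OF _ Yd, of rr] by (simp add: Y_def)
  show "mflux_th f differentiable (at (t, p))" "mflux_ph f differentiable (at (t, p))"
    unfolding mflux_th_def[abs_def] mflux_ph_def[abs_def] using rd sd diff S
    by (intro derivative_intros; simp)+
  have der: "((\<lambda>s. dth f (s, p)) has_real_derivative a) (at t)"
     "((\<lambda>s. dph f (s, p)) has_real_derivative b) (at t)"
     "((\<lambda>s. dth f (t, s)) has_real_derivative b) (at p)"
     "((\<lambda>s. dph f (t, s)) has_real_derivative d) (at p)"
    using DERIV_dth[OF diff(1)] DERIV_dth[OF diff(2)] DERIV_dph[OF diff(1)] DERIV_dph[OF diff(2)]
      mixed_partials_commute[OF U C2 x] by (auto simp: a_def b_def d_def)
  have Y: "(dth f (t, p))\<^sup>2 + (dph f (t, p) / sin t)\<^sup>2 < qm\<^sup>2"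
     "Y = (dth f (t, p))\<^sup>2 + (dph f (t, p) / sin t)\<^sup>2"
    using y by (auto simp: gsq_def cgrad_def Y_def)
  have cY: "cc Y > 0" using Y cc_pos_iff by auto
  have fold: "u\<^sup>2 + (w / sin t)\<^sup>2 = Y" using Y(2) by (simp add: u_def w_def)
  have exp: "mflux_th f = (\<lambda>y. sin (fst y) * rr ((dth f y)\<^sup>2 + (dph f y / sin (fst y))\<^sup>2) * dth f y)"
     "mflux_ph f = (\<lambda>y. rr ((dth f y)\<^sup>2 + (dph f y / sin (fst y))\<^sup>2) / sin (fst y) * dph f y)"
    by (auto simp: mflux_th_def mflux_ph_def gsq_def cgrad_def)
  note R1 = DERIV_density_along[OF der(1,2) DERIV_sin S Y(1)]
  note R2 = DERIV_density_along[OF der(3,4) DERIV_const S Y(1)]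
  show ?A
    unfolding dth_def[of "mflux_th f"] unfolding exp fst_conv snd_conv
    by (rule DERIV_imp_deriv, rule DERIV_cong[OF DERIV_mult[OF DERIV_mult[OF DERIV_sin R1] der(1)]])
      (simp only: u_def[symmetric] w_def[symmetric] fold,
        use S cY in \<open>simp add: divide_simps power2_eq_square, simp add: algebra_simps\<close>)
  show ?B
    unfolding dth_def[of "mflux_ph f"] unfolding exp fst_conv snd_conv
    by (rule DERIV_imp_deriv, rule DERIV_cong[OF DERIV_mult[OF DERIV_divide[OF R1 DERIV_sin S] der(2)]])
      (simp only: u_def[symmetric] w_def[symmetric] fold,
        use S cY in \<open>simp add: divide_simps power2_eq_square, simp add: algebra_simps\<close>)
  show ?C
    unfolding dph_def[of "mflux_ph f"] unfolding exp fst_conv snd_conv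
    by (rule DERIV_imp_deriv, rule DERIV_cong[OF DERIV_mult[OF DERIV_cdivide[OF R2] der(4)]])
      (simp only: u_def[symmetric] w_def[symmetric] fold,
        use S cY in \<open>simp add: divide_simps power2_eq_square, simp add: algebra_simps\<close>)
qed

text \<open>Arises by dividing by the density and multiplying by c^2. Here \<open>b\<close> and
  \<open>d\<close> are scaled coordinate derivatives: the \<theta>-derivative of \<open>v\<close> is
  \<open>b - v * cot t\<close>, and the last term on the right comes from this difference.\<close>

lemma flow_eq_nondivergence:
  assumes U: "open U" and C2: "C2_on U f" and x: "(t, p) \<in> U" and S: "sin t \<noteq> 0"
    and y: "gsq t (cgrad f (t, p)) < qm\<^sup>2" and eq: "flow_eq \<gamma> c0 f (t, p)"
  defines "u \<equiv> dth f (t, p)" and "v \<equiv> dph f (t, p) / sin t" and "a \<equiv> dth (dth f) (t, p)"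
    and "b \<equiv> dth (dph f) (t, p) / sin t" and "d \<equiv> dph (dph f) (t, p) / (sin t)\<^sup>2"
  shows "cc (u\<^sup>2 + v\<^sup>2) * (cot t * u + a + d) = u\<^sup>2 * a + 2 * u * v * b + v\<^sup>2 * d - u * v\<^sup>2 * cot t"
proof -
  define k where "k = cc (u\<^sup>2 + v\<^sup>2)"
  have Y: "gsq t (cgrad f (t, p)) = u\<^sup>2 + v\<^sup>2" by (simp add: gsq_def cgrad_def u_def v_def)
  have k: "k > 0" "rr (u\<^sup>2 + v\<^sup>2) \<noteq> 0" using y cc_pos_iff rr_pos[OF y] unfolding Y k_def by auto
  have w: "dph f (t, p) = v * sin t" "dth (dph f) (t, p) = b * sin t" "dph (dph f) (t, p) = d * (sin t)\<^sup>2"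
    using S by (auto simp: v_def b_def d_def)
  have c: "cos t = cot t * sin t" using S by (simp add: cot_def)
  have "dth (mflux_th f) (t, p) + dph (mflux_ph f) (t, p) = 0" using eq flow_eq_iff[of "(t, p)" f] S by simp
  then have "rr (u\<^sup>2 + v\<^sup>2) * (cos t * u + sin t * a
        - sin t * u / k * (u * a + v * (b - v * cot t)) + (d * sin t - v / k * (u * (b * sin t) + v * (d * sin t)))) = 0"
    unfolding mflux_partials(3,5)[OF U C2 x S y] unfolding Y w unfolding k_def u_def[symmetric] a_def[symmetric]
    using S by (simp add: c field_simps power2_eq_square)
  then have h1: "k * (cos t * u + sin t * a
        - sin t * u / k * (u * a + v * (b - v * cot t)) + (d * sin t - v / k * (u * (b * sin t) + v * (d * sin t)))) = 0"
    using k by simp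
  have h2: "k * (cos t * u + sin t * a
        - sin t * u / k * (u * a + v * (b - v * cot t)) + (d * sin t - v / k * (u * (b * sin t) + v * (d * sin t))))
     = sin t * (k * (cot t * u + a + d) - (u\<^sup>2 * a + 2 * u * v * b + v\<^sup>2 * d - u * v\<^sup>2 * cot t))"
    using k(1) by (simp add: c field_simps power2_eq_square)
  have "sin t * (k * (cot t * u + a + d) - (u\<^sup>2 * a + 2 * u * v * b + v\<^sup>2 * d - u * v\<^sup>2 * cot t)) = 0"
    unfolding h2[symmetric] by (rule h1)
  then show ?thesis using S by (simp add: k_def)
qed

end

text \<open>The left-hand side is the derivative of a Riemann invariant in the characteristic direction
  \<open>(\<mu> u + \<sigma> v, \<mu> v - \<sigma> u)\<close>: the second derivatives of the potential cancel.\<close>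
lemma characteristic_identity:
  fixes u v a b d k ct \<mu> \<sigma> :: real
  assumes pde: "k * (ct * u + a + d) = u\<^sup>2 * a + 2 * u * v * b + v\<^sup>2 * d - u * v\<^sup>2 * ct"
    and k: "k > 0" and mu: "\<mu>\<^sup>2 * k = u\<^sup>2 + v\<^sup>2 - k" and sg: "\<sigma>\<^sup>2 = 1" and y: "u\<^sup>2 + v\<^sup>2 \<noteq> 0"
  defines "Xu \<equiv> (\<mu> * u + \<sigma> * v) * a + (\<mu> * v - \<sigma> * u) * b"
    and "Xv \<equiv> (\<mu> * u + \<sigma> * v) * (b - v * ct) + (\<mu> * v - \<sigma> * u) * d"
  shows "(\<mu> * (u * Xu + v * Xv) + \<sigma> * (u * Xv - v * Xu)) / (u\<^sup>2 + v\<^sup>2) = ct * (u - \<sigma> * \<mu> * v)"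
proof -
  have "k * (\<mu> * (u * Xu + v * Xv) + \<sigma> * (u * Xv - v * Xu)) = k * (ct * (u - \<sigma> * \<mu> * v) * (u\<^sup>2 + v\<^sup>2))"
    unfolding Xu_def Xv_def using pde mu sg by algebra
  then have "\<mu> * (u * Xu + v * Xv) + \<sigma> * (u * Xv - v * Xu) = ct * (u - \<sigma> * \<mu> * v) * (u\<^sup>2 + v\<^sup>2)"
    using k by simp
  then show ?thesis using y by simp
qed

section \<open>Prandtl-Meyer function and Rankine-Hugoniot algebra\<close>

context gas begin

text \<open>\<open>mu\<close> is the square root of \<open>M\<^sup>2 - 1\<close> for the Mach number \<open>M\<close>, and \<open>nu\<close> is the
  Prandtl-Meyer function.\<close>

definition mu :: "real \<Rightarrow> real" where "mu q = sqrt (q\<^sup>2 / cc (q\<^sup>2) - 1)"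

definition nu :: "real \<Rightarrow> real" where
  "nu = (SOME F. \<forall>q\<in>{cs<..<qm}. (F has_real_derivative mu q / q) (at q))"

lemma supersonic:
  assumes "q \<in> {cs<..<qm}"
  shows "0 < q" "cs\<^sup>2 < q\<^sup>2" "q\<^sup>2 < qm\<^sup>2" "0 < cc (q\<^sup>2)" "cc (q\<^sup>2) < q\<^sup>2" "0 < mu q"
    "(mu q)\<^sup>2 * cc (q\<^sup>2) = q\<^sup>2 - cc (q\<^sup>2)"
proof -
  show q: "0 < q" "cs\<^sup>2 < q\<^sup>2" "q\<^sup>2 < qm\<^sup>2"
    using assms cs_pos by (auto simp: power_strict_mono)
  then show c: "0 < cc (q\<^sup>2)" "cc (q\<^sup>2) < q\<^sup>2" using cc_pos_iff cc_less_iff by auto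
  then show "0 < mu q" by (simp add: mu_def)
  have "q\<^sup>2 / cc (q\<^sup>2) - 1 \<ge> 0" using c by simp
  then show "(mu q)\<^sup>2 * cc (q\<^sup>2) = q\<^sup>2 - cc (q\<^sup>2)" using c by (simp add: mu_def field_simps)
qed

lemma continuous_on_mu: "continuous_on {cs<..<qm} mu"
proof -
  have "continuous_on {cs<..<qm} (\<lambda>q. cc (q\<^sup>2))" unfolding csq2_def by (intro continuous_intros)
  then show ?thesis unfolding mu_def
    using supersonic(4) by (intro continuous_intros) force+
qed

text \<open>Only differences of values of \<open>nu\<close> are ever compared, so the constant of
  integration can stay undetermined.\<close>

lemma DERIV_nu: "q \<in> {cs<..<qm} \<Longrightarrow> (nu has_real_derivative mu q / q) (at q)"
proof -
  have "\<exists>F. \<forall>x::real. ereal cs < x \<longrightarrow> x < ereal qm \<longrightarrow> (F has_vector_derivative mu x / x) (at x)"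
  proof (rule einterval_antiderivative)
    fix x :: real assume "ereal cs < ereal x" "ereal x < ereal qm"
    then have x: "x \<in> {cs<..<qm}" by simp
    then have "isCont mu x" using continuous_on_mu by (simp add: continuous_on_eq_continuous_at)
    then show "isCont (\<lambda>x. mu x / x) x" using supersonic(1)[OF x] by (intro continuous_intros) auto
  qed (use cs_less_qm in simp)
  then have "\<exists>F. \<forall>q\<in>{cs<..<qm}. (F has_real_derivative mu q / q) (at q)"
    unfolding has_real_derivative_iff_has_vector_derivative
    by (metis ereal_less_eq(3) greaterThanLessThan_iff not_le)
  from someI_ex[OF this] show "q \<in> {cs<..<qm} \<Longrightarrow> (nu has_real_derivative mu q / q) (at q)"
    unfolding nu_def by blast
qed

text \<open>The transport equations contain \<open>mu\<close>, while deviations are measured in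
  \<open>nu\<close>. On a compact range of supersonic speeds the derivative of \<open>mu\<close> is
  bounded and that of \<open>nu\<close> is bounded below by a positive number. The range must avoid
  \<open>cs\<close>, where \<open>mu\<close> vanishes like a square root.\<close>

lemma mu_Lipschitz_nu:
  assumes q: "cs < q1" "q2 < qm"
  obtains C where "0 \<le> C" "\<And>x y. x \<in> {q1..q2} \<Longrightarrow> y \<in> {q1..q2} \<Longrightarrow> \<bar>mu x - mu y\<bar> \<le> C * \<bar>nu x - nu y\<bar>"
proof (cases "q1 \<le> q2")
  case True
  have sub: "{q1..q2} \<subseteq> {cs<..<qm}" using q by auto
  define dmu where "dmu q = (2 * q * cc (q\<^sup>2) + q\<^sup>2 * ((\<gamma> - 1) * q)) / (cc (q\<^sup>2))\<^sup>2 / (2 * mu q)" for q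
  have ccd: "((\<lambda>q. cc (q\<^sup>2)) has_real_derivative - ((\<gamma> - 1) * q)) (at q)" for q
    unfolding csq2_def by (auto intro!: derivative_eq_intros)
  have dmu: "(mu has_real_derivative dmu q) (at q)" if "q \<in> {cs<..<qm}" for q
  proof -
    note s = supersonic[OF that]
    have pos: "q\<^sup>2 / cc (q\<^sup>2) - 1 > 0" using s by simp
    have "((\<lambda>q. q\<^sup>2 / cc (q\<^sup>2) - 1) has_real_derivative
        (2 * q * cc (q\<^sup>2) + q\<^sup>2 * ((\<gamma> - 1) * q)) / (cc (q\<^sup>2))\<^sup>2) (at q)"
      by (rule DERIV_cong[OF DERIV_diff[OF DERIV_divide[OF DERIV_power[OF DERIV_ident, of 2] ccd] DERIV_const]])
        (use s in \<open>auto simp: power2_eq_square\<close>)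
    from DERIV_chain2[OF DERIV_real_sqrt[OF pos] this] show ?thesis
      unfolding mu_def[abs_def] dmu_def by (rule DERIV_cong) (simp add: mu_def field_simps)
  qed
  have cc_c: "continuous_on {q1..q2} (\<lambda>q. cc (q\<^sup>2))" unfolding csq2_def by (intro continuous_intros)
  have mu_c: "continuous_on {q1..q2} mu" using continuous_on_mu sub continuous_on_subset by blast
  have nz: "cc (q\<^sup>2) \<noteq> 0" "mu q \<noteq> 0" "q \<noteq> 0" if "q \<in> {q1..q2}" for q
    using supersonic(1,4,6)[of q] that sub by auto
  have "continuous_on {q1..q2} dmu" unfolding dmu_def
    using nz by (intro continuous_intros cc_c mu_c) auto
  then have "compact (dmu ` {q1..q2})" by (intro compact_continuous_image compact_Icc)
  then obtain M where M: "\<And>q. q \<in> {q1..q2} \<Longrightarrow> \<bar>dmu q\<bar> \<le> M"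
    using compact_imp_bounded bounded_real by (metis imageI)
  have "continuous_on {q1..q2} (\<lambda>q. mu q / q)"
    using nz by (intro continuous_intros mu_c) auto
  then obtain q0 where q0: "q0 \<in> {q1..q2}" "\<And>q. q \<in> {q1..q2} \<Longrightarrow> mu q0 / q0 \<le> mu q / q"
    using continuous_attains_inf[of "{q1..q2}" "\<lambda>q. mu q / q"] True by (metis atLeastAtMost_iff compact_Icc empty_iff order_refl)
  define m where "m = mu q0 / q0"
  have m: "m > 0" using supersonic(1,6)[of q0] q0 sub by (auto simp: m_def)
  have M0: "0 \<le> M" using M[of q1] True by (force intro: order_trans[OF abs_ge_zero])
  have le: "\<bar>mu x - mu y\<bar> \<le> M / m * \<bar>nu x - nu y\<bar>" if xy: "x \<in> {q1..q2}" "y \<in> {q1..q2}" "x < y" for x y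
  proof -
    have "\<exists>z. x < z \<and> z < y \<and> mu y - mu x = (y - x) * dmu z"
      using xy sub by (intro MVT2 dmu) (auto simp: subset_eq)
    then obtain z where "x < z" "z < y" and z2: "mu y - mu x = (y - x) * dmu z" by blast
    then have z: "z \<in> {q1..q2}" "mu y - mu x = (y - x) * dmu z" using xy by auto
    have "\<exists>z. x < z \<and> z < y \<and> nu y - nu x = (y - x) * (mu z / z)"
      using xy sub by (intro MVT2 DERIV_nu) (auto simp: subset_eq)
    then obtain z' where "x < z'" "z' < y" and z2': "nu y - nu x = (y - x) * (mu z' / z')" by blast
    then have z': "z' \<in> {q1..q2}" "nu y - nu x = (y - x) * (mu z' / z')" using xy by auto
    have "\<bar>mu x - mu y\<bar> = (y - x) * \<bar>dmu z\<bar>" using z xy by (simp add: abs_minus_commute[of "mu x"] abs_mult)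
    also have "\<dots> \<le> (y - x) * M" using M[OF z(1)] xy by (intro mult_left_mono) auto
    also have "\<dots> = M / m * ((y - x) * m)" using m by simp
    also have "\<dots> \<le> M / m * ((y - x) * (mu z' / z'))"
      using q0(2)[OF z'(1)] M0 m xy unfolding m_def[symmetric] by (intro mult_left_mono) auto
    also have "\<dots> \<le> M / m * \<bar>nu x - nu y\<bar>"
      unfolding z'(2)[symmetric] using M0 m by (intro mult_left_mono) auto
    finally show ?thesis .
  qed
  have "\<bar>mu x - mu y\<bar> \<le> M / m * \<bar>nu x - nu y\<bar>" if xy: "x \<in> {q1..q2}" "y \<in> {q1..q2}" for x y
    using le[of x y] le[of y x] xy by (cases x y rule: linorder_cases) (auto simp: abs_minus_commute)
  then show ?thesis using that[of "M / m"] M0 m by auto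
qed (use that in auto)

lemma nu_inject:
  assumes "x \<in> {cs<..<qm}" "y \<in> {cs<..<qm}" "nu x = nu y"
  shows "x = y"
proof -
  have False if xy: "x \<in> {cs<..<qm}" "y \<in> {cs<..<qm}" "x < y" "nu x = nu y" for x y
  proof -
    have "\<exists>z. x < z \<and> z < y \<and> nu y - nu x = (y - x) * (mu z / z)"
      using xy by (intro MVT2 DERIV_nu) auto
    then obtain z where "x < z" "z < y" "mu z / z = 0" using xy by auto
    then show False using supersonic(1,6)[of z] xy by auto
  qed
  then show ?thesis using assms by (metis linorder_cases)
qed

text \<open>The number \<open>s\<close> is the slope of the shock in the orthonormal frame, so that \<open>(1, -s)\<close> is normal
  and \<open>(s, 1)\<close> is tangent to it.\<close>
lemma shock_normally_supersonic:
  assumes rh: "rr (u\<^sup>2 + v\<^sup>2) * (u - v * s) = rr (u'\<^sup>2 + v'\<^sup>2) * (u' - v' * s)"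
    and tang: "u * s + v = u' * s + v'"
    and sup: "cs\<^sup>2 < u\<^sup>2 + v\<^sup>2" and sub: "u'\<^sup>2 + v'\<^sup>2 \<le> cs\<^sup>2"
  shows "cc (u\<^sup>2 + v\<^sup>2) * (1 + s\<^sup>2) < (u - v * s)\<^sup>2"
proof (rule ccontr)
  define n where "n = sqrt (1 + s\<^sup>2)"
  have n: "n > 0" "n\<^sup>2 = 1 + s\<^sup>2" by (auto simp: n_def add_pos_nonneg)
  \<comment> \<open>Normal velocities \<open>x\<close>, \<open>x'\<close> and the common tangential
    velocity \<open>\<tau>\<close>, from rotating the frame into the shock direction.\<close>
  define x where "x = (u - v * s) / n"
  define x' where "x' = (u' - v' * s) / n"
  define \<tau> where "\<tau> = (u * s + v) / n"
  have sq: "((a - b * s) / n)\<^sup>2 + ((a * s + b) / n)\<^sup>2 = a\<^sup>2 + b\<^sup>2" for a b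
  proof -
    have "(a - b * s)\<^sup>2 + (a * s + b)\<^sup>2 = (a\<^sup>2 + b\<^sup>2) * n\<^sup>2" unfolding n(2) by algebra
    then show ?thesis using n(1) by (simp add: power_divide add_divide_distrib[symmetric])
  qed
  have q: "x\<^sup>2 + \<tau>\<^sup>2 = u\<^sup>2 + v\<^sup>2" "x'\<^sup>2 + \<tau>\<^sup>2 = u'\<^sup>2 + v'\<^sup>2"
    using sq[of u v] sq[of u' v'] by (simp_all add: x_def x'_def \<tau>_def tang)
  \<comment> \<open>If the upstream normal velocity were at most sonic, so would be the downstream
    one, because a smaller speed has a larger sonic speed. On such states the normal flux is
    injective, so there would be no jump.\<close>
  assume "\<not> cc (u\<^sup>2 + v\<^sup>2) * (1 + s\<^sup>2) < (u - v * s)\<^sup>2"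
  then have "(u - v * s)\<^sup>2 \<le> cc (u\<^sup>2 + v\<^sup>2) * n\<^sup>2" unfolding n(2) by simp
  then have xle: "x\<^sup>2 \<le> cc (x\<^sup>2 + \<tau>\<^sup>2)"
    unfolding q unfolding x_def power_divide using n(1) by (simp add: divide_le_eq)
  have lt: "x'\<^sup>2 < x\<^sup>2" using sup sub q by linarith
  have "cc (x\<^sup>2 + \<tau>\<^sup>2) \<le> cc (x'\<^sup>2 + \<tau>\<^sup>2)"
    using lt gamma by (simp add: csq2_def)
  then have xle': "x'\<^sup>2 \<le> cc (x'\<^sup>2 + \<tau>\<^sup>2)" using xle lt by linarith
  have "rr (x\<^sup>2 + \<tau>\<^sup>2) * x = rr (x'\<^sup>2 + \<tau>\<^sup>2) * x'"
    unfolding q unfolding x_def x'_def using rh by simp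
  then have "x = x'"
    using normal_flux_strict_mono[of x x' \<tau>] normal_flux_strict_mono[of x' x \<tau>] xle xle'
    by (metis less_irrefl linorder_neqE_linordered_idom)
  then show False using lt by simp
qed

text \<open>Up to the factor \<open>sqrt (1 + s\<^sup>2)\<close> the claim reads:
  \<open>\<mu>\<close> times the normal velocity plus \<open>\<sigma>\<close> times the tangential
  velocity is positive. Since the squared speed is \<open>(\<mu>\<^sup>2 + 1) * k\<close>, a normal
  velocity above the sonic speed forces the tangential one below \<open>\<mu>\<close> times the
  normal one.\<close>

lemma shock_spacelike:
  assumes n: "k * (1 + s\<^sup>2) < (u - v * s)\<^sup>2" and u: "u > 0" and v: "v\<^sup>2 < k"
    and mu: "\<mu> > 0" "\<mu>\<^sup>2 * k = u\<^sup>2 + v\<^sup>2 - k" and sg: "\<sigma>\<^sup>2 = (1::real)"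
  shows "0 < \<mu> * u + \<sigma> * v - s * (\<mu> * v - \<sigma> * u)"
proof -
  have k: "k > 0" using v zero_le_power2[of v] by linarith
  \<comment> \<open>The sign of the normal velocity is not part of the supersonic condition; it
    follows because \<open>v\<close> is subsonic and \<open>u\<close> is positive.\<close>
  have pos: "0 < u - v * s"
  proof (rule ccontr)
    assume neg: "\<not> 0 < u - v * s"
    have "(v * s)\<^sup>2 \<le> k * s\<^sup>2" using v by (simp add: power_mult_distrib mult_right_mono)
    also have "\<dots> \<le> k * (1 + s\<^sup>2)" using k by simp
    also have "\<dots> < (v * s - u)\<^sup>2" using n by (simp add: power2_commute)
    also have "\<dots> \<le> (v * s)\<^sup>2" using neg u by (intro power_mono) auto
    finally show False by simp
  qed
  have "(v + u * s)\<^sup>2 + (u - v * s)\<^sup>2 = (u\<^sup>2 + v\<^sup>2) * (1 + s\<^sup>2)" by algebra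
  also have "\<dots> = (\<mu>\<^sup>2 + 1) * (k * (1 + s\<^sup>2))" using mu(2) by algebra
  also have "\<dots> < (\<mu>\<^sup>2 + 1) * (u - v * s)\<^sup>2"
    using n by (intro mult_strict_left_mono add_nonneg_pos) auto
  also have "\<dots> = (\<mu> * (u - v * s))\<^sup>2 + (u - v * s)\<^sup>2" by algebra
  finally have "(v + u * s)\<^sup>2 < (\<mu> * (u - v * s))\<^sup>2" by simp
  then have "\<bar>v + u * s\<bar> < \<mu> * (u - v * s)"
    using pos mu by (metis abs_of_pos mult_pos_pos power2_less_imp_less power2_abs less_imp_le)
  moreover have "\<bar>\<sigma>\<bar> = 1" using sg by (auto simp: power2_eq_1_iff)
  then have "\<bar>\<sigma> * (v + u * s)\<bar> = \<bar>v + u * s\<bar>" by (simp add: abs_mult)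
  ultimately have "0 < \<mu> * (u - v * s) + \<sigma> * (v + u * s)" by linarith
  then show ?thesis by (simp add: algebra_simps)
qed

text \<open>Differentiates \<open>mflux q * sin t = k t\<close>. Constant \<open>k\<close> gives the
  radial ODE; otherwise \<open>k'\<close> measures the failure to solve it. The factor
  \<open>cc - q\<^sup>2\<close> stays on the left so that one formula serves both branches.\<close>

lemma DERIV_radial_branch:
  assumes br: "(Q = qsub \<or> Q = qsup)" and k: "(k has_real_derivative k') (at t)"
    and S: "sin t \<noteq> 0" and r: "k t / sin t \<in> {0<..<mflux cs}"
  shows "\<exists>D. ((\<lambda>t. Q (k t / sin t)) has_real_derivative D) (at t) \<and>
    (cc ((Q (k t / sin t))\<^sup>2) - (Q (k t / sin t))\<^sup>2) * D =
      cc ((Q (k t / sin t))\<^sup>2) * (k' / (rr ((Q (k t / sin t))\<^sup>2) * sin t) - cot t * Q (k t / sin t))"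
proof -
  define q where "q = Q (k t / sin t)"
  have q: "q \<in> {0<..<cs} \<or> q \<in> {cs<..<qm}" "mflux q = k t / sin t"
    "(Q has_real_derivative 1 / (rr (q\<^sup>2) * (1 - q\<^sup>2 / cc (q\<^sup>2)))) (at (k t / sin t))"
    using br qsub[OF r] qsup[OF r] unfolding q_def by auto
  have ne: "q\<^sup>2 < qm\<^sup>2" "q\<^sup>2 \<noteq> cc (q\<^sup>2)"
  proof -
    show "q\<^sup>2 < qm\<^sup>2" using q(1) cs_less_qm cs_pos by (auto intro!: power_strict_mono)
    show "q\<^sup>2 \<noteq> cc (q\<^sup>2)"
      using q(1)
    proof
      assume "q \<in> {0<..<cs}"
      then have "q\<^sup>2 < cs\<^sup>2" by (auto intro!: power_strict_mono)
      then show ?thesis using less_cc_iff[of "q\<^sup>2"] by simp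
    next
      assume "q \<in> {cs<..<qm}" then show ?thesis using supersonic(5) by force
    qed
  qed
  have c: "cc (q\<^sup>2) > 0" "rr (q\<^sup>2) > 0" using ne cc_pos_iff rr_pos by auto
  have "((\<lambda>t. k t / sin t) has_real_derivative (k' * sin t - k t * cos t) / (sin t * sin t)) (at t)"
    by (rule DERIV_divide[OF k DERIV_sin S])
  from DERIV_chain2[OF q(3) this]
  have D: "((\<lambda>t. Q (k t / sin t)) has_real_derivative
     1 / (rr (q\<^sup>2) * (1 - q\<^sup>2 / cc (q\<^sup>2))) * ((k' * sin t - k t * cos t) / (sin t * sin t))) (at t)" .
  have kt: "k t = rr (q\<^sup>2) * q * sin t" using q(2) S by (simp add: mflux_def field_simps)
  have "(cc (q\<^sup>2) - q\<^sup>2) * (1 / (rr (q\<^sup>2) * (1 - q\<^sup>2 / cc (q\<^sup>2))) * ((k' * sin t - k t * cos t) / (sin t * sin t)))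
    = cc (q\<^sup>2) * ((k' * sin t - k t * cos t) / (sin t * sin t)) / rr (q\<^sup>2)"
  proof -
    have "1 - q\<^sup>2 / cc (q\<^sup>2) = (cc (q\<^sup>2) - q\<^sup>2) / cc (q\<^sup>2)" using c by (simp add: field_simps)
    then show ?thesis using c ne by simp
  qed
  also have "\<dots> = cc (q\<^sup>2) * (k' / (rr (q\<^sup>2) * sin t) - cot t * q)"
    unfolding kt cot_def using c S by (simp add: field_simps)
  finally show ?thesis using D unfolding q_def[symmetric] by blast
qed

end

section \<open>Transonic flows in the nozzle\<close>

locale nozzle = gas +
  fixes \<theta>0 \<theta>1 u0 :: real
  assumes theta: "0 < \<theta>0" "\<theta>0 < \<theta>1" "\<theta>1 < pi"
    and u0: "cs < u0" "u0 < qm"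
    and choke: "mflux u0 * sin \<theta>0 < mflux cs * sin \<theta>1"
begin

section \<open>The supersonic radial flow\<close>

text \<open>Mass flux per unit longitude, constant along every radial solution and unchanged by a
  radial shock.\<close>

definition K :: real where "K = mflux u0 * sin \<theta>0"

definition ub :: "real \<Rightarrow> real" where "ub t = qsup (K / sin t)"

lemma sin_pos: "t \<in> {\<theta>0..\<theta>1} \<Longrightarrow> 0 < sin t"
  using theta by (intro sin_gt_zero) auto

lemma min_sin_le: "t \<in> {\<theta>0..\<theta>1} \<Longrightarrow> min (sin \<theta>0) (sin \<theta>1) \<le> sin t"
proof (cases "t \<le> pi / 2")
  case True
  assume "t \<in> {\<theta>0..\<theta>1}" then have "sin \<theta>0 \<le> sin t" using True theta by (intro sin_monotone_2pi_le) auto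
  then show ?thesis by simp
next
  case False
  assume "t \<in> {\<theta>0..\<theta>1}" then have "sin (pi - \<theta>1) \<le> sin (pi - t)"
    using False theta by (intro sin_monotone_2pi_le) auto
  then show ?thesis by simp
qed

lemma K_pos: "0 < K"
proof -
  have "mflux qm < mflux u0" using u0 by (intro mflux_antimono) auto
  then show ?thesis using sin_pos[of \<theta>0] theta by (simp add: K_def)
qed

text \<open>At \<open>\<theta>0\<close> the bound holds because \<open>u0\<close> is not critical,
  at \<open>\<theta>1\<close> it is the standing assumption, and in between the sine is at least its
  smaller endpoint value.\<close>

lemma K_range: "t \<in> {\<theta>0..\<theta>1} \<Longrightarrow> K / sin t \<in> {0<..<mflux cs}"
proof -
  assume t: "t \<in> {\<theta>0..\<theta>1}"
  have m: "0 < mflux cs" using mflux_mono[of 0 cs] cs_pos by simp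
  have "mflux u0 < mflux cs" using u0 by (intro mflux_antimono) auto
  then have "K < mflux cs * sin \<theta>0" using sin_pos[of \<theta>0] theta by (simp add: K_def)
  then have "K < mflux cs * min (sin \<theta>0) (sin \<theta>1)" using choke by (simp add: K_def min_def)
  also have "\<dots> \<le> mflux cs * sin t" using min_sin_le[OF t] m by (intro mult_left_mono) auto
  finally show ?thesis using K_pos sin_pos[OF t] by (simp add: field_simps)
qed

lemma ub:
  assumes t: "t \<in> {\<theta>0..\<theta>1}"
  shows "ub t \<in> {cs<..<qm}" "mflux (ub t) * sin t = K"
    "(ub has_real_derivative cot t * cc ((ub t)\<^sup>2) * ub t / ((ub t)\<^sup>2 - cc ((ub t)\<^sup>2))) (at t)"
proof -
  show r: "ub t \<in> {cs<..<qm}" unfolding ub_def by (rule qsup(1)[OF K_range[OF t]])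
  show "mflux (ub t) * sin t = K"
    unfolding ub_def qsup(2)[OF K_range[OF t]] using sin_pos[OF t] by simp
  obtain D where D: "(ub has_real_derivative D) (at t)"
    "(cc ((ub t)\<^sup>2) - (ub t)\<^sup>2) * D = cc ((ub t)\<^sup>2) * (0 - cot t * ub t)"
    using DERIV_radial_branch[of qsup "\<lambda>_. K" 0 t] K_range[OF t] sin_pos[OF t]
    unfolding ub_def[abs_def] by force
  have "D = cot t * cc ((ub t)\<^sup>2) * ub t / ((ub t)\<^sup>2 - cc ((ub t)\<^sup>2))"
    using D(2) supersonic(5)[OF r] by (simp add: field_simps)
  then show "(ub has_real_derivative cot t * cc ((ub t)\<^sup>2) * ub t / ((ub t)\<^sup>2 - cc ((ub t)\<^sup>2))) (at t)"
    using D(1) by simp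
qed

lemma ub_\<theta>0: "ub \<theta>0 = u0"
proof (rule mflux_inj_sup)
  have "\<theta>0 \<in> {\<theta>0..\<theta>1}" using theta by simp
  from ub[OF this] sin_pos[OF this]
  show "cs \<le> ub \<theta>0" "ub \<theta>0 \<le> qm" "mflux (ub \<theta>0) = mflux u0" by (auto simp: K_def)
qed (use u0 in auto)

lemma continuous_on_ub: "continuous_on {\<theta>0..\<theta>1} ub"
  using ub(3) by (intro DERIV_continuous_on) (auto intro: has_field_derivative_at_within)

text \<open>Velocities which are supersonic in the direction of increasing \<open>\<theta>\<close> and close enough to it;
  these states make \<open>\<theta>\<close> a time-like variable.\<close>
definition timelike :: "real \<Rightarrow> real \<times> real \<Rightarrow> bool" where
  "timelike t g \<longleftrightarrow> 0 < fst g \<and> cc (gsq t g) < (fst g)\<^sup>2 \<and> (snd g / sin t)\<^sup>2 < cc (gsq t g)"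

text \<open>Since \<open>\<bar>a\<bar> + \<bar>b\<bar>\<close> is the larger of
  \<open>\<bar>a + b\<bar>\<close> and \<open>\<bar>a - b\<bar>\<close>, this is the larger
  deviation, in absolute value, of the two Riemann invariants from the radial flow; the arctangent
  is the flow angle.\<close>

definition deviation :: "real \<Rightarrow> real \<times> real \<Rightarrow> real" where
  "deviation t g = \<bar>nu (sqrt (gsq t g)) - nu (ub t)\<bar> + \<bar>arctan (snd g / sin t / fst g)\<bar>"

lemma timelikeD:
  assumes "timelike t g"
  shows "sqrt (gsq t g) \<in> {cs<..<qm}"
proof -
  have le: "(fst g)\<^sup>2 \<le> gsq t g" by (simp add: gsq_def)
  have "cc (gsq t g) < gsq t g" "0 < cc (gsq t g)"
    using assms le zero_le_power2[of "snd g / sin t"] unfolding timelike_def by linarith+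
  then have "cs\<^sup>2 < gsq t g" "gsq t g < qm\<^sup>2" using cc_less_iff cc_pos_iff by auto
  then show ?thesis
    using real_less_rsqrt cs_pos qm_pos by (auto intro!: real_less_rsqrt real_less_lsqrt gsq_nonneg)
qed

lemma timelike_ub: "t \<in> {\<theta>0..\<theta>1} \<Longrightarrow> timelike t (ub t, 0)"
  using supersonic[OF ub(1), of t] by (simp add: timelike_def gsq_def)

lemma deviation_ub: "t \<in> {\<theta>0..\<theta>1} \<Longrightarrow> deviation t (ub t, 0) = 0"
  using supersonic(1)[OF ub(1), of t] by (simp add: deviation_def gsq_def)

lemma deviation_eq_0:
  assumes t: "t \<in> {\<theta>0..\<theta>1}" and g: "timelike t g" and 0: "deviation t g = 0"
  shows "g = (ub t, 0)"
proof -
  have "arctan (snd g / sin t / fst g) = 0" and n: "nu (sqrt (gsq t g)) = nu (ub t)"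
    using 0 unfolding deviation_def by linarith+
  then have 2: "snd g = 0" using g sin_pos[OF t] by (simp add: timelike_def)
  have "sqrt (gsq t g) = ub t" using nu_inject[OF timelikeD[OF g] ub(1)[OF t] n] .
  then show ?thesis using 2 g by (auto simp: gsq_def timelike_def intro: prod_eqI)
qed

end

section \<open>A given transonic flow: traces, periodicity, continuity across the shock\<close>

text \<open>The solution concept with the one-sided gradients fixed, speeds replaced by squared
  speeds, and the jump of the flux tested against the unnormalised normal vector.\<close>

locale transonic = nozzle +
  fixes \<phi> :: "real \<times> real \<Rightarrow> real" and \<theta>s ds :: "real \<Rightarrow> real"
    and Gm Gp :: "real \<times> real \<Rightarrow> real \<times> real" and c1 :: real
  assumes ds: "\<And>p. (\<theta>s has_real_derivative ds p) (at p)" and cont_ds: "continuous_on UNIV ds"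
    and per_s: "\<And>p. \<theta>s (p + 2 * pi) = \<theta>s p" and range_s: "\<And>p. \<theta>0 < \<theta>s p" "\<And>p. \<theta>s p < \<theta>1"
    and per_phi: "\<And>t p. \<phi> (t, p + 2 * pi) = \<phi> (t, p)"
    and cont_phi: "continuous_on (Omega \<theta>0 \<theta>1) \<phi>"
    and C2m: "C2_on (Om_minus \<theta>0 \<theta>s) \<phi>" and C2p: "C2_on (Om_plus \<theta>1 \<theta>s) \<phi>"
    and sup: "\<And>x. x \<in> Om_minus \<theta>0 \<theta>s \<Longrightarrow> cs\<^sup>2 < gsq (fst x) (cgrad \<phi> x) \<and> gsq (fst x) (cgrad \<phi> x) < qm\<^sup>2"
    and sub: "\<And>x. x \<in> Om_plus \<theta>1 \<theta>s \<Longrightarrow> gsq (fst x) (cgrad \<phi> x) < cs\<^sup>2"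
    and eqm: "\<And>x. x \<in> Om_minus \<theta>0 \<theta>s \<Longrightarrow> flow_eq \<gamma> c0 \<phi> x"
    and eqp: "\<And>x. x \<in> Om_plus \<theta>1 \<theta>s \<Longrightarrow> flow_eq \<gamma> c0 \<phi> x"
    and limm: "\<And>x. x \<in> Cl_minus \<theta>0 \<theta>s \<Longrightarrow> (cgrad \<phi> \<longlongrightarrow> Gm x) (at x within Om_minus \<theta>0 \<theta>s)"
    and limp: "\<And>x. x \<in> Cl_plus \<theta>1 \<theta>s \<Longrightarrow> (cgrad \<phi> \<longlongrightarrow> Gp x) (at x within Om_plus \<theta>1 \<theta>s)"
    and inlet: "\<And>p. Gm (\<theta>0, p) = (u0, 0)"
    and outlet: "\<And>p. gsq \<theta>1 (Gp (\<theta>1, p)) = c1\<^sup>2" "\<And>p. 0 \<le> fst (Gp (\<theta>1, p))" "0 < c1" "c1 < cs"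
    and RH: "\<And>p. rr (gsq (\<theta>s p) (Gm (\<theta>s p, p))) *
                (fst (Gm (\<theta>s p, p)) - snd (Gm (\<theta>s p, p)) / sin (\<theta>s p) * (ds p / sin (\<theta>s p)))
           = rr (gsq (\<theta>s p) (Gp (\<theta>s p, p))) *
                (fst (Gp (\<theta>s p, p)) - snd (Gp (\<theta>s p, p)) / sin (\<theta>s p) * (ds p / sin (\<theta>s p)))"
begin

abbreviation "Um \<equiv> Om_minus \<theta>0 \<theta>s"
abbreviation "Up \<equiv> Om_plus \<theta>1 \<theta>s"
abbreviation "Cm \<equiv> Cl_minus \<theta>0 \<theta>s"
abbreviation "Cp \<equiv> Cl_plus \<theta>1 \<theta>s"

lemma cont_s: "continuous_on A \<theta>s"
  using ds DERIV_continuous_on continuous_on_subset by blast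

lemma continuous_on_s [continuous_intros]: "continuous_on A g \<Longrightarrow> continuous_on A (\<lambda>x. \<theta>s (g x))"
  and continuous_on_ds [continuous_intros]: "continuous_on A g \<Longrightarrow> continuous_on A (\<lambda>x. ds (g x))"
  by (auto intro: continuous_on_compose2[OF cont_s[of UNIV]] continuous_on_compose2[OF cont_ds])

lemma per_ds: "ds (p + 2 * pi) = ds p"
proof -
  have "((\<lambda>p. \<theta>s (p + 2 * pi)) has_real_derivative ds (p + 2 * pi) * 1) (at p)"
    by (rule DERIV_chain2[OF ds]) (auto intro!: derivative_eq_intros)
  then show ?thesis using DERIV_unique[OF _ ds[of p]] by (simp add: per_s)
qed

lemma open_U: "open Um" "open Up"
  unfolding Om_minus_def Om_plus_def
  by (intro open_Collect_conj open_Collect_less continuous_intros)+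

lemma closed_C: "closed Cm" "closed Cp"
  unfolding Cl_minus_def Cl_plus_def
  by (intro closed_Collect_conj closed_Collect_le continuous_intros)+

lemma U_C: "Um \<subseteq> Cm" "Up \<subseteq> Cp"
  by (auto simp: Om_minus_def Om_plus_def Cl_minus_def Cl_plus_def)

lemma limpt: "x \<in> Cm \<Longrightarrow> x islimpt Um" "x \<in> Cp \<Longrightarrow> x islimpt Up"
proof -
  show "x islimpt Um" if "x \<in> Cm"
    using islimpt_vertical[of \<theta>0 "\<theta>s (snd x)" "fst x" "snd x" Um] that range_s[of "snd x"]
    by (auto simp: Om_minus_def Cl_minus_def)
  show "x islimpt Up" if "x \<in> Cp"
    using islimpt_vertical[of "\<theta>s (snd x)" \<theta>1 "fst x" "snd x" Up] that range_s[of "snd x"]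
    by (auto simp: Om_plus_def Cl_plus_def)
qed

lemma C1D: "x \<in> Um \<Longrightarrow> \<phi> differentiable (at x)" "x \<in> Up \<Longrightarrow> \<phi> differentiable (at x)"
  "x \<in> Um \<Longrightarrow> dth \<phi> differentiable (at x)" "x \<in> Um \<Longrightarrow> dph \<phi> differentiable (at x)"
  "x \<in> Up \<Longrightarrow> dth \<phi> differentiable (at x)" "x \<in> Up \<Longrightarrow> dph \<phi> differentiable (at x)"
  using C2m C2p by (auto simp: C2_on_def C1_on_def)

lemma cont_cgrad: "continuous_on Um (cgrad \<phi>)" "continuous_on Up (cgrad \<phi>)"
  using C2m C2p unfolding cgrad_def[abs_def] C2_on_def
  by (auto intro!: continuous_on_Pair C1_on_continuous)

lemma Gm: "continuous_on Cm Gm" "x \<in> Um \<Longrightarrow> Gm x = cgrad \<phi> x"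
  and Gp: "continuous_on Cp Gp" "x \<in> Up \<Longrightarrow> Gp x = cgrad \<phi> x"
  using continuous_on_limit_extension[OF limm limpt(1) U_C(1) cont_cgrad(1)]
    continuous_on_limit_extension[OF limp limpt(2) U_C(2) cont_cgrad(2)] by blast+

lemma Cm_Omega: "Cm \<subseteq> Omega \<theta>0 \<theta>1" and Cp_Omega: "Cp \<subseteq> Omega \<theta>0 \<theta>1"
  using range_s unfolding Cl_minus_def Cl_plus_def Omega_def
  by (auto intro: less_imp_le le_less_trans less_le_trans)

lemma fst_range: "x \<in> Cm \<Longrightarrow> fst x \<in> {\<theta>0..\<theta>1}" "x \<in> Cp \<Longrightarrow> fst x \<in> {\<theta>0..\<theta>1}"
  using Cm_Omega Cp_Omega by (auto simp: Omega_def)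

lemma sin_nz: "x \<in> Cm \<Longrightarrow> 0 < sin (fst x)" "x \<in> Cp \<Longrightarrow> 0 < sin (fst x)"
  using fst_range sin_pos by blast+

lemma per_C: "(t, p + 2 * pi) \<in> Cm \<longleftrightarrow> (t, p) \<in> Cm" "(t, p + 2 * pi) \<in> Cp \<longleftrightarrow> (t, p) \<in> Cp"
  by (auto simp: Cl_minus_def Cl_plus_def per_s)

lemma per_cgrad: "cgrad \<phi> (t, p + 2 * pi) = cgrad \<phi> (t, p)"
proof -
  have "dph \<phi> (t, p + 2 * pi) = dph \<phi> (t, p)"
  proof -
    have "((\<lambda>s. \<phi> (t, s)) has_real_derivative D) (at (p + 2 * pi)) \<longleftrightarrow>
      ((\<lambda>s. \<phi> (t, s)) has_real_derivative D) (at p)" for D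
      using DERIV_shift[of "\<lambda>s. \<phi> (t, s)" D p "2 * pi"] by (simp add: per_phi)
    then show ?thesis unfolding dph_def deriv_def by simp
  qed
  moreover have "dth \<phi> (t, p + 2 * pi) = dth \<phi> (t, p)" by (simp add: dth_def per_phi)
  ultimately show ?thesis by (simp add: cgrad_def)
qed

lemma per_Gm: "(t, p) \<in> Cm \<Longrightarrow> Gm (t, p + 2 * pi) = Gm (t, p)"
proof -
  assume x: "(t, p) \<in> Cm"
  have vert: "continuous_on {\<theta>0..\<theta>s p} (\<lambda>t. Gm (t, q))" if "q = p \<or> q = p + 2 * pi" for q
    using that per_s by (intro continuous_on_compose2[OF Gm(1)] continuous_intros) (auto simp: Cl_minus_def)
  show ?thesis
    by (rule agree_on_closed_interval[of \<theta>0 "\<theta>s p"])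
      (use x range_s[of p] vert Gm(2) per_cgrad per_s in \<open>auto simp: Cl_minus_def Om_minus_def\<close>)
qed

lemma per_Gp: "(t, p) \<in> Cp \<Longrightarrow> Gp (t, p + 2 * pi) = Gp (t, p)"
proof -
  assume x: "(t, p) \<in> Cp"
  have vert: "continuous_on {\<theta>s p..\<theta>1} (\<lambda>t. Gp (t, q))" if "q = p \<or> q = p + 2 * pi" for q
    using that per_s by (intro continuous_on_compose2[OF Gp(1)] continuous_intros) (auto simp: Cl_plus_def)
  show ?thesis
    by (rule agree_on_closed_interval[of "\<theta>s p" \<theta>1])
      (use x range_s[of p] vert Gp(2) per_cgrad per_s in \<open>auto simp: Cl_plus_def Om_plus_def\<close>)
qed

lemma continuous_on_Gm [continuous_intros]: "A \<subseteq> Cm \<Longrightarrow> continuous_on A Gm"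
  and continuous_on_Gp [continuous_intros]: "A \<subseteq> Cp \<Longrightarrow> continuous_on A Gp"
  using Gm Gp continuous_on_subset by blast+

lemma continuous_on_gsq:
  "A \<subseteq> Cm \<Longrightarrow> continuous_on A (\<lambda>x. gsq (fst x) (Gm x))"
  "A \<subseteq> Cp \<Longrightarrow> continuous_on A (\<lambda>x. gsq (fst x) (Gp x))"
  unfolding gsq_def using sin_nz by (auto intro!: continuous_intros) force+

lemma on_shock: "(\<theta>s p, p) \<in> Cm" "(\<theta>s p, p) \<in> Cp"
  using range_s[of p] by (auto simp: Cl_minus_def Cl_plus_def)

text \<open>Strictness is lost in the limit: sonic states behind the shock are not excluded at this
  stage, and the Rankine-Hugoniot lemmas must tolerate them.\<close>

lemma Gp_gsq_le: "x \<in> Cp \<Longrightarrow> gsq (fst x) (Gp x) \<le> cs\<^sup>2"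
proof -
  assume x: "x \<in> Cp"
  have "closure Up \<subseteq> Cp" using U_C(2) closed_C(2) by (rule closure_minimal)
  moreover have "x \<in> closure Up" using limpt(2)[OF x] by (simp add: closure_def)
  ultimately show ?thesis
    using continuous_le_on_closure[of Up "\<lambda>x. gsq (fst x) (Gp x)" x "cs\<^sup>2"] continuous_on_gsq(2) sub Gp(2)
    by (metis less_imp_le)
qed

text \<open>Provides the room for the vertical translates used in
  \<open>DERIV_along_boundary_curve\<close>, for the shock as well as for inlet and outlet.\<close>

lemma shock_margin:
  obtains e where "e > 0"
    "\<And>h q. 0 < h \<Longrightarrow> h < e \<Longrightarrow> \<bar>q - p\<bar> < e \<Longrightarrow> \<theta>0 < \<theta>s q - h \<and> \<theta>s q + h < \<theta>1"
proof -
  define m where "m = min (\<theta>s p - \<theta>0) (\<theta>1 - \<theta>s p)"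
  have m: "m > 0" "m \<le> \<theta>s p - \<theta>0" "m \<le> \<theta>1 - \<theta>s p" using range_s[of p] by (auto simp: m_def)
  obtain d where d: "d > 0" "\<And>q. dist q p < d \<Longrightarrow> dist (\<theta>s q) (\<theta>s p) < m / 2"
    using cont_s[of UNIV] m(1) unfolding continuous_on_iff by (metis UNIV_I half_gt_zero)
  show ?thesis
  proof (rule that[of "min d (m / 2)"])
    fix h q assume "0 < h" "h < min d (m / 2)" "\<bar>q - p\<bar> < min d (m / 2)"
    then have "\<bar>\<theta>s q - \<theta>s p\<bar> < m / 2" "h < m / 2" using d(2)[of q] by (auto simp: dist_real_def)
    then show "\<theta>0 < \<theta>s q - h \<and> \<theta>s q + h < \<theta>1" using m unfolding abs_less_iff by linarith
  qed (use d m in simp)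
qed

text \<open>Continuity of \<open>\<phi>\<close> across the shock yields continuity of the tangential derivative.\<close>
lemma tangential_continuity:
  "fst (Gm (\<theta>s p, p)) * ds p + snd (Gm (\<theta>s p, p)) = fst (Gp (\<theta>s p, p)) * ds p + snd (Gp (\<theta>s p, p))"
proof -
  obtain e where e: "e > 0" and
    in_strip: "\<And>h q. 0 < h \<Longrightarrow> h < e \<Longrightarrow> \<bar>q - p\<bar> < e \<Longrightarrow> \<theta>0 < \<theta>s q - h \<and> \<theta>s q + h < \<theta>1"
    using shock_margin by blast
  have "((\<lambda>p. \<phi> (\<theta>s p, p)) has_real_derivative fst (Gm (\<theta>s p, p)) * ds p + snd (Gm (\<theta>s p, p))) (at p)"
    by (rule DERIV_along_boundary_curve[OF e, where \<sigma> = "-1" and U = Um and C = Cm])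
      (use in_strip on_shock C1D Gm U_C ds cont_ds continuous_on_subset[OF cont_phi Cm_Omega] in \<open>auto simp: Om_minus_def\<close>)
  moreover have "((\<lambda>p. \<phi> (\<theta>s p, p)) has_real_derivative fst (Gp (\<theta>s p, p)) * ds p + snd (Gp (\<theta>s p, p))) (at p)"
    by (rule DERIV_along_boundary_curve[OF e, where \<sigma> = "1" and U = Up and C = Cp])
      (use in_strip on_shock C1D Gp U_C ds cont_ds continuous_on_subset[OF cont_phi Cp_Omega] in \<open>auto simp: Om_plus_def\<close>)
  ultimately show ?thesis by (rule DERIV_unique)
qed

end

section \<open>Uniqueness of the supersonic flow\<close>

context nozzle begin

text \<open>\<open>(chth \<sigma>, chph \<sigma>)\<close> are the two characteristic directions in coordinates, and \<open>source\<close> is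
  the right-hand side of the transport equation for \<open>Rinv \<sigma>\<close>, the deviation of a Riemann
  invariant from its value for the radial flow.\<close>

definition chth :: "real \<Rightarrow> real \<Rightarrow> real \<times> real \<Rightarrow> real" where
  "chth \<sigma> t g = mu (sqrt (gsq t g)) * fst g + \<sigma> * (snd g / sin t)"

definition chph :: "real \<Rightarrow> real \<Rightarrow> real \<times> real \<Rightarrow> real" where
  "chph \<sigma> t g = (mu (sqrt (gsq t g)) * (snd g / sin t) - \<sigma> * fst g) / sin t"

definition source :: "real \<Rightarrow> real \<Rightarrow> real \<times> real \<Rightarrow> real" where
  "source \<sigma> t g = cot t * (fst g - \<sigma> * mu (sqrt (gsq t g)) * (snd g / sin t)) - chth \<sigma> t g * cot t / mu (ub t)"

definition Rinv :: "real \<Rightarrow> real \<Rightarrow> real \<times> real \<Rightarrow> real" where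
  "Rinv \<sigma> t g = nu (sqrt (gsq t g)) - nu (ub t) + \<sigma> * arctan (snd g / sin t / fst g)"

text \<open>Both characteristic families advance in \<theta> because, with m = \<open>mu\<close> of
  the speed, \<open>m\<^sup>2 * k * u\<^sup>2 - v\<^sup>2 * k\<close> factors as
  \<open>(u\<^sup>2 - k) * (u\<^sup>2 + v\<^sup>2)\<close>.\<close>

lemma chth_pos:
  assumes g: "timelike t g" and s: "\<sigma> \<in> {1, -1}"
  shows "0 < chth \<sigma> t g"
proof -
  define u where "u = fst g"
  define v where "v = snd g / sin t"
  define k where "k = cc (gsq t g)"
  define m where "m = mu (sqrt (gsq t g))"
  have y: "gsq t g = u\<^sup>2 + v\<^sup>2" by (simp add: gsq_def u_def v_def)
  note S = supersonic[OF timelikeD[OF g]]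
  have m: "m > 0" "m\<^sup>2 * k = u\<^sup>2 + v\<^sup>2 - k" "k > 0"
    using S gsq_nonneg[of t g] by (auto simp: m_def k_def y)
  have u: "u > 0" "k < u\<^sup>2" using g by (auto simp: timelike_def u_def k_def)
  have "v\<^sup>2 * k < m\<^sup>2 * k * u\<^sup>2"
  proof -
    have "m\<^sup>2 * k * u\<^sup>2 - v\<^sup>2 * k = (u\<^sup>2 - k) * (u\<^sup>2 + v\<^sup>2)" unfolding m(2) by algebra
    also have "\<dots> > 0" using u by (intro mult_pos_pos add_pos_nonneg) auto
    finally show ?thesis by simp
  qed
  then have "v\<^sup>2 < (m * u)\<^sup>2" using m(3) by (simp add: power_mult_distrib mult.commute mult.left_commute)
  then have "\<bar>v\<bar> < m * u" using m u by (metis abs_of_pos mult_pos_pos power2_less_imp_less power2_abs less_imp_le)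
  then have "0 < m * u + \<sigma> * v" using s by auto
  then show ?thesis by (simp add: chth_def u_def v_def m_def)
qed

text \<open>The source vanishes on the radial flow, and the bound by the deviation makes a
  Gronwall-type argument possible.\<close>

lemma source_bound:
  assumes q: "cs < q1" "q2 < qm" and ub_q: "\<And>t. t \<in> {\<theta>0..\<theta>1} \<Longrightarrow> ub t \<in> {q1..q2}"
  obtains L where "0 \<le> L" "\<And>\<sigma> t g. \<sigma> \<in> {1, -1} \<Longrightarrow> t \<in> {\<theta>0..\<theta>1} \<Longrightarrow> timelike t g \<Longrightarrow> sqrt (gsq t g) \<in> {q1..q2} \<Longrightarrow>
     \<bar>source \<sigma> t g\<bar> \<le> L * deviation t g"
proof -
  obtain C where C: "0 \<le> C" "\<And>x y. x \<in> {q1..q2} \<Longrightarrow> y \<in> {q1..q2} \<Longrightarrow> \<bar>mu x - mu y\<bar> \<le> C * \<bar>nu x - nu y\<bar>"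
    using mu_Lipschitz_nu[OF q] by blast
  have sub: "{q1..q2} \<subseteq> {cs<..<qm}" using q by auto
  have mc: "continuous_on {q1..q2} mu" using continuous_on_mu sub continuous_on_subset by blast
  have "mu q \<noteq> 0" if "q \<in> {q1..q2}" for q using supersonic(6)[of q] sub that by auto
  then have "continuous_on {q1..q2} (\<lambda>q. 1 / mu q)" by (intro continuous_intros mc) auto
  then have "bounded ((\<lambda>q. 1 / mu q) ` {q1..q2})" "bounded (mu ` {q1..q2})"
    using mc compact_continuous_image compact_imp_bounded compact_Icc by blast+
  then obtain B M where B: "\<And>q. q \<in> {q1..q2} \<Longrightarrow> \<bar>1 / mu q\<bar> \<le> B" and M: "\<And>q. q \<in> {q1..q2} \<Longrightarrow> \<bar>mu q\<bar> \<le> M"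
    unfolding bounded_real by (metis imageI)
  have "continuous_on {\<theta>0..\<theta>1} cot"
    unfolding cot_def[abs_def] using sin_pos by (intro continuous_intros) force
  then have "bounded (cot ` {\<theta>0..\<theta>1})" using compact_continuous_image compact_imp_bounded compact_Icc by blast
  then obtain c where c: "\<And>t. t \<in> {\<theta>0..\<theta>1} \<Longrightarrow> \<bar>cot t\<bar> \<le> c"
    unfolding bounded_real by (metis imageI)
  have t0: "\<theta>0 \<in> {\<theta>0..\<theta>1}" using theta by simp
  have nn: "0 \<le> B" "0 \<le> M" "0 \<le> c"
    using B[OF ub_q[OF t0]] M[OF ub_q[OF t0]] c[OF t0] by linarith+
  define L where "L = c * (qm * (B * C + M + B))"
  have "\<bar>source \<sigma> t g\<bar> \<le> L * deviation t g"
    if s: "\<sigma> \<in> {1, -1}" and t: "t \<in> {\<theta>0..\<theta>1}" and g: "timelike t g" and Q: "sqrt (gsq t g) \<in> {q1..q2}" for \<sigma> t g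
  proof -
    define u where "u = fst g"
    define v where "v = snd g / sin t"
    define m where "m = mu (sqrt (gsq t g))"
    define mb where "mb = mu (ub t)"
    define dn where "dn = \<bar>nu (sqrt (gsq t g)) - nu (ub t)\<bar>"
    define be where "be = \<bar>arctan (v / u)\<bar>"
    have y: "gsq t g = u\<^sup>2 + v\<^sup>2" by (simp add: gsq_def u_def v_def)
    have u: "u > 0" using g by (auto simp: timelike_def u_def)
    have Qm: "sqrt (gsq t g) \<le> qm" using Q q by simp
    have "u \<le> sqrt (gsq t g)" unfolding y using u by (intro real_le_rsqrt) auto
    then have uq: "u \<le> qm" using Qm by linarith
    have vb: "\<bar>v\<bar> \<le> qm * be"
    proof -
      have s1: "sqrt (gsq t g) = u * sqrt (1 + (v / u)\<^sup>2)"
      proof -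
        have "gsq t g = u\<^sup>2 * (1 + (v / u)\<^sup>2)" unfolding y using u by (simp add: field_simps)
        then show ?thesis using u by (simp add: real_sqrt_mult)
      qed
      have ne: "sqrt (1 + (v / u)\<^sup>2) \<noteq> 0"
        using zero_le_power2[of "v / u"] by (smt (verit) real_sqrt_eq_zero_cancel_iff)
      have "v = sqrt (gsq t g) * sin (arctan (v / u))"
        unfolding s1 sin_arctan using u ne by simp
      then have "\<bar>v\<bar> = sqrt (gsq t g) * \<bar>sin (arctan (v / u))\<bar>"
        by (metis abs_mult abs_of_nonneg gsq_nonneg real_sqrt_ge_zero)
      also have "\<dots> \<le> qm * be" unfolding be_def
        using Qm qm_pos abs_sin_x_le_abs_x by (intro mult_mono) auto
      finally show ?thesis .
    qed
    have mb: "mb \<noteq> 0" using supersonic(6)[OF ub(1)[OF t]] by (simp add: mb_def)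
    \<comment> \<open>Regrouped so that each term has a small factor: \<open>mb - m\<close> is
      controlled by the difference of \<open>nu\<close>, and \<open>v\<close> by the flow
      angle.\<close>
    have "source \<sigma> t g = cot t * (u * ((mb - m) * (1 / mb)) - \<sigma> * v * (m + 1 / mb))"
      unfolding source_def chth_def m_def[symmetric] mb_def[symmetric] u_def[symmetric] v_def[symmetric]
      using mb by (simp add: field_simps)
    also have "\<bar>\<dots>\<bar> \<le> c * (qm * ((C * dn) * B) + (qm * be) * (M + B))"
      unfolding abs_mult
    proof (intro mult_mono c t order_trans[OF abs_triangle_ineq4] add_mono)
      have "\<bar>u * ((mb - m) * (1 / mb))\<bar> = u * (\<bar>mb - m\<bar> * \<bar>1 / mb\<bar>)" using u by (simp add: abs_mult)
      also have "\<dots> \<le> qm * ((C * dn) * B)"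
        using C(2)[OF ub_q[OF t] Q] B[OF ub_q[OF t]] uq u C(1) nn qm_pos
        by (intro mult_mono) (auto simp: m_def mb_def dn_def abs_minus_commute)
      finally show "\<bar>u * ((mb - m) * (1 / mb))\<bar> \<le> qm * ((C * dn) * B)" .
      have "\<bar>\<sigma> * v * (m + 1 / mb)\<bar> = \<bar>v\<bar> * \<bar>m + 1 / mb\<bar>" using s by (auto simp: abs_mult)
      also have "\<dots> \<le> (qm * be) * (M + B)"
        using vb M[OF Q] B[OF ub_q[OF t]] nn qm_pos
        by (intro mult_mono order_trans[OF abs_triangle_ineq] add_mono) (auto simp: m_def mb_def be_def)
      finally show "\<bar>\<sigma> * v * (m + 1 / mb)\<bar> \<le> (qm * be) * (M + B)" .
    qed (use nn in auto)
    also have "\<dots> = c * (qm * (B * C * dn + (M + B) * be))" by (simp add: algebra_simps)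
    also have "\<dots> \<le> c * (qm * ((B * C + M + B) * (dn + be)))"
    proof -
      have "B * C * dn + (M + B) * be \<le> (B * C + M + B) * (dn + be)"
        using nn C(1) by (auto simp: algebra_simps dn_def be_def)
      then show ?thesis using nn qm_pos by (intro mult_left_mono) auto
    qed
    also have "\<dots> = L * deviation t g"
      by (simp add: L_def deviation_def dn_def be_def u_def v_def algebra_simps)
    finally show ?thesis .
  qed
  moreover have "0 \<le> L" using nn C(1) qm_pos by (auto simp: L_def)
  ultimately show ?thesis using that by blast
qed

end

context transonic begin

text \<open>Only the derivative at one point is needed, so a straight segment in the characteristic
  direction frozen at that point suffices; no characteristic curve has to be constructed.\<close>

lemma DERIV_Rinv_backward:
  assumes x: "(t, p) \<in> Um" and g: "timelike t (cgrad \<phi> (t, p))" and s: "\<sigma> \<in> {1, -1}"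
  defines "A \<equiv> chth \<sigma> t (cgrad \<phi> (t, p))" and "B \<equiv> chph \<sigma> t (cgrad \<phi> (t, p))"
  shows "((\<lambda>s. Rinv \<sigma> (t - s * A) (cgrad \<phi> (t - s * A, p - s * B))) has_real_derivative
     - source \<sigma> t (cgrad \<phi> (t, p))) (at 0)"
proof -
  define u where "u = dth \<phi> (t, p)"
  define v where "v = dph \<phi> (t, p) / sin t"
  define Y where "Y = gsq t (cgrad \<phi> (t, p))"
  define m where "m = mu (sqrt Y)"
  define a where "a = dth (dth \<phi>) (t, p)"
  define b where "b = dth (dph \<phi>) (t, p) / sin t"
  define d where "d = dph (dph \<phi>) (t, p) / (sin t)\<^sup>2"
  define Xu where "Xu = (m * u + \<sigma> * v) * a + (m * v - \<sigma> * u) * b"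
  define Xv where "Xv = (m * u + \<sigma> * v) * (b - v * cot t) + (m * v - \<sigma> * u) * d"
  have xC: "(t, p) \<in> Cm" using x U_C by auto
  have t: "t \<in> {\<theta>0..\<theta>1}" using fst_range(1)[OF xC] by simp
  have S: "sin t > 0" using sin_pos[OF t] .
  have Y: "Y = u\<^sup>2 + v\<^sup>2" by (simp add: Y_def gsq_def cgrad_def u_def v_def)
  have Q: "sqrt Y \<in> {cs<..<qm}" using timelikeD[OF g] by (simp add: Y_def)
  note SQ = supersonic[OF Q]
  have Y0: "0 < Y" using SQ(1) by simp
  have sY: "(sqrt Y)\<^sup>2 = Y" using Y0 by simp
  have u: "u > 0" using g by (simp add: timelike_def cgrad_def u_def)
  have w: "dph \<phi> (t, p) = v * sin t" "dth (dph \<phi>) (t, p) = b * sin t" "dph (dph \<phi>) (t, p) = d * (sin t)\<^sup>2"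
    using S by (auto simp: v_def b_def d_def)
  have A: "A = m * u + \<sigma> * v" and B: "B = (m * v - \<sigma> * u) / sin t"
    by (auto simp: A_def B_def chth_def chph_def m_def Y_def u_def v_def cgrad_def)
  have c: "cos t = cot t * sin t" using S by (simp add: cot_def)
  have da: "((\<lambda>s. t - s * A) has_real_derivative - A) (at 0)"
    and db: "((\<lambda>s. p - s * B) has_real_derivative - B) (at 0)"
    by (auto intro!: derivative_eq_intros)
  have Du: "((\<lambda>s. dth \<phi> (t - s * A, p - s * B)) has_real_derivative - Xu) (at 0)"
  proof -
    have "((\<lambda>s. dth \<phi> (t - s * A, p - s * B)) has_real_derivative
      dth (dth \<phi>) (t - 0 * A, p - 0 * B) * - A + dph (dth \<phi>) (t - 0 * A, p - 0 * B) * - B) (at 0)"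
      by (rule DERIV_along_curve[OF _ da db]) (use C1D(3)[OF x] in simp)
    then show ?thesis
      by (rule DERIV_cong)
        (use S mixed_partials_commute[OF open_U(1) C2m x] in \<open>simp add: w Xu_def A B a_def field_simps\<close>)
  qed
  have Dw: "((\<lambda>s. dph \<phi> (t - s * A, p - s * B)) has_real_derivative
      - (b * sin t * A + d * (sin t)\<^sup>2 * B)) (at 0)"
  proof -
    have "((\<lambda>s. dph \<phi> (t - s * A, p - s * B)) has_real_derivative
      dth (dph \<phi>) (t - 0 * A, p - 0 * B) * - A + dph (dph \<phi>) (t - 0 * A, p - 0 * B) * - B) (at 0)"
      by (rule DERIV_along_curve[OF _ da db]) (use C1D(4)[OF x] in simp)
    then show ?thesis by (rule DERIV_cong) (simp add: w algebra_simps)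
  qed
  have Ds: "((\<lambda>s. sin (t - s * A)) has_real_derivative cos t * - A) (at 0)"
    using DERIV_chain2[OF DERIV_sin da] by simp
  have Dv: "((\<lambda>s. dph \<phi> (t - s * A, p - s * B) / sin (t - s * A)) has_real_derivative - Xv) (at 0)"
    by (rule DERIV_cong[OF DERIV_divide[OF Dw Ds]])
      (use S in \<open>simp_all add: w A B Xv_def c field_simps power2_eq_square\<close>)
  define fu where "fu s = dth \<phi> (t - s * A, p - s * B)" for s
  define fv where "fv s = dph \<phi> (t - s * A, p - s * B) / sin (t - s * A)" for s
  have fuv: "fu 0 = u" "fv 0 = v" by (auto simp: fu_def fv_def u_def v_def)
  have Dfu: "(fu has_real_derivative - Xu) (at 0)" and Dfv: "(fv has_real_derivative - Xv) (at 0)"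
    using Du Dv unfolding fu_def fv_def .
  have DY: "((\<lambda>s. (fu s)\<^sup>2 + (fv s)\<^sup>2) has_real_derivative - (2 * (u * Xu + v * Xv))) (at 0)"
    by (auto intro!: derivative_eq_intros Dfu Dfv simp: fuv)
  have Y0': "(fu 0)\<^sup>2 + (fv 0)\<^sup>2 = Y" by (simp add: fuv Y)
  have DQ: "((\<lambda>s. sqrt ((fu s)\<^sup>2 + (fv s)\<^sup>2)) has_real_derivative - ((u * Xu + v * Xv) / sqrt Y)) (at 0)"
    by (rule DERIV_cong[OF DERIV_chain2[OF DERIV_real_sqrt DY]]) (use Y0 in \<open>auto simp: Y0' field_simps\<close>)
  have "((\<lambda>s. nu (sqrt ((fu s)\<^sup>2 + (fv s)\<^sup>2))) has_real_derivative
      mu (sqrt Y) / sqrt Y * - ((u * Xu + v * Xv) / sqrt Y)) (at 0)"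
    by (rule DERIV_chain2[OF _ DQ]) (use DERIV_nu[OF Q] Y0' in simp)
  then have Dn: "((\<lambda>s. nu (sqrt ((fu s)\<^sup>2 + (fv s)\<^sup>2))) has_real_derivative - (m * (u * Xu + v * Xv) / Y)) (at 0)"
    by (rule DERIV_cong) (use Y0 in \<open>simp add: m_def real_sqrt_mult_self field_simps\<close>)
  have Dq: "((\<lambda>s. fv s / fu s) has_real_derivative (- Xv * u - v * - Xu) / (u * u)) (at 0)"
    using DERIV_divide[OF Dfv Dfu] u by (simp add: fuv)
  have Db: "((\<lambda>s. arctan (fv s / fu s)) has_real_derivative - ((u * Xv - v * Xu) / Y)) (at 0)"
  proof (rule DERIV_cong[OF DERIV_chain2[OF DERIV_arctan Dq]])
    have "inverse (1 + (v / u)\<^sup>2) = u * u / Y" unfolding Y using u by (simp add: field_simps power2_eq_square)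
    moreover have "u * u / Y * ((- Xv * u - v * - Xu) / (u * u)) = - ((u * Xv - v * Xu) / Y)"
      using u Y0 by (simp add: field_simps)
    ultimately show "inverse (1 + (fv 0 / fu 0)\<^sup>2) * ((- Xv * u - v * - Xu) / (u * u)) = - ((u * Xv - v * Xu) / Y)"
      unfolding fuv by simp
  qed
  have Dub: "((\<lambda>s. nu (ub (t - s * A))) has_real_derivative - (A * cot t / mu (ub t))) (at 0)"
  proof -
    note SB = supersonic[OF ub(1)[OF t]]
    have "((\<lambda>s. nu (ub (t - s * A))) has_real_derivative
       mu (ub t) / ub t * (cot t * cc ((ub t)\<^sup>2) * ub t / ((ub t)\<^sup>2 - cc ((ub t)\<^sup>2)) * - A)) (at 0)"
      by (rule DERIV_chain2[where f = nu, OF _ DERIV_chain2[where f = ub, OF _ da]]) (use ub[OF t] DERIV_nu in auto)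
    then show ?thesis
    proof (rule DERIV_cong)
      \<comment> \<open>The denominator of the radial ODE is the product of the squares of
        \<open>mu\<close> and of the sonic speed, whence the quotient by \<open>mu (ub t)\<close> in
        the source.\<close>
      have "mu (ub t) / ub t * (cot t * cc ((ub t)\<^sup>2) * ub t / ((mu (ub t))\<^sup>2 * cc ((ub t)\<^sup>2)) * - A) =
          - (A * cot t / mu (ub t))"
        using SB by (simp add: field_simps power2_eq_square)
      then show "mu (ub t) / ub t * (cot t * cc ((ub t)\<^sup>2) * ub t / ((ub t)\<^sup>2 - cc ((ub t)\<^sup>2)) * - A) =
          - (A * cot t / mu (ub t))" unfolding SB(7) .
    qed
  qed
  have "((\<lambda>s. nu (sqrt ((fu s)\<^sup>2 + (fv s)\<^sup>2)) - nu (ub (t - s * A)) + \<sigma> * arctan (fv s / fu s)) has_real_derivative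
     - (m * (u * Xu + v * Xv) / Y) - - (A * cot t / mu (ub t)) + \<sigma> * - ((u * Xv - v * Xu) / Y)) (at 0)"
    by (intro DERIV_add DERIV_diff DERIV_cmult Dn Dub Db)
  moreover have "- (m * (u * Xu + v * Xv) / Y) - - (A * cot t / mu (ub t)) + \<sigma> * - ((u * Xv - v * Xu) / Y)
     = - source \<sigma> t (cgrad \<phi> (t, p))"
  proof -
    have qm: "gsq t (cgrad \<phi> (t, p)) < qm\<^sup>2" using sup[OF x] by simp
    have pde: "cc (u\<^sup>2 + v\<^sup>2) * (cot t * u + a + d) = u\<^sup>2 * a + 2 * u * v * b + v\<^sup>2 * d - u * v\<^sup>2 * cot t"
      using flow_eq_nondivergence[OF open_U(1) C2m x _ qm eqm[OF x]] S
      unfolding u_def v_def a_def b_def d_def by simp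
    have "(m * (u * Xu + v * Xv) + \<sigma> * (u * Xv - v * Xu)) / (u\<^sup>2 + v\<^sup>2) = cot t * (u - \<sigma> * m * v)"
      unfolding Xu_def Xv_def
    proof (rule characteristic_identity[OF pde])
      show "0 < cc (u\<^sup>2 + v\<^sup>2)" "m\<^sup>2 * cc (u\<^sup>2 + v\<^sup>2) = u\<^sup>2 + v\<^sup>2 - cc (u\<^sup>2 + v\<^sup>2)"
        using SQ unfolding sY unfolding m_def Y by auto
      show "\<sigma>\<^sup>2 = 1" using s by auto
      show "u\<^sup>2 + v\<^sup>2 \<noteq> 0" using Y0 unfolding Y by linarith
    qed
    then have "m * (u * Xu + v * Xv) / Y + \<sigma> * (u * Xv - v * Xu) / Y = cot t * (u - \<sigma> * m * v)"
      unfolding Y by (simp add: add_divide_distrib)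
    moreover have "source \<sigma> t (cgrad \<phi> (t, p)) = cot t * (u - \<sigma> * m * v) - A * cot t / mu (ub t)"
      by (simp add: source_def A_def m_def Y_def u_def v_def cgrad_def)
    ultimately show ?thesis by simp
  qed
  ultimately show ?thesis
    unfolding Rinv_def gsq_def cgrad_def fst_conv snd_conv fu_def fv_def by simp
qed

text \<open>The expression is the rate at which \<open>fst x - \<theta>s (snd x)\<close> grows along
  a characteristic: both families run out of the upstream region through the shock.\<close>

lemma spacelike_shock:
  assumes g: "timelike (\<theta>s p) (Gm (\<theta>s p, p))" and s: "\<sigma> \<in> {1, -1}"
  shows "0 < chth \<sigma> (\<theta>s p) (Gm (\<theta>s p, p)) - ds p * chph \<sigma> (\<theta>s p) (Gm (\<theta>s p, p))"
proof -
  define u where "u = fst (Gm (\<theta>s p, p))"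
  define v where "v = snd (Gm (\<theta>s p, p)) / sin (\<theta>s p)"
  define u' where "u' = fst (Gp (\<theta>s p, p))"
  define v' where "v' = snd (Gp (\<theta>s p, p)) / sin (\<theta>s p)"
  define sl where "sl = ds p / sin (\<theta>s p)"
  have S: "sin (\<theta>s p) > 0" using sin_nz(1)[OF on_shock(1)] by simp
  have y: "gsq (\<theta>s p) (Gm (\<theta>s p, p)) = u\<^sup>2 + v\<^sup>2" "gsq (\<theta>s p) (Gp (\<theta>s p, p)) = u'\<^sup>2 + v'\<^sup>2"
    by (simp_all add: gsq_def u_def v_def u'_def v'_def)
  have Q: "sqrt (u\<^sup>2 + v\<^sup>2) \<in> {cs<..<qm}" using timelikeD[OF g] by (simp add: y)
  note SQ = supersonic[OF Q]
  have "cc (u\<^sup>2 + v\<^sup>2) * (1 + sl\<^sup>2) < (u - v * sl)\<^sup>2"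
  proof (rule shock_normally_supersonic)
    show "rr (u\<^sup>2 + v\<^sup>2) * (u - v * sl) = rr (u'\<^sup>2 + v'\<^sup>2) * (u' - v' * sl)"
      using RH[of p] unfolding y by (simp add: u_def v_def u'_def v'_def sl_def)
    have "(u * ds p + snd (Gm (\<theta>s p, p))) / sin (\<theta>s p) = (u' * ds p + snd (Gp (\<theta>s p, p))) / sin (\<theta>s p)"
      using tangential_continuity[of p] by (simp add: u_def u'_def)
    then show "u * sl + v = u' * sl + v'" by (simp add: sl_def v_def v'_def add_divide_distrib)
    show "cs\<^sup>2 < u\<^sup>2 + v\<^sup>2" using SQ(2) by simp
    show "u'\<^sup>2 + v'\<^sup>2 \<le> cs\<^sup>2" using Gp_gsq_le[OF on_shock(2)[of p]] by (simp add: y)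
  qed
  then have "0 < mu (sqrt (u\<^sup>2 + v\<^sup>2)) * u + \<sigma> * v - sl * (mu (sqrt (u\<^sup>2 + v\<^sup>2)) * v - \<sigma> * u)"
    by (rule shock_spacelike) (use g s SQ in \<open>auto simp: timelike_def y u_def[symmetric] v_def[symmetric]\<close>)
  then show ?thesis
    unfolding chth_def chph_def y u_def[symmetric] v_def[symmetric] sl_def by simp
qed

definition dev :: "real \<times> real \<Rightarrow> real" where "dev x = deviation (fst x) (Gm x)"

text \<open>Domains of dependence do not leave the upstream region because the shock is space-like;
  this is used in the form that the curves obtained by translating the shock slightly upstream
  are crossed outwards by both characteristics. The exponentially weighted deviation is then
  maximal at a point from which one can move backwards along a characteristic, and its
  derivative there has the wrong sign.\<close>

lemma deviation_vanishes:
  assumes TT: "\<theta>0 \<le> T" "T < T'" "T' \<le> \<theta>1"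
    and init: "\<And>x. x \<in> Cm \<Longrightarrow> fst x = T \<Longrightarrow> Gm x = (ub T, 0)"
    and tl: "\<And>x. x \<in> Cm \<Longrightarrow> T \<le> fst x \<Longrightarrow> fst x \<le> T' \<Longrightarrow> timelike (fst x) (Gm x)"
    and x: "x \<in> Cm" "T \<le> fst x" "fst x \<le> T'" "fst x < \<theta>s (snd x)"
  shows "dev x = 0"
proof -
  define C where "C = Cm \<inter> {T..T'} \<times> UNIV"
  have C: "y \<in> Cm" "T \<le> fst y" "fst y \<le> T'" "fst y \<in> {\<theta>0..\<theta>1}" "timelike (fst y) (Gm y)" if "y \<in> C" for y
    using that TT tl by (auto simp: C_def)
  have clC: "closed C" unfolding C_def by (intro closed_Int closed_C closed_Times) auto
  have bdC: "C \<subseteq> {T..T'} \<times> UNIV" by (auto simp: C_def)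
  have perC: "(t, p + 2 * pi) \<in> C \<longleftrightarrow> (t, p) \<in> C" for t p by (auto simp: C_def per_C)
  have perG: "Gm (t, p + 2 * pi) = Gm (t, p)" if "(t, p) \<in> C" for t p
    using per_Gm C(1)[OF that] by simp
  have CsubCm: "C \<subseteq> Cm" by (auto simp: C_def)
  have cG: "continuous_on C Gm" using CsubCm by (rule continuous_on_Gm)
  have cq: "continuous_on C (\<lambda>y. sqrt (gsq (fst y) (Gm y)))"
    by (intro continuous_intros continuous_on_gsq CsubCm)
  have Q: "sqrt (gsq (fst y) (Gm y)) \<in> {cs<..<qm}" if "y \<in> C" for y
    using timelikeD C(5)[OF that] .
  have cmu: "continuous_on C (\<lambda>y. mu (sqrt (gsq (fst y) (Gm y))))"
    by (rule continuous_on_compose2[OF continuous_on_mu cq]) (use Q in auto)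
  have sn: "sin (fst y) \<noteq> 0" "sin (fst y) > 0" if "y \<in> C" for y using sin_pos[OF C(4)[OF that]] by auto
  have cch: "continuous_on C (\<lambda>y. chth \<sigma> (fst y) (Gm y))" "continuous_on C (\<lambda>y. chph \<sigma> (fst y) (Gm y))" for \<sigma>
    unfolding chth_def chph_def using sn by (intro continuous_intros cmu cG; simp)+
  have cnu: "continuous_on {cs<..<qm} nu"
    using DERIV_nu by (intro DERIV_continuous_on) (auto intro: has_field_derivative_at_within)
  have cdev: "continuous_on C dev"
  proof -
    have "continuous_on C (\<lambda>y. ub (fst y))"
      by (rule continuous_on_compose2[OF continuous_on_ub]) (use C(4) in \<open>auto intro: continuous_intros\<close>)
    then have "continuous_on C (\<lambda>y. nu (ub (fst y)))"
      by (rule continuous_on_compose2[OF cnu]) (use ub(1) C(4) in blast)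
    moreover have "continuous_on C (\<lambda>y. nu (sqrt (gsq (fst y) (Gm y))))"
      by (rule continuous_on_compose2[OF cnu cq]) (use Q in auto)
    moreover have "continuous_on C (\<lambda>y. snd (Gm y) / sin (fst y) / fst (Gm y))"
      using C(5) sn by (intro continuous_on_divide continuous_on_fst continuous_on_snd continuous_on_sin
          continuous_on_id cG) (force simp: timelike_def)+
    ultimately show ?thesis unfolding dev_def deviation_def
      by (intro continuous_on_add continuous_on_rabs continuous_on_diff continuous_on_arctan)
  qed
  have t0: "\<theta>0 \<in> {\<theta>0..\<theta>1}" and ne: "{\<theta>0..\<theta>1} \<noteq> {}" using theta by auto
  obtain q1 where q1: "cs < q1" "\<And>y. y \<in> C \<Longrightarrow> q1 \<le> sqrt (gsq (fst y) (Gm y))" "\<And>t. t \<in> {\<theta>0..\<theta>1} \<Longrightarrow> q1 \<le> ub t"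
  proof -
    obtain m where m: "0 < m" "\<And>y. y \<in> C \<Longrightarrow> m \<le> sqrt (gsq (fst y) (Gm y)) - cs"
      by (rule periodic_positive_lower_bound[OF clC bdC, of "\<lambda>y. sqrt (gsq (fst y) (Gm y)) - cs"])
        (use perC perG Q cq in \<open>auto intro: continuous_intros\<close>)
    obtain s where s: "s \<in> {\<theta>0..\<theta>1}" "\<forall>t\<in>{\<theta>0..\<theta>1}. ub s \<le> ub t"
      using continuous_attains_inf[OF compact_Icc ne continuous_on_ub] by blast
    show ?thesis using that[of "min (cs + m) (ub s)"] m s ub(1)[OF s(1)] by force
  qed
  obtain q2 where q2: "q2 < qm" "\<And>y. y \<in> C \<Longrightarrow> sqrt (gsq (fst y) (Gm y)) \<le> q2" "\<And>t. t \<in> {\<theta>0..\<theta>1} \<Longrightarrow> ub t \<le> q2"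
  proof -
    obtain m where m: "0 < m" "\<And>y. y \<in> C \<Longrightarrow> m \<le> qm - sqrt (gsq (fst y) (Gm y))"
      by (rule periodic_positive_lower_bound[OF clC bdC, of "\<lambda>y. qm - sqrt (gsq (fst y) (Gm y))"])
        (use perC perG Q cq in \<open>auto intro: continuous_intros\<close>)
    obtain s where s: "s \<in> {\<theta>0..\<theta>1}" "\<forall>t\<in>{\<theta>0..\<theta>1}. ub t \<le> ub s"
      using continuous_attains_sup[OF compact_Icc ne continuous_on_ub] by blast
    show ?thesis using that[of "max (qm - m) (ub s)"] m s ub(1)[OF s(1)] by force
  qed
  obtain L where L: "0 \<le> L" "\<And>\<sigma> t g. \<sigma> \<in> {1, -1} \<Longrightarrow> t \<in> {\<theta>0..\<theta>1} \<Longrightarrow> timelike t g \<Longrightarrow> sqrt (gsq t g) \<in> {q1..q2} \<Longrightarrow>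
     \<bar>source \<sigma> t g\<bar> \<le> L * deviation t g"
    using source_bound[OF q1(1) q2(1)] q1(3) q2(3) by auto
  have "\<exists>m>0. \<forall>y\<in>C. m \<le> chth \<sigma> (fst y) (Gm y)" if s: "\<sigma> \<in> {1, -1}" for \<sigma>
    by (rule periodic_positive_lower_bound[OF clC bdC cch(1)[of \<sigma>]])
      (use perC perG C(5) chth_pos s in auto)
  then obtain m1 m2 where "m1 > 0" "\<And>y. y \<in> C \<Longrightarrow> m1 \<le> chth 1 (fst y) (Gm y)"
    "m2 > 0" "\<And>y. y \<in> C \<Longrightarrow> m2 \<le> chth (-1) (fst y) (Gm y)" by (metis insert_iff)
  then obtain m where m: "m > 0" "\<And>\<sigma> y. \<sigma> \<in> {1, -1} \<Longrightarrow> y \<in> C \<Longrightarrow> m \<le> chth \<sigma> (fst y) (Gm y)"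
    using that[of "min m1 m2"] by force
  \<comment> \<open>Along a characteristic \<theta> grows at rate at least \<open>m\<close> and the
    invariant changes at rate at most \<open>L * dev\<close>; any exponent above
    \<open>L / m\<close> makes the weight win strictly.\<close>
  define \<Lambda> where "\<Lambda> = L / m + 1"
  define sp where "sp \<sigma> y = chth \<sigma> (fst y) (Gm y) - ds (snd y) * chph \<sigma> (fst y) (Gm y)" for \<sigma> y
  \<comment> \<open>Positivity holds on the shock itself; the points where it fails form a closed
    periodic set off the shock, hence at a positive distance from it.\<close>
  have "\<exists>e>0. \<forall>y\<in>C. \<theta>s (snd y) - fst y < e \<longrightarrow> 0 < sp \<sigma> y" if s: "\<sigma> \<in> {1, -1}" for \<sigma>
  proof -
    have csp: "continuous_on C (sp \<sigma>)" unfolding sp_def by (intro continuous_intros cch)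
    define B where "B = C \<inter> sp \<sigma> -` {..0}"
    have clB: "closed B" unfolding B_def by (rule continuous_closed_preimage[OF csp clC]) simp
    have pos: "0 < \<theta>s (snd y) - fst y" if "y \<in> B" for y
    proof -
      have yC: "y \<in> C" "sp \<sigma> y \<le> 0" using that by (auto simp: B_def)
      have "fst y \<noteq> \<theta>s (snd y)"
      proof
        assume e: "fst y = \<theta>s (snd y)"
        then have "y = (\<theta>s (snd y), snd y)" by (metis prod.collapse)
        then show False using spacelike_shock[of "snd y" \<sigma>] C(5)[OF yC(1)] yC(2) s e by (simp add: sp_def)
      qed
      then show ?thesis using C(1)[OF yC(1)] by (auto simp: Cl_minus_def)
    qed
    obtain e where "0 < e" "\<And>y. y \<in> B \<Longrightarrow> e \<le> \<theta>s (snd y) - fst y"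
      by (rule periodic_positive_lower_bound[OF clB, of T T' "\<lambda>y. \<theta>s (snd y) - fst y"])
        (use bdC perC perG pos per_s per_ds in \<open>auto simp: B_def sp_def intro!: continuous_intros\<close>)
    then show ?thesis by (intro exI[of _ e]) (force simp: B_def)
  qed
  then obtain e1 e2 where "e1 > 0" "\<And>y. y \<in> C \<Longrightarrow> \<theta>s (snd y) - fst y < e1 \<Longrightarrow> 0 < sp 1 y"
    "e2 > 0" "\<And>y. y \<in> C \<Longrightarrow> \<theta>s (snd y) - fst y < e2 \<Longrightarrow> 0 < sp (-1) y" by (metis insert_iff)
  then obtain e where e: "e > 0" "\<And>\<sigma> y. \<sigma> \<in> {1, -1} \<Longrightarrow> y \<in> C \<Longrightarrow> \<theta>s (snd y) - fst y < e \<Longrightarrow> 0 < sp \<sigma> y"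
    using that[of "min e1 e2"] by force
  \<comment> \<open>Small enough that the translated shock lies in the collar where both
    characteristics cross it outwards, and that \<open>x\<close> is still in the truncated region
    \<open>R\<close>.\<close>
  define \<eta> where "\<eta> = min (e / 2) (\<theta>s (snd x) - fst x)"
  have \<eta>: "0 < \<eta>" "\<eta> < e" "\<eta> \<le> \<theta>s (snd x) - fst x" using e x(4) by (auto simp: \<eta>_def)
  define R where "R = C \<inter> {y. fst y + \<eta> \<le> \<theta>s (snd y)}"
  have xR: "x \<in> R" using x \<eta> by (auto simp: R_def C_def mem_Times_iff)
  define E where "E y = exp (- \<Lambda> * fst y) * dev y" for y
  obtain y where y: "y \<in> R" "\<And>z. z \<in> R \<Longrightarrow> E z \<le> E y"
  proof (rule periodic_attains_sup[of R T T' E])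
    show "closed R" unfolding R_def by (intro closed_Int clC closed_Collect_le continuous_intros)
    show "continuous_on R E" unfolding E_def
      by (intro continuous_intros continuous_on_subset[OF cdev]) (auto simp: R_def)
    show "E (t, p + 2 * pi) = E (t, p)" if "(t, p) \<in> R" for t p
      using that perG by (auto simp: E_def dev_def R_def)
  qed (use bdC perC per_s xR in \<open>auto simp: R_def\<close>)
  have dev_nn: "0 \<le> dev z" for z by (simp add: dev_def deviation_def)
  have "dev y = 0"
  proof (rule ccontr)
    assume "dev y \<noteq> 0"
    then have dpos: "dev y > 0" using dev_nn[of y] by simp
    obtain t p where tp: "y = (t, p)" by fastforce
    have yC: "(t, p) \<in> C" "t + \<eta> \<le> \<theta>s p" using y(1) by (auto simp: R_def tp)
    note Cy = C[OF yC(1), unfolded fst_conv]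
    have "t \<noteq> T" using dpos init[OF Cy(1)] deviation_ub[of T] TT by (auto simp: dev_def tp)
    then have t: "T < t" "t \<le> T'" using Cy by auto
    have yU: "(t, p) \<in> Um" using t TT yC(2) \<eta> by (auto simp: Om_minus_def)
    define g where "g = cgrad \<phi> (t, p)"
    have Gg: "Gm (t, p) = g" using Gm(2)[OF yU] by (simp add: g_def)
    obtain \<sigma> \<tau> :: real where st: "\<sigma> \<in> {1, -1}" "\<tau> \<in> {1, -1}" "dev y = \<tau> * Rinv \<sigma> t g"
      unfolding dev_def deviation_def Rinv_def tp fst_conv Gg by (rule abs_add_abs_signs)
    define A where "A = chth \<sigma> t g"
    define B where "B = chph \<sigma> t g"
    have A: "0 < A" "m \<le> A" using m(1) m(2)[OF st(1) yC(1)] by (auto simp: A_def Gg)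
    \<comment> \<open>One signed invariant never exceeds the deviation, so \<open>h\<close> stays
      below the weighted deviation \<open>E\<close> along the backward segment and equals it at
      \<open>s = 0\<close>. Since \<open>h\<close> increases there, \<open>E\<close> cannot be
      maximal at \<open>y\<close>.\<close>
    define h where "h s = exp (- \<Lambda> * (t - s * A)) * (\<tau> * Rinv \<sigma> (t - s * A) (cgrad \<phi> (t - s * A, p - s * B)))" for s
    have "(h has_real_derivative exp (- \<Lambda> * (t - 0 * A)) * (\<Lambda> * A) * (\<tau> * Rinv \<sigma> (t - 0 * A) (cgrad \<phi> (t - 0 * A, p - 0 * B)))
        + \<tau> * (- source \<sigma> t g) * exp (- \<Lambda> * (t - 0 * A))) (at 0)"
      unfolding h_def[abs_def]
    proof (rule DERIV_mult)
      show "((\<lambda>s. exp (- \<Lambda> * (t - s * A))) has_real_derivative exp (- \<Lambda> * (t - 0 * A)) * (\<Lambda> * A)) (at 0)"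
        by (auto intro!: derivative_eq_intros)
      show "((\<lambda>s. \<tau> * Rinv \<sigma> (t - s * A) (cgrad \<phi> (t - s * A, p - s * B))) has_real_derivative \<tau> * (- source \<sigma> t g)) (at 0)"
        using DERIV_Rinv_backward[OF yU _ st(1)] Cy(5) unfolding Gg A_def B_def g_def by (intro DERIV_cmult) simp
    qed
    then have hd: "(h has_real_derivative exp (- \<Lambda> * t) * (\<Lambda> * A * dev y - \<tau> * source \<sigma> t g)) (at 0)"
      by (rule DERIV_cong) (simp add: st(3) g_def algebra_simps)
    have "\<tau> * source \<sigma> t g \<le> \<bar>source \<sigma> t g\<bar>" using st(2) by auto
    also have "\<dots> \<le> L * dev y"
      using L(2)[OF st(1) Cy(4,5)] q1(2)[OF yC(1)] q2(2)[OF yC(1)] by (simp add: dev_def tp Gg)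
    also have "\<dots> = L / m * m * dev y" using m(1) by simp
    also have "\<dots> \<le> L / m * A * dev y"
      using A(2) L(1) m(1) dpos by (intro mult_right_mono mult_left_mono) auto
    also have "\<dots> < \<Lambda> * A * dev y" using A(1) dpos by (simp add: \<Lambda>_def algebra_simps)
    finally have "0 < exp (- \<Lambda> * t) * (\<Lambda> * A * dev y - \<tau> * source \<sigma> t g)" by simp
    from DERIV_pos_inc_right[OF hd this] obtain d1 where d1: "d1 > 0" "\<And>s. 0 < s \<Longrightarrow> s < d1 \<Longrightarrow> h 0 < h s" by auto
    define k where "k s = \<theta>s (p - s * B) - (t - s * A)" for s
    have kd: "(k has_real_derivative sp \<sigma> (t, p)) (at 0)"
    proof -
      have "(k has_real_derivative ds (p - 0 * B) * - B - - A) (at 0)"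
        unfolding k_def[abs_def]
        by (intro DERIV_diff DERIV_chain2[OF ds]) (auto intro!: derivative_eq_intros)
      then show ?thesis by (rule DERIV_cong) (simp add: sp_def A_def B_def Gg)
    qed
    \<comment> \<open>The backward segment stays in \<open>R\<close>: inside the collar the distance
      to the shock grows, outside it is larger than \<open>\<eta>\<close> and continuity is
      enough.\<close>
    have "\<exists>d2>0. \<forall>s. 0 < s \<longrightarrow> s < d2 \<longrightarrow> \<eta> \<le> k s"
    proof (cases "k 0 < e")
      case True
      then have "0 < sp \<sigma> (t, p)" using e(2)[OF st(1) yC(1)] by (simp add: k_def)
      from DERIV_pos_inc_right[OF kd this] obtain d2 where
        d2: "d2 > 0" "\<And>s. 0 < s \<Longrightarrow> s < d2 \<Longrightarrow> k 0 < k s" by auto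
      have "\<eta> \<le> k 0" using yC(2) by (simp add: k_def)
      then show ?thesis using d2 by (meson less_imp_le order_trans)
    next
      case False
      have "(k \<longlongrightarrow> k 0) (at_right 0)" using DERIV_isCont[OF kd] by (simp add: isCont_def filterlim_at_split)
      then have "\<forall>\<^sub>F s in at_right 0. \<eta> < k s" using False \<eta>(2) by (intro order_tendstoD(1)[of k "k 0"]) auto
      then show ?thesis unfolding eventually_at_right_field by (auto intro: less_imp_le)
    qed
    then obtain d2 where d2: "d2 > 0" "\<And>s. 0 < s \<Longrightarrow> s < d2 \<Longrightarrow> \<eta> \<le> k s" by blast
    define r where "r = (t - T) / A"
    have r: "0 < r" using t A by (simp add: r_def)
    define s where "s = min (min d1 d2) r / 2"
    have s: "0 < s" "s < d1" "s < d2" "s < (t - T) / A"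
      unfolding r_def[symmetric] using d1(1) d2(1) r by (auto simp: s_def)
    have sA: "0 < s * A" "s * A < t - T" using s A by (auto simp: pos_less_divide_eq)
    define z where "z = (t - s * A, p - s * B)"
    have zU: "z \<in> Um" using sA TT t d2(2)[OF s(1,3)] \<eta> by (auto simp: z_def Om_minus_def k_def)
    have zR: "z \<in> R" using sA t d2(2)[OF s(1,3)] zU U_C by (auto simp: z_def R_def C_def k_def)
    have "h s \<le> E z"
    proof -
      have "\<tau> * Rinv \<sigma> (fst z) (cgrad \<phi> z) \<le> dev z"
        using st(1,2) unfolding dev_def Gm(2)[OF zU] deviation_def Rinv_def by auto
      then show ?thesis unfolding h_def E_def by (auto simp: z_def intro!: mult_left_mono)
    qed
    also have "\<dots> \<le> E y" by (rule y(2)[OF zR])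
    also have "E y = h 0" unfolding h_def E_def st(3) by (simp add: tp g_def)
    finally show False using d1(2)[OF s(1,2)] by simp
  qed
  then have "E x \<le> 0" using y(2)[OF xR] by (simp add: E_def)
  then show ?thesis using dev_nn[of x] by (simp add: E_def mult_le_0_iff)
qed

lemma upstream_closure:
  assumes x: "(t, p) \<in> Cm" "\<theta>0 < t"
    and inner: "\<And>s. \<theta>0 < s \<Longrightarrow> s < t \<Longrightarrow> Gm (s, p) = (ub s, 0)"
  shows "Gm (t, p) = (ub t, 0)"
proof (rule agree_on_closed_interval[of \<theta>0 t "\<lambda>s. Gm (s, p)" "\<lambda>s. (ub s, 0)" t])
  show "continuous_on {\<theta>0..t} (\<lambda>s. Gm (s, p))"
    using x by (intro continuous_on_compose2[OF Gm(1)] continuous_intros) (auto simp: Cl_minus_def)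
  show "continuous_on {\<theta>0..t} (\<lambda>s. (ub s, 0::real))"
    using fst_range(1)[OF x(1)] by (intro continuous_intros continuous_on_subset[OF continuous_on_ub]) auto
qed (use x inner in auto)

text \<open>The radial flow is time-like, and this is an open condition. As the non-time-like points
  beyond \<open>T\<close> form a closed periodic set, they stay away from
  \<open>\<theta> = T\<close> uniformly, which leaves a slab in which
  \<open>deviation_vanishes\<close> applies.\<close>

lemma upstream_step:
  assumes T: "\<theta>0 \<le> T" "T < \<theta>1" and init: "\<And>x. x \<in> Cm \<Longrightarrow> fst x \<le> T \<Longrightarrow> Gm x = (ub (fst x), 0)"
  shows "\<exists>T'>T. T' \<le> \<theta>1 \<and> (\<forall>x\<in>Cm. fst x \<le> T' \<longrightarrow> Gm x = (ub (fst x), 0))"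
proof -
  define h where "h x = min (fst (Gm x)) (min ((fst (Gm x))\<^sup>2 - cc (gsq (fst x) (Gm x)))
     (cc (gsq (fst x) (Gm x)) - (snd (Gm x) / sin (fst x))\<^sup>2))" for x
  have h: "timelike (fst x) (Gm x) \<longleftrightarrow> 0 < h x" for x by (auto simp: h_def timelike_def)
  have "continuous_on Cm (\<lambda>x. cc (gsq (fst x) (Gm x)))"
    unfolding csq2_def by (intro continuous_intros continuous_on_gsq order_refl)
  then have ch: "continuous_on Cm h" unfolding h_def
    using sin_nz(1) by (intro continuous_intros) force+
  define B where "B = (Cm \<inter> {T..} \<times> UNIV) \<inter> h -` {..0}"
  have clB: "closed B" unfolding B_def
    by (rule continuous_closed_preimage[OF continuous_on_subset[OF ch]])
      (auto intro!: closed_Int closed_C closed_Times)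
  have T0: "timelike (fst x) (Gm x)" if "x \<in> Cm" "fst x \<le> T" for x
    using init[OF that] timelike_ub fst_range(1)[OF that(1)] by simp
  have posB: "0 < fst x - T" if "x \<in> B" for x
  proof -
    have "x \<in> Cm" "\<not> timelike (fst x) (Gm x)" using that h[of x] by (auto simp: B_def)
    then show ?thesis using T0[of x] by force
  qed
  have perB: "(t, p + 2 * pi) \<in> B \<longleftrightarrow> (t, p) \<in> B" for t p
    using per_C per_Gm by (auto simp: B_def h_def)
  obtain m where m: "0 < m" "\<And>x. x \<in> B \<Longrightarrow> m \<le> fst x - T"
    by (rule periodic_positive_lower_bound[OF clB, of \<theta>0 \<theta>1 "\<lambda>x. fst x - T"])
      (use perB posB fst_range(1) in \<open>auto simp: B_def intro!: continuous_intros\<close>)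
  define T' where "T' = min \<theta>1 (T + m / 2)"
  have T': "T < T'" "T' \<le> \<theta>1" "T' < T + m" using T m by (auto simp: T'_def)
  have tl: "timelike (fst x) (Gm x)" if "x \<in> Cm" "T \<le> fst x" "fst x \<le> T'" for x
  proof (rule ccontr)
    assume "\<not> timelike (fst x) (Gm x)"
    then have "x \<in> B" using that h[of x] by (auto simp: B_def mem_Times_iff)
    then show False using m(2)[of x] that T' by auto
  qed
  have inner: "Gm x = (ub (fst x), 0)" if "x \<in> Cm" "fst x \<le> T'" "fst x < \<theta>s (snd x)" for x
  proof (cases "fst x \<le> T")
    case False
    have "Gm z = (ub T, 0)" if "z \<in> Cm" "fst z = T" for z using init[of z] that by simp
    from deviation_vanishes[OF T(1) T'(1,2) this tl] have "dev x = 0" using False that by simp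
    then show ?thesis using deviation_eq_0 tl False that fst_range(1) by (simp add: dev_def)
  qed (use init that in simp)
  have "Gm x = (ub (fst x), 0)" if x: "x \<in> Cm" "fst x \<le> T'" for x
  proof (cases "fst x < \<theta>s (snd x)")
    case False
    obtain t p where tp: "x = (t, p)" by fastforce
    have t: "t = \<theta>s p" "t \<le> T'" using False x by (auto simp: tp Cl_minus_def)
    have "Gm (t, p) = (ub t, 0)"
      by (rule upstream_closure) (use x t inner[of "(_, p)"] range_s(1) in \<open>auto simp: tp Cl_minus_def\<close>)
    then show ?thesis by (simp add: tp)
  qed (use inner x in blast)
  then show ?thesis using T' by blast
qed

text \<open>The set of \<theta> up to which the flow is radial contains the inlet, is closed by
  continuity of \<open>Gm\<close>, and can always be enlarged by
  \<open>upstream_step\<close>.\<close>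

lemma upstream_radial: "x \<in> Cm \<Longrightarrow> Gm x = (ub (fst x), 0)"
proof -
  define P where "P t \<longleftrightarrow> (\<forall>x\<in>Cm. fst x \<le> t \<longrightarrow> Gm x = (ub (fst x), 0))" for t
  define J where "J = {t. \<theta>0 \<le> t \<and> t \<le> \<theta>1 \<and> P t}"
  have "P \<theta>0"
  proof -
    have "x = (\<theta>0, snd x)" if "x \<in> Cm" "fst x \<le> \<theta>0" for x using that by (auto simp: Cl_minus_def prod_eq_iff)
    then show ?thesis unfolding P_def using inlet ub_\<theta>0 by (metis fst_conv)
  qed
  then have J0: "\<theta>0 \<in> J" using theta by (auto simp: J_def)
  have bd: "bdd_above J" by (auto simp: J_def)
  define T where "T = Sup J"
  have T: "\<theta>0 \<le> T" "T \<le> \<theta>1"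
  proof -
    show "\<theta>0 \<le> T" unfolding T_def by (rule cSup_upper[OF J0 bd])
    show "T \<le> \<theta>1" unfolding T_def by (rule cSup_least) (use J0 in \<open>auto simp: J_def\<close>)
  qed
  have below: "Gm x = (ub (fst x), 0)" if "x \<in> Cm" "fst x < T" for x
  proof -
    have "J \<noteq> {}" using J0 by blast
    from less_cSupD[OF this that(2)[unfolded T_def]]
    obtain t where t: "t \<in> J" "fst x < t" by (elim bexE)
    have "P t" using t(1) unfolding J_def by blast
    moreover have "fst x \<le> t" using t(2) by (rule less_imp_le)
    ultimately show ?thesis using that(1) unfolding P_def by blast
  qed
  have "P T" unfolding P_def
  proof (intro ballI impI)
    fix x assume x: "x \<in> Cm" "fst x \<le> T"
    obtain t p where tp: "x = (t, p)" by fastforce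
    show "Gm x = (ub (fst x), 0)"
    proof (cases "t = \<theta>0 \<or> t < T")
      case True then show ?thesis using inlet ub_\<theta>0 below[OF x(1)] by (auto simp: tp)
    next
      case False
      have tr: "\<theta>0 < t" "t \<le> \<theta>s p" using x(1) False by (auto simp: tp Cl_minus_def)
      have "Gm (t, p) = (ub t, 0)"
        by (rule upstream_closure) (use x tr below[of "(_, p)"] in \<open>auto simp: tp Cl_minus_def\<close>)
      then show ?thesis by (simp add: tp)
    qed
  qed
  have "T = \<theta>1"
  proof (rule ccontr)
    assume "T \<noteq> \<theta>1"
    then have "T < \<theta>1" using T by simp
    from upstream_step[OF T(1) this] \<open>P T\<close> obtain T' where "T < T'" "T' \<in> J"
      using T by (auto simp: P_def J_def)
    then show False using cSup_upper[OF _ bd] by (force simp: T_def)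
  qed
  then show "x \<in> Cm \<Longrightarrow> Gm x = (ub (fst x), 0)"
    using \<open>P T\<close> fst_range(1)[of x] by (auto simp: P_def)
qed

end

section \<open>Mass flux through the outlet\<close>

context transonic begin

text \<open>The continuous extensions of the coordinate fluxes to the shock and the outlet.\<close>

definition Mth :: "real \<times> real \<Rightarrow> real" where
  "Mth x = sin (fst x) * rr (gsq (fst x) (Gp x)) * fst (Gp x)"

definition Mph :: "real \<times> real \<Rightarrow> real" where
  "Mph x = rr (gsq (fst x) (Gp x)) / sin (fst x) * snd (Gp x)"

lemma Gp_gsq_less: "x \<in> Cp \<Longrightarrow> gsq (fst x) (Gp x) < qm\<^sup>2"
  using Gp_gsq_le[of x] cs_less_qm cs_pos power_strict_mono[of cs qm 2] by force

lemma continuous_on_M: "continuous_on Cp Mth" "continuous_on Cp Mph"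
proof -
  have r: "continuous_on Cp (\<lambda>x. rr (gsq (fst x) (Gp x)))"
    by (rule continuous_on_compose2[OF continuous_on_rr continuous_on_gsq(2)])
      (use Gp_gsq_less less_imp_le in auto)
  show "continuous_on Cp Mth" "continuous_on Cp Mph"
    unfolding Mth_def Mph_def using sin_nz(2) by (auto intro!: continuous_intros r) force
qed

lemma M_eq_mflux: "x \<in> Up \<Longrightarrow> Mth x = mflux_th \<phi> x" "x \<in> Up \<Longrightarrow> Mph x = mflux_ph \<phi> x"
  by (auto simp: Mth_def Mph_def mflux_th_def mflux_ph_def Gp(2) cgrad_def)

lemma
  assumes x: "x \<in> Up"
  shows mflux_differentiable: "mflux_th \<phi> differentiable (at x)" "mflux_ph \<phi> differentiable (at x)"
    and mflux_balance: "dth (mflux_th \<phi>) x = - dph (mflux_ph \<phi>) x"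
proof -
  obtain t p where tp: "x = (t, p)" by fastforce
  have xC: "x \<in> Cp" using x U_C by auto
  have S: "sin t \<noteq> 0" using sin_nz(2)[OF xC] by (simp add: tp)
  have y: "gsq t (cgrad \<phi> (t, p)) < qm\<^sup>2" using Gp_gsq_less[OF xC] Gp(2)[OF x] by (simp add: tp)
  show "mflux_th \<phi> differentiable (at x)" "mflux_ph \<phi> differentiable (at x)"
    using mflux_partials(1,2)[OF open_U(2) C2p x[unfolded tp] S y] by (simp_all add: tp)
  show "dth (mflux_th \<phi>) x = - dph (mflux_ph \<phi>) x"
    using eqp[OF x] flow_eq_iff[of x \<phi>] S by (simp add: tp)
qed

lemma continuous_on_mflux_partials:
  "continuous_on Up (dth (mflux_th \<phi>))" "continuous_on Up (dth (mflux_ph \<phi>))"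
proof -
  have c1: "continuous_on Up (dth \<phi>)" "continuous_on Up (dph \<phi>)" "continuous_on Up (dth (dth \<phi>))"
    "continuous_on Up (dth (dph \<phi>))"
    using C2p by (auto simp: C2_on_def C1_on_def)
  have sn: "sin (fst x) \<noteq> 0" if "x \<in> Up" for x using sin_nz(2)[of x] that U_C by force
  have g: "continuous_on Up (\<lambda>x. gsq (fst x) (cgrad \<phi> x))"
    unfolding gsq_def using sn by (intro continuous_intros cont_cgrad) auto
  have lt: "gsq (fst x) (cgrad \<phi> x) < qm\<^sup>2" if "x \<in> Up" for x
    using Gp_gsq_less[of x] that U_C Gp(2)[OF that] by force
  have r: "continuous_on Up (\<lambda>x. rr (gsq (fst x) (cgrad \<phi> x)))"
    by (rule continuous_on_compose2[OF continuous_on_rr g]) (use lt less_imp_le in auto)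
  have cc: "continuous_on Up (\<lambda>x. cc (gsq (fst x) (cgrad \<phi> x)))"
    unfolding csq2_def by (intro continuous_intros g)
  have cnz: "cc (gsq (fst x) (cgrad \<phi> x)) \<noteq> 0" if "x \<in> Up" for x
    using cc_pos_iff[of "gsq (fst x) (cgrad \<phi> x)"] lt[OF that] by simp
  have eq: "dth (mflux_th \<phi>) x = rr (gsq (fst x) (cgrad \<phi> x)) * (cos (fst x) * dth \<phi> x + sin (fst x) * dth (dth \<phi>) x
      - sin (fst x) * dth \<phi> x / cc (gsq (fst x) (cgrad \<phi> x)) * (dth \<phi> x * dth (dth \<phi>) x
         + dph \<phi> x / sin (fst x) * (dth (dph \<phi>) x / sin (fst x) - dph \<phi> x * cos (fst x) / (sin (fst x))\<^sup>2)))"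
     "dth (mflux_ph \<phi>) x = rr (gsq (fst x) (cgrad \<phi> x)) * (dth (dph \<phi>) x / sin (fst x) - dph \<phi> x * cos (fst x) / (sin (fst x))\<^sup>2
      - dph \<phi> x / sin (fst x) / cc (gsq (fst x) (cgrad \<phi> x)) * (dth \<phi> x * dth (dth \<phi>) x
         + dph \<phi> x / sin (fst x) * (dth (dph \<phi>) x / sin (fst x) - dph \<phi> x * cos (fst x) / (sin (fst x))\<^sup>2)))"
    if "x \<in> Up" for x
    using mflux_partials(3,4)[OF open_U(2) C2p, of "fst x" "snd x"] that sn lt by simp_all
  show "continuous_on Up (dth (mflux_th \<phi>))" "continuous_on Up (dth (mflux_ph \<phi>))"
    by (simp_all only: eq cong: continuous_on_cong)
      (intro continuous_intros r cc c1; use sn cnz in simp)+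
qed

text \<open>The mass flux through the curves \<open>\<theta> = cur s\<close>, which interpolate between the shock and
  the outlet, does not depend on \<open>s\<close>.\<close>
definition cur :: "real \<Rightarrow> real \<Rightarrow> real" where "cur s p = \<theta>s p + s * (\<theta>1 - \<theta>s p)"

lemma cur_C: "s \<in> {0..1} \<Longrightarrow> (cur s p, p) \<in> Cp"
proof -
  assume s: "s \<in> {0..1}"
  have d: "0 < \<theta>1 - \<theta>s p" using range_s by simp
  then have "s * (\<theta>1 - \<theta>s p) \<le> 1 * (\<theta>1 - \<theta>s p)" "0 \<le> s * (\<theta>1 - \<theta>s p)" using s by (auto intro: mult_right_mono)
  then show ?thesis by (auto simp: cur_def Cl_plus_def)
qed

lemma cur_U: "0 < s \<Longrightarrow> s < 1 \<Longrightarrow> (cur s p, p) \<in> Up"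
proof -
  assume s: "0 < s" "s < 1"
  have d: "0 < \<theta>1 - \<theta>s p" using range_s by simp
  then have "s * (\<theta>1 - \<theta>s p) < 1 * (\<theta>1 - \<theta>s p)" "0 < s * (\<theta>1 - \<theta>s p)"
    using s by (auto intro: mult_strict_right_mono)
  then show ?thesis by (auto simp: cur_def Om_plus_def)
qed

text \<open>The divergence theorem for fluxes that are merely continuous up to the boundary: the
  \<open>s\<close>-derivative is computed for \<open>0 < s < 1\<close> only, and continuity of the
  integral carries the constancy to both ends.\<close>

lemma outlet_flux: "integral {0..2 * pi} (\<lambda>p. Mth (\<theta>1, p)) =
    integral {0..2 * pi} (\<lambda>p. Mth (\<theta>s p, p) - Mph (\<theta>s p, p) * ds p)"
proof -
  \<comment> \<open>The flux through the curve per unit longitude; \<open>(1 - s) * ds p\<close> is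
    the slope of \<open>cur s\<close>.\<close>
  define F where "F s p = Mth (cur s p, p) - Mph (cur s p, p) * ((1 - s) * ds p)" for s p
  define F' where "F' s p = dth (mflux_th \<phi>) (cur s p, p) * (\<theta>1 - \<theta>s p)
     - (dth (mflux_ph \<phi>) (cur s p, p) * (\<theta>1 - \<theta>s p) * ((1 - s) * ds p) + - ds p * Mph (cur s p, p))" for s p
  define J where "J s = integral (cbox 0 (2 * pi)) (F s)" for s
  have ccur: "continuous_on A (\<lambda>x. (cur (fst x) (snd x), snd x))" for A
    unfolding cur_def by (intro continuous_intros)
  have cM: "continuous_on ({0..1} \<times> UNIV) (\<lambda>x. Mth (cur (fst x) (snd x), snd x))"
    "continuous_on ({0..1} \<times> UNIV) (\<lambda>x. Mph (cur (fst x) (snd x), snd x))"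
    by (rule continuous_on_compose2[OF continuous_on_M(1) ccur] continuous_on_compose2[OF continuous_on_M(2) ccur];
        use cur_C in auto)+
  have cF: "continuous_on ({0..1} \<times> UNIV) (\<lambda>(s, p). F s p)"
    unfolding F_def split_beta by (intro continuous_intros cM)
  have contJ: "continuous_on {0..1} J"
    unfolding J_def by (rule integral_continuous_on_param) (rule continuous_on_subset[OF cF], auto)
  have cm: "continuous_on ({0<..<1} \<times> UNIV) (\<lambda>x. dth (mflux_th \<phi>) (cur (fst x) (snd x), snd x))"
    "continuous_on ({0<..<1} \<times> UNIV) (\<lambda>x. dth (mflux_ph \<phi>) (cur (fst x) (snd x), snd x))"
    by (rule continuous_on_compose2[OF continuous_on_mflux_partials(1) ccur]
        continuous_on_compose2[OF continuous_on_mflux_partials(2) ccur]; use cur_U in auto)+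
  have cM': "continuous_on ({0<..<1} \<times> UNIV) (\<lambda>x. Mph (cur (fst x) (snd x), snd x))"
    by (rule continuous_on_subset[OF cM(2)]) auto
  have cF': "continuous_on ({0<..<1} \<times> cbox 0 (2 * pi)) (\<lambda>(s, p). F' s p)"
    unfolding F'_def split_beta
    by (rule continuous_on_subset[of "{0<..<1} \<times> UNIV"]) (auto intro!: continuous_intros cm cM')
  have derM: "((\<lambda>s. Mth (cur s p, p)) has_real_derivative dth (mflux_th \<phi>) (cur s p, p) * (\<theta>1 - \<theta>s p)) (at s)"
     "((\<lambda>s. Mph (cur s p, p)) has_real_derivative dth (mflux_ph \<phi>) (cur s p, p) * (\<theta>1 - \<theta>s p)) (at s)"
    if s: "0 < s" "s < 1" for s p
  proof -
    have dc: "((\<lambda>s. cur s p) has_real_derivative \<theta>1 - \<theta>s p) (at s)"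
      unfolding cur_def by (auto intro!: derivative_eq_intros)
    have ev: "\<forall>\<^sub>F s in nhds s. s \<in> {0<..<1}" using s by (intro eventually_nhds_in_open) auto
    have "((\<lambda>s. mflux_th \<phi> (cur s p, p)) has_real_derivative dth (mflux_th \<phi>) (cur s p, p) * (\<theta>1 - \<theta>s p)) (at s)"
      "((\<lambda>s. mflux_ph \<phi> (cur s p, p)) has_real_derivative dth (mflux_ph \<phi>) (cur s p, p) * (\<theta>1 - \<theta>s p)) (at s)"
      using DERIV_along_curve[OF mflux_differentiable(1)[OF cur_U[OF s]] dc DERIV_const]
        DERIV_along_curve[OF mflux_differentiable(2)[OF cur_U[OF s]] dc DERIV_const] by simp_all
    moreover have "\<forall>\<^sub>F s in nhds s. Mth (cur s p, p) = mflux_th \<phi> (cur s p, p)"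
      "\<forall>\<^sub>F s in nhds s. Mph (cur s p, p) = mflux_ph \<phi> (cur s p, p)"
      using ev by (eventually_elim, simp add: M_eq_mflux cur_U)+
    ultimately show "((\<lambda>s. Mth (cur s p, p)) has_real_derivative dth (mflux_th \<phi>) (cur s p, p) * (\<theta>1 - \<theta>s p)) (at s)"
     "((\<lambda>s. Mph (cur s p, p)) has_real_derivative dth (mflux_ph \<phi>) (cur s p, p) * (\<theta>1 - \<theta>s p)) (at s)"
      by (simp_all cong: DERIV_cong_ev)
  qed
  have derJ: "(J has_real_derivative 0) (at s)" if s: "0 < s" "s < 1" for s
  proof -
    have "(J has_real_derivative integral (cbox 0 (2 * pi)) (F' s)) (at s within {0<..<1})"
      unfolding J_def
    proof (rule leibniz_rule_field_derivative[OF _ _ cF'])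
      fix r p assume r: "r \<in> {0<..<1::real}"
      have "((\<lambda>r. F r p) has_real_derivative F' r p) (at r)"
        unfolding F_def F'_def
        by (intro DERIV_diff DERIV_mult derM DERIV_cong[OF DERIV_cmult_right[OF DERIV_diff[OF DERIV_const DERIV_ident]]])
          (use r in auto)
      then show "((\<lambda>r. F r p) has_real_derivative F' r p) (at r within {0<..<1})"
        by (rule has_field_derivative_at_within)
    next
      fix r assume "r \<in> {0<..<1::real}"
      then have "continuous_on (cbox 0 (2 * pi)) (\<lambda>p. (\<lambda>(s, p). F s p) (r, p))"
        by (intro continuous_on_compose2[OF cF] continuous_intros) auto
      then show "F r integrable_on cbox 0 (2 * pi)" by (auto intro: integrable_continuous_real)
    qed (use s in auto)
    moreover have "at s within {0<..<1} = at s" using s by (intro at_within_open) auto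
    ultimately have J': "(J has_real_derivative integral (cbox 0 (2 * pi)) (F' s)) (at s)" by metis
    \<comment> \<open>By the equation \<open>F' s\<close> is an exact derivative in the longitude,
      with primitive \<open>W\<close>; periodicity makes its integral vanish.\<close>
    define W where "W p = - (mflux_ph \<phi> (cur s p, p) * (\<theta>1 - \<theta>s p))" for p
    have "(F' s has_integral (W (2 * pi) - W 0)) {0..2 * pi}"
    proof (rule fundamental_theorem_of_calculus)
      fix p :: real
      have dc: "((\<lambda>p. cur s p) has_real_derivative ds p + s * (0 - ds p)) (at p)"
        unfolding cur_def by (intro DERIV_add ds DERIV_cmult DERIV_diff DERIV_const)
      have U: "(cur s p, p) \<in> Up" using cur_U[OF s] .
      have "(W has_real_derivative - ((dth (mflux_ph \<phi>) (cur s p, p) * (ds p + s * (0 - ds p)) + dph (mflux_ph \<phi>) (cur s p, p) * 1)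
           * (\<theta>1 - \<theta>s p) + (0 - ds p) * mflux_ph \<phi> (cur s p, p))) (at p)"
        unfolding W_def[abs_def]
        by (intro DERIV_minus DERIV_mult DERIV_along_curve mflux_differentiable(2) U dc DERIV_ident DERIV_diff DERIV_const ds)
      then have "(W has_real_derivative F' s p) (at p)"
        by (rule DERIV_cong) (simp add: F'_def mflux_balance[OF U] M_eq_mflux(2)[OF U] algebra_simps)
      then show "(W has_vector_derivative F' s p) (at p within {0..2 * pi})"
        by (auto simp: has_real_derivative_iff_has_vector_derivative intro: has_vector_derivative_at_within)
    qed simp
    moreover have "W (2 * pi) = W 0"
    proof -
      have e: "\<theta>s (2 * pi) = \<theta>s 0" using per_s[of 0] by simp
      have "cgrad \<phi> (t, 2 * pi) = cgrad \<phi> (t, 0)" for t using per_cgrad[of t 0] by simp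
      moreover then have "dph \<phi> (t, 2 * pi) = dph \<phi> (t, 0)" for t by (simp add: cgrad_def)
      ultimately show ?thesis by (simp add: W_def mflux_ph_def cur_def e)
    qed
    ultimately have "integral (cbox 0 (2 * pi)) (F' s) = 0" by (auto dest: integral_unique)
    then show ?thesis using J' by simp
  qed
  have "J 1 = J 0" by (rule DERIV_isconst_end[OF _ contJ derJ]) auto
  moreover have "F 1 = (\<lambda>p. Mth (\<theta>1, p))" "F 0 = (\<lambda>p. Mth (\<theta>s p, p) - Mph (\<theta>s p, p) * ds p)"
    by (simp_all add: F_def fun_eq_iff cur_def)
  ultimately show ?thesis by (simp add: J_def)
qed

end

section \<open>Comparison with radial subsonic flows\<close>

context nozzle begin

definition usub :: "real \<Rightarrow> real \<Rightarrow> real" where "usub \<epsilon> t = qsub ((K + \<epsilon> * t) / sin t)"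

text \<open>Radial subsonic velocities whose mass flux \<open>K + \<epsilon> t\<close> is perturbed by a strictly monotone
  amount: they are strict sub- or supersolutions, depending on the sign of \<open>\<epsilon>\<close>.\<close>

definition admissible :: "real \<Rightarrow> bool" where
  "admissible \<epsilon> \<longleftrightarrow> (\<forall>t\<in>{\<theta>0..\<theta>1}. (K + \<epsilon> * t) / sin t \<in> {0<..<mflux cs})"

lemma admissible_0: "admissible 0"
  using K_range by (simp add: admissible_def)

lemma admissible_small: obtains e where "e > 0" "\<And>\<epsilon>. \<bar>\<epsilon>\<bar> \<le> e \<Longrightarrow> admissible \<epsilon>"
proof -
  have m: "0 < mflux cs" using mflux_mono[of 0 cs] cs_pos by simp
  have c: "continuous_on {\<theta>0..\<theta>1} (\<lambda>t. min K (mflux cs * sin t - K))"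
    by (intro continuous_intros)
  obtain s where s: "s \<in> {\<theta>0..\<theta>1}"
    "\<forall>t\<in>{\<theta>0..\<theta>1}. min K (mflux cs * sin s - K) \<le> min K (mflux cs * sin t - K)"
    using continuous_attains_inf[OF compact_Icc _ c] theta by auto
  \<comment> \<open>The margin by which the flux \<open>K\<close> stays between stagnation and
    choking; a perturbation \<open>\<epsilon> * t\<close> of at most half of it keeps both
    inequalities strict.\<close>
  define g where "g = min K (mflux cs * sin s - K)"
  have g: "g > 0" using K_range[OF s(1)] sin_pos[OF s(1)] K_pos by (simp add: g_def field_simps)
  have tpos: "0 < \<theta>1" using theta by simp
  show ?thesis
  proof (rule that[of "g / (2 * \<theta>1)"])
    show "g / (2 * \<theta>1) > 0" using g tpos by simp
    fix \<epsilon> assume e: "\<bar>\<epsilon>\<bar> \<le> g / (2 * \<theta>1)"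
    show "admissible \<epsilon>" unfolding admissible_def
    proof
      fix t assume t: "t \<in> {\<theta>0..\<theta>1}"
      have "\<bar>\<epsilon> * t\<bar> \<le> g / (2 * \<theta>1) * \<theta>1"
        unfolding abs_mult using e t theta g by (intro mult_mono) auto
      also have "\<dots> < g" using g tpos by simp
      also have "g \<le> min K (mflux cs * sin t - K)" using s(2) t by (simp add: g_def)
      finally have "0 < K + \<epsilon> * t" "K + \<epsilon> * t < mflux cs * sin t" by (auto simp: abs_less_iff)
      then show "(K + \<epsilon> * t) / sin t \<in> {0<..<mflux cs}" using sin_pos[OF t] by (simp add: field_simps)
    qed
  qed
qed

lemma usub:
  assumes a: "admissible \<epsilon>" and t: "t \<in> {\<theta>0..\<theta>1}"
  shows "usub \<epsilon> t \<in> {0<..<cs}" "mflux (usub \<epsilon> t) * sin t = K + \<epsilon> * t"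
    "\<exists>D. (usub \<epsilon> has_real_derivative D) (at t) \<and> (cc ((usub \<epsilon> t)\<^sup>2) - (usub \<epsilon> t)\<^sup>2) * D =
      cc ((usub \<epsilon> t)\<^sup>2) * (\<epsilon> / (rr ((usub \<epsilon> t)\<^sup>2) * sin t) - cot t * usub \<epsilon> t)"
proof -
  have r: "(K + \<epsilon> * t) / sin t \<in> {0<..<mflux cs}" using a t by (simp add: admissible_def)
  show "usub \<epsilon> t \<in> {0<..<cs}" unfolding usub_def by (rule qsub(1)[OF r])
  show "mflux (usub \<epsilon> t) * sin t = K + \<epsilon> * t"
    unfolding usub_def qsub(2)[OF r] using sin_pos[OF t] by simp
  show "\<exists>D. (usub \<epsilon> has_real_derivative D) (at t) \<and> (cc ((usub \<epsilon> t)\<^sup>2) - (usub \<epsilon> t)\<^sup>2) * D =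
      cc ((usub \<epsilon> t)\<^sup>2) * (\<epsilon> / (rr ((usub \<epsilon> t)\<^sup>2) * sin t) - cot t * usub \<epsilon> t)"
    unfolding usub_def
    by (rule DERIV_radial_branch) (use r sin_pos[OF t] in \<open>auto intro!: derivative_eq_intros\<close>)
qed

lemma continuous_on_usub: "admissible \<epsilon> \<Longrightarrow> continuous_on {\<theta>0..\<theta>1} (usub \<epsilon>)"
  using usub(3) by (meson DERIV_isCont continuous_at_imp_continuous_on)

definition Psi :: "real \<Rightarrow> real \<Rightarrow> real" where "Psi \<epsilon> t = integral {\<theta>0..t} (usub \<epsilon>)"

lemma DERIV_Psi:
  "admissible \<epsilon> \<Longrightarrow> t \<in> {\<theta>0..\<theta>1} \<Longrightarrow> (Psi \<epsilon> has_real_derivative usub \<epsilon> t) (at t within {\<theta>0..\<theta>1})"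
  unfolding Psi_def by (rule integral_has_real_derivative[OF continuous_on_usub])

definition Phim :: "real \<Rightarrow> real" where "Phim t = integral {\<theta>0..t} ub"

lemma DERIV_Phim: "t \<in> {\<theta>0..\<theta>1} \<Longrightarrow> (Phim has_real_derivative ub t) (at t within {\<theta>0..\<theta>1})"
  unfolding Phim_def by (rule integral_has_real_derivative[OF continuous_on_ub])

lemma continuous_on_Psi: "admissible \<epsilon> \<Longrightarrow> continuous_on {\<theta>0..\<theta>1} (Psi \<epsilon>)"
  using DERIV_Psi by (meson DERIV_continuous_on)

lemma continuous_on_Phim: "continuous_on {\<theta>0..\<theta>1} Phim"
  using DERIV_Phim by (meson DERIV_continuous_on)

text \<open>Joint continuity of the perturbed velocities in \<open>\<epsilon>\<close> and the angle
  lets the limit pass under the integral.\<close>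

lemma Psi_diff_tendsto:
  assumes t: "t \<in> {\<theta>0..\<theta>1}"
  shows "((\<lambda>\<epsilon>. Psi \<epsilon> \<theta>1 - Psi \<epsilon> t) \<longlongrightarrow> Psi 0 \<theta>1 - Psi 0 t) (at 0)"
proof -
  obtain e where e: "e > 0" "\<And>\<epsilon>. \<bar>\<epsilon>\<bar> \<le> e \<Longrightarrow> admissible \<epsilon>" using admissible_small by blast
  have range: "(K + \<epsilon> * s) / sin s \<in> {0<..<mflux cs}" if "\<epsilon> \<in> {-e..e}" "s \<in> {\<theta>0..\<theta>1}" for \<epsilon> s
    using e(2)[of \<epsilon>] that by (auto simp: admissible_def)
  have cq: "continuous_on {0<..<mflux cs} qsub"
    by (intro continuous_at_imp_continuous_on ballI DERIV_isCont[OF qsub(3)])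
  have "continuous_on ({-e..e} \<times> cbox t \<theta>1) (\<lambda>(\<epsilon>, s). usub \<epsilon> s)"
    unfolding usub_def split_beta
  proof (rule continuous_on_compose2[OF cq])
    have "sin (snd x) \<noteq> 0" if "x \<in> {-e..e} \<times> cbox t \<theta>1" for x
      using sin_pos[of "snd x"] that t by auto
    then show "continuous_on ({-e..e} \<times> cbox t \<theta>1) (\<lambda>x. (K + fst x * snd x) / sin (snd x))"
      by (intro continuous_intros) auto
    show "(\<lambda>x. (K + fst x * snd x) / sin (snd x)) ` ({-e..e} \<times> cbox t \<theta>1) \<subseteq> {0<..<mflux cs}"
    proof (rule image_subsetI)
      fix x assume "x \<in> {-e..e} \<times> cbox t \<theta>1"
      then show "(K + fst x * snd x) / sin (snd x) \<in> {0<..<mflux cs}" using t by (intro range) auto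
    qed
  qed
  then have "continuous_on {-e..e} (\<lambda>\<epsilon>. integral (cbox t \<theta>1) (usub \<epsilon>))"
    by (rule integral_continuous_on_param)
  moreover have "0 \<in> interior {-e..e}" using e by simp
  ultimately have "isCont (\<lambda>\<epsilon>. integral (cbox t \<theta>1) (usub \<epsilon>)) 0" by (rule continuous_on_interior)
  then have lim: "((\<lambda>\<epsilon>. integral {t..\<theta>1} (usub \<epsilon>)) \<longlongrightarrow> integral {t..\<theta>1} (usub 0)) (at 0)"
    unfolding isCont_def cbox_interval .
  have eq: "integral {t..\<theta>1} (usub \<epsilon>) = Psi \<epsilon> \<theta>1 - Psi \<epsilon> t" if "\<bar>\<epsilon>\<bar> \<le> e" for \<epsilon>
    using Henstock_Kurzweil_Integration.integral_combine[of \<theta>0 t \<theta>1 "usub \<epsilon>"] t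
      integrable_continuous_real[OF continuous_on_usub[OF e(2)[OF that]]] by (simp add: Psi_def)
  have "\<forall>\<^sub>F \<epsilon> in at 0. \<bar>\<epsilon>\<bar> \<le> e"
    using e(1) unfolding eventually_at by (intro exI[of _ e]) (auto simp: dist_real_def)
  then have ev: "\<forall>\<^sub>F \<epsilon> in at 0. integral {t..\<theta>1} (usub \<epsilon>) = Psi \<epsilon> \<theta>1 - Psi \<epsilon> t"
    by eventually_elim (rule eq)
  have e0: "integral {t..\<theta>1} (usub 0) = Psi 0 \<theta>1 - Psi 0 t" by (rule eq) (use e in simp)
  show ?thesis using lim unfolding tendsto_cong[OF ev] e0 .
qed

end

context transonic begin

text \<open>The inlet velocity has no longitudinal component, so the potential is constant on the
  inlet; integration along meridians does the rest.\<close>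

lemma phi_upstream: obtains C where "\<And>x. x \<in> Cm \<Longrightarrow> \<phi> x = Phim (fst x) + C"
proof -
  have contm: "continuous_on Cm \<phi>" using cont_phi Cm_Omega by (rule continuous_on_subset)
  have "((\<lambda>p. \<phi> (\<theta>0, p)) has_real_derivative 0) (at p)" for p
  proof -
    obtain e where e: "e > 0"
      "\<And>h q. 0 < h \<Longrightarrow> h < e \<Longrightarrow> \<bar>q - p\<bar> < e \<Longrightarrow> \<theta>0 < \<theta>s q - h \<and> \<theta>s q + h < \<theta>1"
      using shock_margin by blast
    have "((\<lambda>p. \<phi> (\<theta>0, p)) has_real_derivative fst (Gm (\<theta>0, p)) * 0 + snd (Gm (\<theta>0, p))) (at p)"
    proof (rule DERIV_along_boundary_curve[where e = e and \<sigma> = 1 and U = Um and C = Cm and c = "\<lambda>_. \<theta>0" and c' = "\<lambda>_. 0"])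
      show "(\<theta>0 + 1 * h, q) \<in> Um" if "0 < h" "h < e" "\<bar>q - p\<bar> < e" for h q
        using e(2)[OF that] that by (simp add: Om_minus_def)
    qed (use e(1) C1D(1) Gm U_C(1) contm range_s(1)[THEN less_imp_le] in \<open>auto simp: Cl_minus_def\<close>)
    then show ?thesis by (simp add: inlet)
  qed
  then have const: "\<phi> (\<theta>0, p) = \<phi> (\<theta>0, 0)" for p
    using DERIV_isconst_all[of "\<lambda>p. \<phi> (\<theta>0, p)"] by blast
  have "\<phi> x = Phim (fst x) + (\<phi> (\<theta>0, 0) - Phim \<theta>0)" if "x \<in> Cm" for x
  proof -
    obtain t p where tp: "x = (t, p)" by fastforce
    have t: "\<theta>0 \<le> t" "t \<le> \<theta>s p" using that by (auto simp: tp Cl_minus_def)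
    show ?thesis
    proof (cases "t = \<theta>0")
      case False
      have "\<phi> (t, p) - Phim t = \<phi> (\<theta>0, p) - Phim \<theta>0"
      proof (rule DERIV_isconst_end[of \<theta>0 t "\<lambda>t. \<phi> (t, p) - Phim t"])
        show "continuous_on {\<theta>0..t} (\<lambda>t. \<phi> (t, p) - Phim t)"
          using t range_s[of p]
          by (intro continuous_on_diff continuous_on_compose2[OF contm] continuous_on_subset[OF continuous_on_Phim] continuous_intros)
            (auto simp: Cl_minus_def)
        fix s assume s: "\<theta>0 < s" "s < t"
        then have U: "(s, p) \<in> Um" using t by (auto simp: Om_minus_def)
        have "dth \<phi> (s, p) = ub s" using upstream_radial[of "(s, p)"] Gm(2)[OF U] U U_C by (auto simp: cgrad_def)
        then show "((\<lambda>t. \<phi> (t, p) - Phim t) has_real_derivative 0) (at s)"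
          using DERIV_diff[OF DERIV_dth[OF C1D(1)[OF U]] DERIV_interior[OF DERIV_Phim]] s t range_s[of p] by force
      qed (use False t in auto)
      then show ?thesis using const[of p] by (simp add: tp)
    qed (use const in \<open>simp add: tp\<close>)
  qed
  then show ?thesis using that by blast
qed

text \<open>The upstream velocity is radial, so the slope of the shock drops out of the upstream
  side and a condition on the downstream flow alone remains.\<close>

lemma shock_flux:
  "rr (gsq (\<theta>s p) (Gp (\<theta>s p, p))) *
     (fst (Gp (\<theta>s p, p)) - snd (Gp (\<theta>s p, p)) / sin (\<theta>s p) * (ds p / sin (\<theta>s p))) = K / sin (\<theta>s p)"
proof -
  have t: "\<theta>s p \<in> {\<theta>0..\<theta>1}" using fst_range(1)[OF on_shock(1)[of p]] by simp
  have "Gm (\<theta>s p, p) = (ub (\<theta>s p), 0)" using upstream_radial[OF on_shock(1)] by simp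
  then have "rr ((ub (\<theta>s p))\<^sup>2) * ub (\<theta>s p) = rr (gsq (\<theta>s p) (Gp (\<theta>s p, p))) *
     (fst (Gp (\<theta>s p, p)) - snd (Gp (\<theta>s p, p)) / sin (\<theta>s p) * (ds p / sin (\<theta>s p)))"
    using RH[of p] by (simp add: gsq_def)
  moreover have "rr ((ub (\<theta>s p))\<^sup>2) * ub (\<theta>s p) = K / sin (\<theta>s p)"
    using ub(2)[OF t] sin_pos[OF t] by (simp add: mflux_def field_simps)
  ultimately show ?thesis by simp
qed

lemma outlet_gradient:
  "((\<lambda>p. \<phi> (\<theta>1, p)) has_real_derivative snd (Gp (\<theta>1, p))) (at p)"
proof -
  have contp: "continuous_on Cp \<phi>" using cont_phi Cp_Omega by (rule continuous_on_subset)
  obtain e where e: "e > 0"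
    "\<And>h q. 0 < h \<Longrightarrow> h < e \<Longrightarrow> \<bar>q - p\<bar> < e \<Longrightarrow> \<theta>0 < \<theta>s q - h \<and> \<theta>s q + h < \<theta>1"
    using shock_margin by blast
  have "((\<lambda>p. \<phi> (\<theta>1, p)) has_real_derivative fst (Gp (\<theta>1, p)) * 0 + snd (Gp (\<theta>1, p))) (at p)"
  proof (rule DERIV_along_boundary_curve[where e = e and \<sigma> = "-1" and U = Up and C = Cp and c = "\<lambda>_. \<theta>1" and c' = "\<lambda>_. 0"])
    show "(\<theta>1 + -1 * h, q) \<in> Up" if "0 < h" "h < e" "\<bar>q - p\<bar> < e" for h q
      using e(2)[OF that] that by (simp add: Om_plus_def)
  qed (use e(1) C1D(2) Gp U_C(2) contp range_s(2)[THEN less_imp_le] in \<open>auto simp: Cl_plus_def\<close>)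
  then show ?thesis by simp
qed

text \<open>The factor \<open>\<tau>\<close> treats minima (\<open>\<epsilon> > 0\<close>) and
  maxima (\<open>\<epsilon> < 0\<close>) of the difference at once. The extremum can lie neither on
  the shock nor inside, so it lies on the outlet, where the one-sided derivative orders
  \<open>c1\<close> and the comparison speed.\<close>

lemma comparison:
  assumes adm: "admissible \<epsilon>" and tau: "\<tau> \<in> {1, -1}" "0 < \<tau> * \<epsilon>"
  obtains p0 where "\<tau> * (c1 - usub \<epsilon> \<theta>1) \<le> 0"
    "\<And>y. y \<in> Cp \<Longrightarrow> \<tau> * (\<phi> (\<theta>1, p0) - Psi \<epsilon> \<theta>1) \<le> \<tau> * (\<phi> y - Psi \<epsilon> (fst y))"
proof -
  define f where "f y = \<tau> * (\<phi> y - Psi \<epsilon> (fst y))" for y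
  have contp: "continuous_on Cp \<phi>" using cont_phi Cp_Omega by (rule continuous_on_subset)
  have cf: "continuous_on Cp f" unfolding f_def
    by (intro continuous_intros contp continuous_on_compose2[OF continuous_on_Psi[OF adm]]) (use fst_range(2) in blast)
  obtain x where x: "x \<in> Cp" "\<And>y. y \<in> Cp \<Longrightarrow> - f y \<le> - f x"
    by (rule periodic_attains_sup[OF closed_C(2), of \<theta>0 \<theta>1 "\<lambda>y. - f y"])
      (use cf on_shock fst_range(2) per_C per_phi in \<open>auto simp: f_def intro: continuous_intros\<close>)
  then have min: "f x \<le> f y" if "y \<in> Cp" for y using that by fastforce
  obtain t p where tp: "x = (t, p)" by fastforce
  define U where "U = usub \<epsilon> t"
  have t: "t \<in> {\<theta>0..\<theta>1}" "\<theta>s p \<le> t" "t \<le> \<theta>1" using fst_range(2)[OF x(1)] x(1) by (auto simp: tp Cl_plus_def)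
  have S: "0 < sin t" using sin_pos[OF t(1)] .
  have Ur: "0 < U" "U < cs" and Um: "mflux U * sin t = K + \<epsilon> * t" using usub[OF adm t(1)] by (auto simp: U_def)
  have U2: "U\<^sup>2 < cs\<^sup>2" using Ur by (auto intro: power_strict_mono)
  have tpos: "0 < t" using t(1) theta by auto
  have te: "0 < \<tau> * (\<epsilon> * t)" using tau(2) tpos by (simp add: mult.assoc[symmetric])
  have tau2: "\<tau> * (\<tau> * z) = z" for z using tau(1) by auto
  \<comment> \<open>The coordinate gradient of the difference of the potentials at the extremal
    point.\<close>
  define e where "e = (fst (Gp x) - U, snd (Gp x))"
  have vert_der: "((\<lambda>s. f (s, p)) has_real_derivative \<tau> * (fst (Gp (s, p)) - usub \<epsilon> s)) (at s)"
    if s: "\<theta>s p < s" "s < \<theta>1" for s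
  proof -
    have V: "(s, p) \<in> Up" using s by (simp add: Om_plus_def)
    have s': "s \<in> {\<theta>0..\<theta>1}" "\<theta>0 < s" using s range_s(1)[of p] by auto
    show ?thesis unfolding f_def fst_conv
      by (intro DERIV_cmult DERIV_diff DERIV_interior[OF DERIV_Psi[OF adm]])
        (use s s' DERIV_dth[OF C1D(2)[OF V]] in \<open>auto simp: Gp(2)[OF V] cgrad_def\<close>)
  qed
  have vert_cont: "continuous_on {\<theta>s p..\<theta>1} (\<lambda>s. \<tau> * (fst (Gp (s, p)) - usub \<epsilon> s))"
    "continuous_on {\<theta>s p..\<theta>1} (\<lambda>s. f (s, p))"
    using range_s[of p]
    by (intro continuous_on_mult_left continuous_on_diff continuous_on_fst continuous_on_compose2[OF Gp(1)]
        continuous_on_compose2[OF cf] continuous_on_subset[OF continuous_on_usub[OF adm]] continuous_on_Pair continuous_on_id continuous_on_const;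
        auto simp: Cl_plus_def)+
  consider (shock) "t = \<theta>s p" | (exit) "t = \<theta>1" | (inside) "\<theta>s p < t" "t < \<theta>1" using t by linarith
  then show ?thesis
  proof cases
    case shock
    note s = shock
    have e1: "0 \<le> \<tau> * fst e"
    proof (rule one_sided_derivative_nonneg[OF range_s(2)[of p] vert_cont(2) vert_der])
      have "((\<lambda>s. \<tau> * (fst (Gp (s, p)) - usub \<epsilon> s)) \<longlongrightarrow> \<tau> * (fst (Gp (\<theta>s p, p)) - usub \<epsilon> (\<theta>s p))) (at (\<theta>s p) within {\<theta>s p..\<theta>1})"
        using vert_cont(1) range_s[of p] by (auto simp: continuous_on_def)
      then show "((\<lambda>s. \<tau> * (fst (Gp (s, p)) - usub \<epsilon> s)) \<longlongrightarrow> \<tau> * fst e) (at_right (\<theta>s p))"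
        using range_s(2)[of p] by (simp add: at_within_Icc_at_right e_def U_def tp s)
      show "f (\<theta>s p, p) \<le> f (r, p)" if "\<theta>s p \<le> r" "r \<le> \<theta>1" for r
        using min[of "(r, p)"] that by (simp add: tp s Cl_plus_def)
    qed
    \<comment> \<open>On the shock the potential is also given by the upstream formula, so
      stationarity along the shock can be written with \<open>ub\<close>; with the continuity of the
      tangential derivative it says that \<open>e\<close> is normal to the shock.\<close>
    obtain C where C: "\<And>x. x \<in> Cm \<Longrightarrow> \<phi> x = Phim (fst x) + C" using phi_upstream by blast
    have f_s: "f (\<theta>s q, q) = \<tau> * (Phim (\<theta>s q) + C - Psi \<epsilon> (\<theta>s q))" for q
      using C[OF on_shock(1)] by (simp add: f_def)
    have "((\<lambda>q. \<tau> * (Phim (\<theta>s q) + C - Psi \<epsilon> (\<theta>s q))) has_real_derivative \<tau> * (ub t * ds p + 0 - U * ds p)) (at p)"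
      unfolding U_def s
      by (intro DERIV_cmult DERIV_diff DERIV_add DERIV_const DERIV_chain2[OF _ ds] DERIV_interior[OF DERIV_Phim] DERIV_interior[OF DERIV_Psi[OF adm]])
        (use range_s in \<open>auto intro: less_imp_le\<close>)
    then have "\<tau> * (ub t * ds p + 0 - U * ds p) = 0"
      by (rule DERIV_local_min[of _ _ _ 1]) (use min[OF on_shock(2)] in \<open>auto simp: f_s[symmetric] tp s\<close>)
    then have "\<tau> * (\<tau> * (ub t * ds p + 0 - U * ds p)) = 0" by simp
    then have ud: "ub t * ds p = U * ds p" unfolding tau2 by simp
    have e2: "fst e * ds p + snd e = 0"
    proof -
      have "ub t * ds p = fst (Gp x) * ds p + snd (Gp x)"
        using tangential_continuity[of p] upstream_radial[OF on_shock(1)[of p]] by (simp add: tp s)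
      then show ?thesis using ud by (simp add: e_def algebra_simps)
    qed
    define sl where "sl = ds p / sin t"
    define n where "n = sqrt (1 + sl\<^sup>2)"
    have n: "n > 0" "n\<^sup>2 = 1 + sl\<^sup>2" by (auto simp: n_def add_pos_nonneg)
    define b1 where "b1 = fst (Gp x)"
    define b2 where "b2 = snd (Gp x) / sin t"
    have b: "b1 = U + fst e" "b2 = - fst e * sl"
    proof -
      show "b1 = U + fst e" by (simp add: b1_def e_def)
      have "snd (Gp x) = - fst e * ds p" using e2 unfolding e_def snd_conv by linarith
      then show "b2 = - fst e * sl" by (simp add: b2_def sl_def)
    qed
    \<comment> \<open>The comparison velocity \<open>(U, 0)\<close> and the actual one differ by a
      normal vector, so they share the tangential component \<open>tg\<close>; \<open>xa\<close> and
      \<open>xb\<close> are their normal components.\<close>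
    define xa where "xa = U / n"
    define xb where "xb = (U + fst e * n\<^sup>2) / n"
    define tg where "tg = U * sl / n"
    have qa: "xa\<^sup>2 + tg\<^sup>2 = U\<^sup>2"
    proof -
      have "xa\<^sup>2 + tg\<^sup>2 = U\<^sup>2 * (1 + sl\<^sup>2) / n\<^sup>2" by (simp add: xa_def tg_def power_divide power_mult_distrib add_divide_distrib distrib_left)
      then show ?thesis unfolding n(2)[symmetric] using n(1) by simp
    qed
    have qb: "xb\<^sup>2 + tg\<^sup>2 = gsq t (Gp x)"
    proof -
      have "xb\<^sup>2 + tg\<^sup>2 = ((U + fst e * n\<^sup>2)\<^sup>2 + (U * sl)\<^sup>2) / n\<^sup>2"
        unfolding xb_def tg_def power_divide by (rule add_divide_distrib[symmetric])
      also have "(U + fst e * n\<^sup>2)\<^sup>2 + (U * sl)\<^sup>2 = (b1\<^sup>2 + b2\<^sup>2) * n\<^sup>2" unfolding n b by algebra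
      finally show ?thesis using n(1) by (simp add: gsq_def b1_def b2_def)
    qed
    have le_crit: "z\<^sup>2 \<le> cc (z\<^sup>2 + tg\<^sup>2)" if "z\<^sup>2 + tg\<^sup>2 \<le> cs\<^sup>2" for z
      using that le_cc_iff[of "z\<^sup>2 + tg\<^sup>2"] zero_le_power2[of tg] by linarith
    have ca: "xa\<^sup>2 \<le> cc (xa\<^sup>2 + tg\<^sup>2)" using U2 qa by (intro le_crit) simp
    have cb: "xb\<^sup>2 \<le> cc (xb\<^sup>2 + tg\<^sup>2)" using Gp_gsq_le[OF x(1)] qb by (intro le_crit) (simp add: tp)
    have fa: "rr (xa\<^sup>2 + tg\<^sup>2) * xa * n * sin t = K + \<epsilon> * t"
      using Um n(1) unfolding qa by (simp add: xa_def mflux_def)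
    have fb: "rr (xb\<^sup>2 + tg\<^sup>2) * xb * n * sin t = K"
    proof -
      have "xb * n = U + fst e * n\<^sup>2" using n(1) by (simp add: xb_def)
      then have "xb * n = b1 - b2 * sl" unfolding b n(2) by algebra
      moreover have "rr (gsq t (Gp x)) * (b1 - b2 * sl) = K / sin t"
        using shock_flux[of p] unfolding b1_def b2_def sl_def by (simp add: tp s)
      ultimately have "rr (gsq t (Gp x)) * (xb * n) = K / sin t" by simp
      then show ?thesis unfolding qb using S by (simp add: field_simps)
    qed
    have "\<tau> * (xb - xa) = \<tau> * fst e * n" using n(1) by (simp add: xa_def xb_def field_simps power2_eq_square)
    then have dir: "0 \<le> \<tau> * (xb - xa)" using e1 n(1) by (metis less_imp_le mult_nonneg_nonneg)
    \<comment> \<open>Monotonicity of the normal flux yields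
      \<open>\<tau> * K \<ge> \<tau> * (K + \<epsilon> * t)\<close>, against the sign of
      \<open>\<epsilon>\<close>.\<close>
    have "0 \<le> \<tau> * (rr (xb\<^sup>2 + tg\<^sup>2) * xb - rr (xa\<^sup>2 + tg\<^sup>2) * xa)"
      using tau(1) dir normal_flux_strict_mono[OF _ ca cb] normal_flux_strict_mono[OF _ cb ca]
      by (cases xa xb rule: linorder_cases) auto
    then have "0 \<le> \<tau> * (rr (xb\<^sup>2 + tg\<^sup>2) * xb - rr (xa\<^sup>2 + tg\<^sup>2) * xa) * (n * sin t)"
      using n(1) S by simp
    also have "\<dots> = \<tau> * (rr (xb\<^sup>2 + tg\<^sup>2) * xb * n * sin t - rr (xa\<^sup>2 + tg\<^sup>2) * xa * n * sin t)"
      by (simp add: algebra_simps)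
    also have "\<dots> = - (\<tau> * (\<epsilon> * t))" unfolding fa fb by simp
    finally show ?thesis using te by simp
  next
    case inside
    have V: "x \<in> Up" using inside by (simp add: tp Om_plus_def)
    obtain r where r: "r > 0" "ball x r \<subseteq> Up" using open_U(2) V openE by blast
    have inV: "(s, q) \<in> Up" if "\<bar>t - s\<bar> < r" "q = p" for s q
      using r(2) that by (auto simp: subset_iff tp dist_Pair_Pair dist_real_def)
    have inV': "(s, q) \<in> Up" if "\<bar>p - q\<bar> < r" "s = t" for s q
      using r(2) that by (auto simp: subset_iff tp dist_Pair_Pair dist_real_def)
    define a where "a = dth (dth \<phi>) (t, p)"
    define d where "d = dph (dph \<phi>) (t, p)"
    obtain D where D: "(usub \<epsilon> has_real_derivative D) (at t)"
      "(cc (U\<^sup>2) - U\<^sup>2) * D = cc (U\<^sup>2) * (\<epsilon> / (rr (U\<^sup>2) * sin t) - cot t * U)"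
      using usub(3)[OF adm t(1)] by (auto simp: U_def)
    have th: "\<tau> * (dth \<phi> (t, p) - usub \<epsilon> t) = 0" "0 \<le> \<tau> * (a - D)"
    proof -
      have "((\<lambda>s. f (s, p)) has_real_derivative \<tau> * (dth \<phi> (s, p) - usub \<epsilon> s)) (at s)" if "\<bar>t - s\<bar> < r" for s
        using vert_der[of s] inV[OF that] Gp(2)[of "(s, p)"] by (simp add: Om_plus_def cgrad_def)
      note der = this
      have der2: "((\<lambda>s. \<tau> * (dth \<phi> (s, p) - usub \<epsilon> s)) has_real_derivative \<tau> * (a - D)) (at t)"
        unfolding a_def by (intro DERIV_cmult DERIV_diff D DERIV_dth C1D) (use V tp in simp)
      have mn: "f (t, p) \<le> f (s, p)" if "\<bar>t - s\<bar> < r" for s using min[of "(s, p)"] inV[OF that] U_C by (auto simp: tp)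
      show "\<tau> * (dth \<phi> (t, p) - usub \<epsilon> t) = 0" "0 \<le> \<tau> * (a - D)"
        using second_derivative_nonneg_at_min[OF r(1) der der2 mn] by simp_all
    qed
    have ph: "\<tau> * dph \<phi> (t, p) = 0" "0 \<le> \<tau> * d"
    proof -
      have "((\<lambda>q. f (t, q)) has_real_derivative \<tau> * dph \<phi> (t, q)) (at q)" if "\<bar>p - q\<bar> < r" for q
      proof -
        have "((\<lambda>q. f (t, q)) has_real_derivative \<tau> * (dph \<phi> (t, q) - 0)) (at q)"
          unfolding f_def fst_conv
          by (intro DERIV_cmult DERIV_diff DERIV_const DERIV_dph C1D(2) inV' that refl)
        then show ?thesis by simp
      qed
      note der = this
      have der2: "((\<lambda>q. \<tau> * dph \<phi> (t, q)) has_real_derivative \<tau> * d) (at p)"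
        unfolding d_def by (intro DERIV_cmult DERIV_dph C1D) (use V tp in simp)
      have mn: "f (t, p) \<le> f (t, q)" if "\<bar>p - q\<bar> < r" for q using min[of "(t, q)"] inV'[OF that] U_C by (auto simp: tp)
      show "\<tau> * dph \<phi> (t, p) = 0" "0 \<le> \<tau> * d"
        using second_derivative_nonneg_at_min[OF r(1) der der2 mn] by simp_all
    qed
    \<comment> \<open>The gradients agree at the extremal point, so both flows satisfy second-order
      equations with the same coefficients, elliptic because \<open>U < cs\<close>.\<close>
    have u: "dth \<phi> (t, p) = U" "dph \<phi> (t, p) = 0" using th(1) ph(1) tau(1) by (auto simp: U_def)
    have cpos: "0 < cc (U\<^sup>2)" "0 < cc (U\<^sup>2) - U\<^sup>2" "0 < rr (U\<^sup>2)"
    proof -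
      show 2: "0 < cc (U\<^sup>2) - U\<^sup>2" using less_cc_iff[of "U\<^sup>2"] U2 by simp
      then show "0 < cc (U\<^sup>2)" using zero_le_power2[of U] by linarith
      then show "0 < rr (U\<^sup>2)" using rr_pos cc_pos_iff by blast
    qed
    have "gsq t (cgrad \<phi> (t, p)) < qm\<^sup>2" using Gp_gsq_less[OF x(1)] Gp(2)[OF V] by (simp add: tp)
    from flow_eq_nondivergence[OF open_U(2) C2p V[unfolded tp] _ this] eqp[OF V] S
    have "cc (U\<^sup>2) * (cot t * U + a + d / (sin t)\<^sup>2) = U\<^sup>2 * a"
      by (simp add: u a_def d_def tp)
    \<comment> \<open>Subtracting the equations: after multiplication by \<open>\<tau>\<close> the
      left side is nonnegative by the second derivative test and the right side negative.\<close>
    then have "(cc (U\<^sup>2) - U\<^sup>2) * (a - D) + cc (U\<^sup>2) * (d / (sin t)\<^sup>2) = - (cc (U\<^sup>2) * (\<epsilon> / (rr (U\<^sup>2) * sin t)))"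
      using D(2) by (simp add: algebra_simps)
    then have "\<tau> * ((cc (U\<^sup>2) - U\<^sup>2) * (a - D) + cc (U\<^sup>2) * (d / (sin t)\<^sup>2)) = - (cc (U\<^sup>2) * (\<tau> * \<epsilon> / (rr (U\<^sup>2) * sin t)))"
      by simp
    moreover have "0 < cc (U\<^sup>2) * (\<tau> * \<epsilon> / (rr (U\<^sup>2) * sin t))" using cpos tau(2) S by simp
    moreover have "0 \<le> (cc (U\<^sup>2) - U\<^sup>2) * (\<tau> * (a - D)) + cc (U\<^sup>2) * (\<tau> * d / (sin t)\<^sup>2)"
      using th(2) ph(2)
      by (intro add_nonneg_nonneg mult_nonneg_nonneg[OF less_imp_le[OF cpos(2)]]
          mult_nonneg_nonneg[OF less_imp_le[OF cpos(1)]] divide_nonneg_nonneg zero_le_power2)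
    ultimately show ?thesis by (simp add: algebra_simps)
  next
    case exit
    \<comment> \<open>Stationarity along the outlet removes the longitudinal component; the
      prescribed speed and the sign condition then leave the velocity \<open>(c1, 0)\<close> at this
      point.\<close>
    have "((\<lambda>q. f (\<theta>1, q)) has_real_derivative \<tau> * (snd (Gp (\<theta>1, p)) - 0)) (at p)"
      unfolding f_def fst_conv by (intro DERIV_cmult DERIV_diff outlet_gradient DERIV_const)
    then have "\<tau> * (snd (Gp (\<theta>1, p)) - 0) = 0"
      by (rule DERIV_local_min[of _ _ _ 1]) (use min range_s(2)[THEN less_imp_le] in \<open>auto simp: Cl_plus_def tp exit\<close>)
    then have v: "snd (Gp (\<theta>1, p)) = 0" using tau(1) by auto
    then have "(fst (Gp (\<theta>1, p)))\<^sup>2 = c1\<^sup>2" using outlet(1)[of p] by (simp add: gsq_def)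
    then have u: "fst (Gp (\<theta>1, p)) = c1" using outlet(2)[of p] outlet(3) by (simp add: power2_eq_iff_nonneg)
    \<comment> \<open>Reflection in \<theta>, because the one-sided test is stated for a left
      endpoint.\<close>
    have "0 \<le> - (\<tau> * (c1 - usub \<epsilon> \<theta>1))"
    proof (rule one_sided_derivative_nonneg[of "- \<theta>1" "- \<theta>s p" "\<lambda>s. f (- s, p)"
          "\<lambda>s. - (\<tau> * (fst (Gp (- s, p)) - usub \<epsilon> (- s)))"])
      have img: "uminus ` {- \<theta>1..- \<theta>s p} \<subseteq> {\<theta>s p..\<theta>1}" by auto
      show "continuous_on {- \<theta>1..- \<theta>s p} (\<lambda>s. f (- s, p))"
        by (rule continuous_on_compose2[OF vert_cont(2) _ img]) (intro continuous_intros)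
      have "continuous_on {- \<theta>1..- \<theta>s p} (\<lambda>s. - (\<tau> * (fst (Gp (- s, p)) - usub \<epsilon> (- s))))"
        by (intro continuous_on_minus continuous_on_compose2[OF vert_cont(1) _ img] continuous_on_id)
      from bspec[OF this[unfolded continuous_on_def], of "- \<theta>1"]
      show "((\<lambda>s. - (\<tau> * (fst (Gp (- s, p)) - usub \<epsilon> (- s)))) \<longlongrightarrow> - (\<tau> * (c1 - usub \<epsilon> \<theta>1))) (at_right (- \<theta>1))"
        using range_s(2)[of p] by (simp add: at_within_Icc_at_right u)
      show "f (- (- \<theta>1), p) \<le> f (- s, p)" if "- \<theta>1 \<le> s" "s \<le> - \<theta>s p" for s
        using min[of "(- s, p)"] that by (simp add: tp exit Cl_plus_def)
      fix s assume "- \<theta>1 < s" "s < - \<theta>s p"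
      then show "((\<lambda>s. f (- s, p)) has_real_derivative - (\<tau> * (fst (Gp (- s, p)) - usub \<epsilon> (- s)))) (at s)"
        using DERIV_chain2[OF vert_der DERIV_minus[OF DERIV_ident], of s] by simp
    qed (use range_s(2)[of p] in simp)
    then show ?thesis using that[of p] min by (simp add: f_def tp exit)
  qed
qed

end

context nozzle begin

definition phib :: "real \<Rightarrow> real \<Rightarrow> real" where
  "phib \<theta>b t = (if t \<le> \<theta>b then Phim t else Psi 0 t + (Phim \<theta>b - Psi 0 \<theta>b))"

lemma usub0:
  assumes t: "t \<in> {\<theta>0..\<theta>1}"
  shows "usub 0 t \<in> {0<..<cs}" "mflux (usub 0 t) * sin t = K"
    "(usub 0 has_real_derivative cot t * cc ((usub 0 t)\<^sup>2) * usub 0 t / ((usub 0 t)\<^sup>2 - cc ((usub 0 t)\<^sup>2))) (at t)"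
proof -
  show r: "usub 0 t \<in> {0<..<cs}" "mflux (usub 0 t) * sin t = K"
    using usub(1,2)[OF admissible_0 t] by auto
  obtain D where D: "(usub 0 has_real_derivative D) (at t)"
    "(cc ((usub 0 t)\<^sup>2) - (usub 0 t)\<^sup>2) * D = cc ((usub 0 t)\<^sup>2) * (0 - cot t * usub 0 t)"
    using usub(3)[OF admissible_0 t] by auto
  have "(usub 0 t)\<^sup>2 < cs\<^sup>2" using r by (auto intro: power_strict_mono)
  then have "(usub 0 t)\<^sup>2 < cc ((usub 0 t)\<^sup>2)" using less_cc_iff by blast
  then have "D = cot t * cc ((usub 0 t)\<^sup>2) * usub 0 t / ((usub 0 t)\<^sup>2 - cc ((usub 0 t)\<^sup>2))"
    using D(2) by (simp add: field_simps)
  then show "(usub 0 has_real_derivative cot t * cc ((usub 0 t)\<^sup>2) * usub 0 t / ((usub 0 t)\<^sup>2 - cc ((usub 0 t)\<^sup>2))) (at t)"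
    using D(1) by simp
qed

end

section \<open>Exit speed, exit direction and identification of the downstream flow\<close>

context transonic begin

text \<open>Comparison with \<open>\<epsilon>\<close> and \<open>- \<epsilon>\<close> encloses the
  exit flux between \<open>K - \<epsilon> * \<theta>1\<close> and
  \<open>K + \<epsilon> * \<theta>1\<close>, since the flux increases with subsonic speed.\<close>

lemma outlet_speed: "mflux c1 * sin \<theta>1 = K"
proof -
  obtain e where e: "e > 0" "\<And>\<epsilon>. \<bar>\<epsilon>\<bar> \<le> e \<Longrightarrow> admissible \<epsilon>" using admissible_small by blast
  have t1: "\<theta>1 \<in> {\<theta>0..\<theta>1}" "0 < \<theta>1" using theta by auto
  note S = sin_pos[OF t1(1)]
  have small: "\<exists>\<epsilon>>0. \<epsilon> \<le> e \<and> \<epsilon> * \<theta>1 \<le> d" if "d > 0" for d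
    using that e t1(2) by (intro exI[of _ "min e (d / \<theta>1)"]) (auto simp: min_def field_simps)
  have "mflux c1 * sin \<theta>1 \<le> K"
  proof (rule field_le_epsilon)
    fix d :: real assume "d > 0"
    then obtain \<epsilon> where ep: "0 < \<epsilon>" "\<epsilon> \<le> e" "\<epsilon> * \<theta>1 \<le> d" using small by blast
    then have adm: "admissible \<epsilon>" using e(2) by simp
    have "c1 \<le> usub \<epsilon> \<theta>1" by (rule comparison[OF adm, of 1]) (use ep in auto)
    then have "mflux c1 \<le> mflux (usub \<epsilon> \<theta>1)"
      using mflux_le_iff[of c1 "usub \<epsilon> \<theta>1"] outlet(3,4) usub(1)[OF adm t1(1)] by auto
    then have "mflux c1 * sin \<theta>1 \<le> mflux (usub \<epsilon> \<theta>1) * sin \<theta>1" using S by (intro mult_right_mono) auto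
    then show "mflux c1 * sin \<theta>1 \<le> K + d" using usub(2)[OF adm t1(1)] ep by simp
  qed
  moreover have "K \<le> mflux c1 * sin \<theta>1"
  proof (rule field_le_epsilon)
    fix d :: real assume "d > 0"
    then obtain \<epsilon> where ep: "0 < \<epsilon>" "\<epsilon> \<le> e" "\<epsilon> * \<theta>1 \<le> d" using small by blast
    then have adm: "admissible (- \<epsilon>)" using e(2) by simp
    have "usub (- \<epsilon>) \<theta>1 \<le> c1" by (rule comparison[OF adm, of "-1"]) (use ep in auto)
    then have "mflux (usub (- \<epsilon>) \<theta>1) \<le> mflux c1"
      using mflux_le_iff[of "usub (- \<epsilon>) \<theta>1" c1] outlet(3,4) usub(1)[OF adm t1(1)] by auto
    then have "mflux (usub (- \<epsilon>) \<theta>1) * sin \<theta>1 \<le> mflux c1 * sin \<theta>1" using S by (intro mult_right_mono) auto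
    then show "K \<le> mflux c1 * sin \<theta>1 + d" using usub(2)[OF adm t1(1)] ep by simp
  qed
  ultimately show ?thesis by simp
qed

lemma outlet_C: "(\<theta>1, p) \<in> Cp"
  using range_s(2)[THEN less_imp_le] by (simp add: Cl_plus_def)

text \<open>At speed \<open>c1\<close> the flux per unit longitude is at most that of the axial
  velocity \<open>(c1, 0)\<close>, which is \<open>K\<close>. Mass balance makes its mean equal to
  \<open>K\<close>, so equality holds at every point.\<close>

lemma outlet_axial: "snd (Gp (\<theta>1, p)) = 0"
proof -
  have t1: "\<theta>1 \<in> {\<theta>0..\<theta>1}" using theta by auto
  note S = sin_pos[OF t1(1)]
  define g where "g p = K - Mth (\<theta>1, p)" for p
  have M: "Mth (\<theta>1, p) = sin \<theta>1 * rr (c1\<^sup>2) * fst (Gp (\<theta>1, p))" for p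
    by (simp add: Mth_def outlet(1))
  have rpos: "0 < rr (c1\<^sup>2)"
    using outlet(3,4) cs_less_qm by (intro rr_pos power_strict_mono) auto
  have Kc: "K = sin \<theta>1 * rr (c1\<^sup>2) * c1" using outlet_speed by (simp add: mflux_def algebra_simps)
  have ule: "fst (Gp (\<theta>1, p)) \<le> c1" for p
  proof -
    have "(fst (Gp (\<theta>1, p)))\<^sup>2 \<le> c1\<^sup>2" unfolding outlet(1)[of p, symmetric] by (simp add: gsq_def)
    then show ?thesis using outlet(3) by (auto intro: power2_le_imp_le)
  qed
  have g_nn: "0 \<le> g p" for p
    unfolding g_def M Kc using ule[of p] S rpos by (simp add: mult_left_mono)
  have cM: "continuous_on A (\<lambda>p. Mth (\<theta>1, p))" for A
    by (rule continuous_on_compose2[OF continuous_on_M(1)]) (auto intro!: continuous_intros outlet_C)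
  have cg: "continuous_on A g" for A unfolding g_def by (intro continuous_intros cM)
  \<comment> \<open>By the shock condition each longitude carries exactly \<open>K\<close> through
    the shock.\<close>
  have "Mth (\<theta>s p, p) - Mph (\<theta>s p, p) * ds p = K" for p
  proof -
    have Sp: "0 < sin (\<theta>s p)" using sin_nz(2)[OF on_shock(2)[of p]] by simp
    have "Mth (\<theta>s p, p) - Mph (\<theta>s p, p) * ds p = sin (\<theta>s p) * (rr (gsq (\<theta>s p) (Gp (\<theta>s p, p))) *
     (fst (Gp (\<theta>s p, p)) - snd (Gp (\<theta>s p, p)) / sin (\<theta>s p) * (ds p / sin (\<theta>s p))))"
      using Sp by (simp add: Mth_def Mph_def field_simps)
    then show ?thesis unfolding shock_flux using Sp by simp
  qed
  then have "integral {0..2 * pi} (\<lambda>p. Mth (\<theta>1, p)) = integral {0..2 * pi} (\<lambda>p. K)"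
    using outlet_flux by simp
  then have "integral {0..2 * pi} g = 0"
    unfolding g_def by (subst integral_diff) (auto intro!: integrable_continuous_real cM)
  then have g0: "g q = 0" if "q \<in> {0..2 * pi}" for q
    using integral_eq_0_iff[OF cg, of 0 "2 * pi"] g_nn that by auto
  have per: "g (p + 2 * pi * of_int k) = g p" for k
    by (rule periodic_add_int) (simp add: g_def Mth_def per_Gp[OF outlet_C])
  define k where "k = \<lfloor>p / (2 * pi)\<rfloor>"
  have k: "of_int k \<le> p / (2 * pi)" "p / (2 * pi) < of_int k + 1" unfolding k_def by linarith+
  have "p + 2 * pi * of_int (- k) \<in> {0..2 * pi}" using k by (simp add: field_simps)
  then have "g p = 0" using g0 per[of "- k"] by metis
  then have "fst (Gp (\<theta>1, p)) = c1" unfolding g_def M Kc using S rpos by simp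
  then show ?thesis using outlet(1)[of p] S by (simp add: gsq_def)
qed

text \<open>Once the potential is constant on the outlet, the unknown point \<open>p0\<close> from
  \<open>comparison\<close> drops out of its inequality; positive and negative
  \<open>\<epsilon>\<close> then squeeze the potential between the same limits.\<close>

lemma phi_downstream: obtains k where "\<And>y. y \<in> Cp \<Longrightarrow> \<phi> y = k + Psi 0 (fst y)"
proof -
  obtain e where e: "e > 0" "\<And>\<epsilon>. \<bar>\<epsilon>\<bar> \<le> e \<Longrightarrow> admissible \<epsilon>" using admissible_small by blast
  define k where "k = \<phi> (\<theta>1, 0)"
  have const: "\<phi> (\<theta>1, p) = k" for p
    unfolding k_def using DERIV_isconst_all[of "\<lambda>p. \<phi> (\<theta>1, p)"] outlet_gradient by (simp add: outlet_axial)
  have "\<phi> y = (k - Psi 0 \<theta>1) + Psi 0 (fst y)" if y: "y \<in> Cp" for y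
  proof -
    note lim = Psi_diff_tendsto[OF fst_range(2)[OF y]]
    have "k - \<phi> y \<le> Psi 0 \<theta>1 - Psi 0 (fst y)"
    proof (rule tendsto_lowerbound)
      show "((\<lambda>\<epsilon>. Psi \<epsilon> \<theta>1 - Psi \<epsilon> (fst y)) \<longlongrightarrow> Psi 0 \<theta>1 - Psi 0 (fst y)) (at_right 0)"
        using lim by (simp add: filterlim_at_split)
      have "k - \<phi> y \<le> Psi \<epsilon> \<theta>1 - Psi \<epsilon> (fst y)" if "0 < \<epsilon>" "\<epsilon> < e" for \<epsilon>
      proof (rule comparison[of \<epsilon> 1])
        show "admissible \<epsilon>" using e(2) that by simp
        fix p0 assume "\<And>z. z \<in> Cp \<Longrightarrow> 1 * (\<phi> (\<theta>1, p0) - Psi \<epsilon> \<theta>1) \<le> 1 * (\<phi> z - Psi \<epsilon> (fst z))"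
        from this[OF y] show ?thesis unfolding const by simp
      qed (use that in auto)
      then show "\<forall>\<^sub>F \<epsilon> in at_right 0. k - \<phi> y \<le> Psi \<epsilon> \<theta>1 - Psi \<epsilon> (fst y)"
        using e(1) unfolding eventually_at_right_field by blast
    qed simp
    moreover have "Psi 0 \<theta>1 - Psi 0 (fst y) \<le> k - \<phi> y"
    proof (rule tendsto_upperbound)
      show "((\<lambda>\<epsilon>. Psi \<epsilon> \<theta>1 - Psi \<epsilon> (fst y)) \<longlongrightarrow> Psi 0 \<theta>1 - Psi 0 (fst y)) (at_left 0)"
        using lim by (simp add: filterlim_at_split)
      have "Psi \<epsilon> \<theta>1 - Psi \<epsilon> (fst y) \<le> k - \<phi> y" if "- e < \<epsilon>" "\<epsilon> < 0" for \<epsilon>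
      proof (rule comparison[of \<epsilon> "-1"])
        show "admissible \<epsilon>" using e(2) that by simp
        fix p0 assume "\<And>z. z \<in> Cp \<Longrightarrow> -1 * (\<phi> (\<theta>1, p0) - Psi \<epsilon> \<theta>1) \<le> -1 * (\<phi> z - Psi \<epsilon> (fst z))"
        from this[OF y] show ?thesis unfolding const by simp
      qed (use that in auto)
      then show "\<forall>\<^sub>F \<epsilon> in at_left 0. Psi \<epsilon> \<theta>1 - Psi \<epsilon> (fst y) \<le> k - \<phi> y"
        using e(1) unfolding eventually_at_left_field by (intro exI[of _ "- e"]) auto
    qed simp
    ultimately show ?thesis by simp
  qed
  then show ?thesis using that by blast
qed

lemma radial: "\<theta>s p = \<theta>s 0" "\<exists>C. \<forall>x\<in>Omega \<theta>0 \<theta>1. \<phi> x = phib (\<theta>s 0) (fst x) + C"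
proof -
  obtain C where C: "\<And>x. x \<in> Cm \<Longrightarrow> \<phi> x = Phim (fst x) + C" using phi_upstream by blast
  obtain k where k: "\<And>x. x \<in> Cp \<Longrightarrow> \<phi> x = k + Psi 0 (fst x)" using phi_downstream by blast
  have W: "Phim (\<theta>s q) - Psi 0 (\<theta>s q) = k - C" for q
    using C[OF on_shock(1)[of q]] k[OF on_shock(2)[of q]] by simp
  have inc: "Phim s - Psi 0 s < Phim t - Psi 0 t" if st: "\<theta>0 \<le> s" "s < t" "t \<le> \<theta>1" for s t
  proof (rule DERIV_pos_imp_increasing_open[OF st(2)])
    fix r assume "s < r" "r < t"
    then have r: "\<theta>0 < r" "r < \<theta>1" "r \<in> {\<theta>0..\<theta>1}" using st by auto
    have "((\<lambda>t. Phim t - Psi 0 t) has_real_derivative ub r - usub 0 r) (at r)"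
      using r by (intro DERIV_diff DERIV_interior[OF DERIV_Phim] DERIV_interior[OF DERIV_Psi[OF admissible_0]]) auto
    moreover have "0 < ub r - usub 0 r" using ub(1)[OF r(3)] usub0(1)[OF r(3)] by auto
    ultimately show "\<exists>y. ((\<lambda>t. Phim t - Psi 0 t) has_real_derivative y) (at r) \<and> 0 < y" by blast
  next
    show "continuous_on {s..t} (\<lambda>t. Phim t - Psi 0 t)"
      using st by (intro continuous_intros continuous_on_subset[OF continuous_on_Phim]
          continuous_on_subset[OF continuous_on_Psi[OF admissible_0]]) auto
  qed
  show const: "\<theta>s p = \<theta>s 0" for p
    using inc[of "\<theta>s p" "\<theta>s 0"] inc[of "\<theta>s 0" "\<theta>s p"] W[of p] W[of 0] range_s[THEN less_imp_le]
    by (cases "\<theta>s p" "\<theta>s 0" rule: linorder_cases) auto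
  show "\<exists>C. \<forall>x\<in>Omega \<theta>0 \<theta>1. \<phi> x = phib (\<theta>s 0) (fst x) + C"
  proof (intro exI[of _ C] ballI)
    fix x assume x: "x \<in> Omega \<theta>0 \<theta>1"
    show "\<phi> x = phib (\<theta>s 0) (fst x) + C"
    proof (cases "fst x \<le> \<theta>s 0")
      case True
      then have "x \<in> Cm" using x const[of "snd x"] by (simp add: Omega_def Cl_minus_def)
      then show ?thesis using C True by (simp add: phib_def)
    next
      case False
      then have "x \<in> Cp" using x const[of "snd x"] by (simp add: Omega_def Cl_plus_def)
      then show ?thesis using k W[of 0] False by (simp add: phib_def)
    qed
  qed
qed

end

section \<open>Radial transonic shocks\<close>

lemma dth_radial: "dth (\<lambda>x. f (fst x)) = (\<lambda>x. deriv f (fst x))"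
  by (auto simp: dth_def)

lemma dph_radial: "dph (\<lambda>x. f (fst x)) = (\<lambda>x. 0)"
  by (auto simp: dph_def)

lemma differentiable_radial:
  "(f has_real_derivative D) (at (fst x)) \<Longrightarrow> (\<lambda>x. f (fst x)) differentiable (at x)"
  by (rule differentiable_compose[OF _ bounded_linear_imp_differentiable[OF bounded_linear_fst]])
    (auto simp: real_differentiable_def)

context nozzle begin

definition branch :: "real \<Rightarrow> real \<Rightarrow> real" where
  "branch \<theta>b t = (if t \<le> \<theta>b then ub t else usub 0 t)"

definition ode_rhs :: "real \<Rightarrow> real \<Rightarrow> real" where
  "ode_rhs t q = cot t * cc (q\<^sup>2) * q / (q\<^sup>2 - cc (q\<^sup>2))"

context
  fixes \<theta>b :: real
  assumes \<theta>b: "\<theta>0 < \<theta>b" "\<theta>b < \<theta>1"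
begin

lemma DERIV_phib:
  assumes t: "t \<in> {\<theta>0..\<theta>1}" "t \<noteq> \<theta>b"
  shows "(phib \<theta>b has_real_derivative branch \<theta>b t) (at t within {\<theta>0..\<theta>1})"
proof (cases "t < \<theta>b")
  case True
  show ?thesis
    by (rule has_field_derivative_transform_within[of Phim _ _ _ "\<theta>b - t"])
      (use True t DERIV_Phim[OF t(1)] in \<open>auto simp: phib_def branch_def dist_real_def\<close>)
next
  case False
  have "((\<lambda>t. Psi 0 t + (Phim \<theta>b - Psi 0 \<theta>b)) has_real_derivative usub 0 t + 0) (at t within {\<theta>0..\<theta>1})"
    by (intro DERIV_add DERIV_const DERIV_Psi admissible_0 t)
  then show ?thesis
    by (rule has_field_derivative_transform_within[of _ _ _ _ "t - \<theta>b", THEN DERIV_cong])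
      (use False t in \<open>auto simp: phib_def branch_def dist_real_def\<close>)
qed

lemma DERIV_branch:
  assumes t: "t \<in> {\<theta>0..\<theta>1}" "t \<noteq> \<theta>b"
  shows "(branch \<theta>b has_real_derivative ode_rhs t (branch \<theta>b t)) (at t)"
proof (cases "t < \<theta>b")
  case True
  show ?thesis
    by (rule has_field_derivative_transform_within[of ub _ _ _ "\<theta>b - t"])
      (use True t ub(3)[OF t(1)] in \<open>auto simp: branch_def ode_rhs_def dist_real_def\<close>)
next
  case False
  show ?thesis
    by (rule has_field_derivative_transform_within[of "usub 0" _ _ _ "t - \<theta>b"])
      (use False t usub0(3)[OF t(1)] in \<open>auto simp: branch_def ode_rhs_def dist_real_def\<close>)
qed

lemma branch_cases:
  assumes t: "t \<in> {\<theta>0..\<theta>1}"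
  shows "t \<le> \<theta>b \<Longrightarrow> branch \<theta>b t \<in> {cs<..<qm}" "\<theta>b < t \<Longrightarrow> branch \<theta>b t \<in> {0<..<cs}"
    "mflux (branch \<theta>b t) * sin t = K" "branch \<theta>b t \<in> {0<..<qm}" "(branch \<theta>b t)\<^sup>2 \<noteq> cc ((branch \<theta>b t)\<^sup>2)"
proof -
  show *: "t \<le> \<theta>b \<Longrightarrow> branch \<theta>b t \<in> {cs<..<qm}" "\<theta>b < t \<Longrightarrow> branch \<theta>b t \<in> {0<..<cs}"
    "mflux (branch \<theta>b t) * sin t = K"
    using ub(1,2)[OF t] usub0(1,2)[OF t] by (auto simp: branch_def)
  show "branch \<theta>b t \<in> {0<..<qm}"
    using *(1,2) cs_pos cs_less_qm by (cases "t \<le> \<theta>b") auto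
  show "(branch \<theta>b t)\<^sup>2 \<noteq> cc ((branch \<theta>b t)\<^sup>2)"
  proof (cases "t \<le> \<theta>b")
    case True then show ?thesis using supersonic(5)[OF *(1)] by simp
  next
    case False
    then have "(branch \<theta>b t)\<^sup>2 < cs\<^sup>2" using *(2) by (auto intro: power_strict_mono)
    then show ?thesis using less_cc_iff[of "(branch \<theta>b t)\<^sup>2"] by simp
  qed
qed

lemma continuous_on_phib: "continuous_on {\<theta>0..\<theta>1} (phib \<theta>b)"
proof -
  have "{\<theta>0..\<theta>1} = {\<theta>0..\<theta>b} \<union> {\<theta>b..\<theta>1}" using \<theta>b by auto
  moreover have "continuous_on ({\<theta>0..\<theta>b} \<union> {\<theta>b..\<theta>1}) (\<lambda>t. if t \<le> \<theta>b then Phim t else Psi 0 t + (Phim \<theta>b - Psi 0 \<theta>b))"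
    using \<theta>b
    by (intro continuous_on_If continuous_intros continuous_on_subset[OF continuous_on_Phim]
        continuous_on_subset[OF continuous_on_Psi[OF admissible_0]]) auto
  ultimately show ?thesis by (simp add: phib_def[abs_def])
qed

lemma mflux_branches: "t \<in> {\<theta>0..\<theta>1} \<Longrightarrow> mflux (usub 0 t) = mflux (ub t)"
proof -
  assume t: "t \<in> {\<theta>0..\<theta>1}"
  have "mflux (usub 0 t) * sin t = mflux (ub t) * sin t" using usub0(2)[OF t] ub(2)[OF t] by simp
  then show ?thesis using sin_pos[OF t] by simp
qed

lemma radial_shock_sol_phib: "radial_shock_sol \<gamma> c0 \<theta>0 \<theta>1 u0 \<theta>b (phib \<theta>b)"
  unfolding radial_shock_sol_def
proof (intro conjI \<theta>b continuous_on_phib, rule exI[of _ "branch \<theta>b"], rule exI[of _ "ub \<theta>b"],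
    rule exI[of _ "usub 0 \<theta>b"], intro conjI ballI)
  fix t assume "t \<in> {\<theta>0..<\<theta>b} \<union> {\<theta>b<..\<theta>1}"
  then have t: "t \<in> {\<theta>0..\<theta>1}" "t \<noteq> \<theta>b" using \<theta>b by auto
  show "(phib \<theta>b has_real_derivative branch \<theta>b t) (at t within {\<theta>0..\<theta>1})" by (rule DERIV_phib[OF t])
  show "(branch \<theta>b has_real_derivative cot t * csq \<gamma> c0 (branch \<theta>b t) * branch \<theta>b t /
       ((branch \<theta>b t)\<^sup>2 - csq \<gamma> c0 (branch \<theta>b t))) (at t within {\<theta>0..\<theta>1})"
    using DERIV_branch[OF t] unfolding ode_rhs_def csq_eq_csq2 by (rule has_field_derivative_at_within)
next
  show "branch \<theta>b \<theta>0 = u0" using \<theta>b ub_\<theta>0 by (simp add: branch_def)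
next
  fix t assume "t \<in> {\<theta>0..<\<theta>b}"
  then have "branch \<theta>b t \<in> {cs<..<qm}" using \<theta>b by (intro branch_cases(1)) auto
  then show "cs < \<bar>branch \<theta>b t\<bar>" "\<bar>branch \<theta>b t\<bar> < qm" using cs_pos by auto
next
  fix t assume "t \<in> {\<theta>b<..\<theta>1}"
  then have "branch \<theta>b t \<in> {0<..<cs}" using \<theta>b by (intro branch_cases(2)) auto
  then show "\<bar>branch \<theta>b t\<bar> < cs" by auto
next
  have tb: "\<theta>b \<in> {\<theta>0..\<theta>1}" using \<theta>b by auto
  have "(ub \<longlongrightarrow> ub \<theta>b) (at_left \<theta>b)" "(usub 0 \<longlongrightarrow> usub 0 \<theta>b) (at_right \<theta>b)"
    using DERIV_isCont[OF ub(3)[OF tb]] DERIV_isCont[OF usub0(3)[OF tb]]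
    by (auto simp: isCont_def filterlim_at_split)
  moreover have "\<forall>\<^sub>F t in at_left \<theta>b. ub t = branch \<theta>b t" "\<forall>\<^sub>F t in at_right \<theta>b. usub 0 t = branch \<theta>b t"
    by (auto simp: eventually_at_filter branch_def)
  ultimately show "(branch \<theta>b \<longlongrightarrow> ub \<theta>b) (at_left \<theta>b)" "(branch \<theta>b \<longlongrightarrow> usub 0 \<theta>b) (at_right \<theta>b)"
    by (blast intro: Lim_transform_eventually)+
  show "usub 0 \<theta>b < cs" using usub0(1)[OF tb] by simp
  show "rho \<gamma> c0 (usub 0 \<theta>b) * usub 0 \<theta>b = rho \<gamma> c0 (ub \<theta>b) * ub \<theta>b"
    using mflux_branches[OF tb] by (simp add: rho_eq_rho2 mflux_def)
qed

text \<open>Both branches have speeds below \<open>qm\<close>, which therefore serves as a Lipschitz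
  constant on either side of the shock.\<close>

lemma Lipschitz_phib: "\<exists>L. L-lipschitz_on (Omega \<theta>0 \<theta>1) (\<lambda>x. phib \<theta>b (fst x))"
proof -
  have lip: "qm-lipschitz_on {a..b} f"
    if "\<theta>0 \<le> a" "b \<le> \<theta>1" "\<And>t. t \<in> {\<theta>0..\<theta>1} \<Longrightarrow> (f has_real_derivative f' t) (at t within {\<theta>0..\<theta>1})"
      "\<And>t. t \<in> {\<theta>0..\<theta>1} \<Longrightarrow> f' t \<in> {0<..<qm}" for a b f f'
  proof (rule lipschitz_onI)
    fix s t assume st: "s \<in> {a..b}" "t \<in> {a..b}"
    have "norm (f s - f t) \<le> qm * norm (s - t)"
    proof (rule field_differentiable_bound[where S = "{\<theta>0..\<theta>1}" and f' = f'])
      show "norm (f' t) \<le> qm" if "t \<in> {\<theta>0..\<theta>1}" for t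
        using \<open>\<And>t. t \<in> {\<theta>0..\<theta>1} \<Longrightarrow> f' t \<in> {0<..<qm}\<close>[OF that] by simp
    qed (use that st in auto)
    then show "dist (f s) (f t) \<le> qm * dist s t" by (simp add: dist_norm)
  qed (use qm_pos in simp)
  have 1: "qm-lipschitz_on {\<theta>0..\<theta>b} Phim"
  proof (rule lip[of _ _ _ ub])
    show "ub t \<in> {0<..<qm}" if "t \<in> {\<theta>0..\<theta>1}" for t using ub(1)[OF that] cs_pos by auto
  qed (use \<theta>b DERIV_Phim in auto)
  have 2: "qm-lipschitz_on {\<theta>b..\<theta>1} (\<lambda>t. Psi 0 t + (Phim \<theta>b - Psi 0 \<theta>b))"
  proof (rule lip[of _ _ _ "usub 0"])
    show "usub 0 t \<in> {0<..<qm}" if "t \<in> {\<theta>0..\<theta>1}" for t using usub0(1)[OF that] cs_less_qm by auto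
    show "((\<lambda>t. Psi 0 t + (Phim \<theta>b - Psi 0 \<theta>b)) has_real_derivative usub 0 t) (at t within {\<theta>0..\<theta>1})"
      if "t \<in> {\<theta>0..\<theta>1}" for t
      using DERIV_add[OF DERIV_Psi[OF admissible_0 that] DERIV_const] by simp
  qed (use \<theta>b in auto)
  have "qm-lipschitz_on {\<theta>0..\<theta>1} (phib \<theta>b)"
    unfolding phib_def[abs_def] by (rule lipschitz_on_concat[OF 1 2]) simp
  moreover have "1-lipschitz_on (Omega \<theta>0 \<theta>1) (fst :: real \<times> real \<Rightarrow> real)"
    by (rule lipschitz_onI) (auto simp: dist_fst_le)
  moreover have "fst ` Omega \<theta>0 \<theta>1 \<subseteq> {\<theta>0..\<theta>1}" by (auto simp: Omega_def)
  ultimately have "(qm * 1)-lipschitz_on (Omega \<theta>0 \<theta>1) (\<lambda>x. phib \<theta>b (fst x))"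
    by (intro lipschitz_on_compose2) (auto intro: lipschitz_on_subset)
  then show ?thesis by blast
qed

lemma transonic_shock_sol_phib:
  assumes c1: "c1 = usub 0 \<theta>1"
  shows "transonic_shock_sol \<gamma> c0 \<theta>0 \<theta>1 u0 c1 (\<lambda>x. phib \<theta>b (fst x)) (\<lambda>p. \<theta>b)"
proof -
  define \<phi> where "\<phi> = (\<lambda>x :: real \<times> real. phib \<theta>b (fst x))"
  define V where "V = Om_minus \<theta>0 (\<lambda>p. \<theta>b) \<union> Om_plus \<theta>1 (\<lambda>p. \<theta>b)"
  define I where "I = {\<theta>0<..<\<theta>b} \<union> {\<theta>b<..<\<theta>1}"
  have V: "fst x \<in> I" if "x \<in> V" for x using that by (auto simp: V_def I_def Om_minus_def Om_plus_def)
  have I: "t \<in> {\<theta>0..\<theta>1}" "t \<noteq> \<theta>b" "\<theta>0 < t" "t < \<theta>1" if "t \<in> I" for t using that \<theta>b by (auto simp: I_def)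
  have openI: "open I" unfolding I_def by (intro open_Un open_greaterThanLessThan)
  have d1: "(phib \<theta>b has_real_derivative branch \<theta>b t) (at t)" if "t \<in> I" for t
    using DERIV_interior[OF DERIV_phib] I[OF that] by blast
  have e1: "deriv (phib \<theta>b) t = branch \<theta>b t" if "t \<in> I" for t using d1[OF that] by (rule DERIV_imp_deriv)
  have ev: "\<forall>\<^sub>F s in nhds t. s \<in> I" if "t \<in> I" for t using openI that by (rule eventually_nhds_in_open)
  have d2: "(deriv (phib \<theta>b) has_real_derivative ode_rhs t (branch \<theta>b t)) (at t)" if "t \<in> I" for t
  proof -
    have "\<forall>\<^sub>F s in nhds t. deriv (phib \<theta>b) s = branch \<theta>b s" using ev[OF that] by eventually_elim (rule e1)
    then show ?thesis using DERIV_branch[of t] I[OF that] by (simp cong: DERIV_cong_ev)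
  qed
  have e2: "deriv (deriv (phib \<theta>b)) t = ode_rhs t (branch \<theta>b t)" if "t \<in> I" for t
    using d2[OF that] by (rule DERIV_imp_deriv)
  have cb: "continuous_on I (branch \<theta>b)"
    using DERIV_branch I by (meson DERIV_isCont continuous_at_imp_continuous_on)
  have co: "continuous_on I (\<lambda>t. ode_rhs t (branch \<theta>b t))"
  proof -
    have "sin t \<noteq> 0" if "t \<in> I" for t using sin_pos[OF I(1)[OF that]] by simp
    moreover have "(branch \<theta>b t)\<^sup>2 - cc ((branch \<theta>b t)\<^sup>2) \<noteq> 0" if "t \<in> I" for t
      using branch_cases(5)[OF I(1)[OF that]] by simp
    moreover have "continuous_on I (\<lambda>t. cc ((branch \<theta>b t)\<^sup>2))" unfolding csq2_def by (intro continuous_intros cb)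
    ultimately show ?thesis unfolding ode_rhs_def cot_def by (intro continuous_intros cb) auto
  qed
  have dth\<phi>: "dth \<phi> = (\<lambda>x. deriv (phib \<theta>b) (fst x))" and dph\<phi>: "dph \<phi> = (\<lambda>x. 0)"
    unfolding \<phi>_def by (rule dth_radial dph_radial)+
  have cV: "continuous_on V (\<lambda>x. f (fst x))" if "continuous_on I f" for f :: "real \<Rightarrow> real"
    by (rule continuous_on_compose2[OF that]) (use V in \<open>auto intro: continuous_intros\<close>)
  have C2: "C2_on V \<phi>"
  proof -
    have "C1_on V \<phi>" unfolding C1_on_def dth\<phi> dph\<phi>
    proof (intro conjI ballI)
      show "\<phi> differentiable (at x)" if "x \<in> V" for x
        unfolding \<phi>_def by (rule differentiable_radial[OF d1[OF V[OF that]]])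
      show "continuous_on V (\<lambda>x. deriv (phib \<theta>b) (fst x))"
        using cV[OF cb] e1 V by (simp cong: continuous_on_cong)
    qed auto
    moreover have "C1_on V (dth \<phi>)" unfolding C1_on_def dth\<phi> dth_radial dph_radial
    proof (intro conjI ballI)
      show "(\<lambda>x. deriv (phib \<theta>b) (fst x)) differentiable (at x)" if "x \<in> V" for x
        by (rule differentiable_radial[OF d2[OF V[OF that]]])
      show "continuous_on V (\<lambda>x. deriv (deriv (phib \<theta>b)) (fst x))"
        using cV[OF co] e2 V by (simp cong: continuous_on_cong)
    qed auto
    moreover have "C1_on V (dph \<phi>)"
      unfolding C1_on_def dph\<phi> by (simp add: dth_def dph_def)
    ultimately show ?thesis by (simp add: C2_on_def)
  qed
  have cg: "cgrad \<phi> x = (branch \<theta>b (fst x), 0)" if "x \<in> V" for x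
    using e1[OF V[OF that]] by (simp add: cgrad_def dth\<phi> dph\<phi>)
  have gn: "gnorm t (q, 0) = \<bar>q\<bar>" for t q by (simp add: gnorm_def onb_def norm_Pair)
  \<comment> \<open>For a radial potential the equation asks that \<open>sin t * mflux q\<close> be
    locally constant, and on both branches this product equals \<open>K\<close>; the second
    derivative need not be computed.\<close>
  have feq: "flow_eq \<gamma> c0 \<phi> x" if x: "x \<in> V" for x
  proof -
    have "mflux_ph \<phi> = (\<lambda>x. 0)" by (simp add: mflux_ph_def dph\<phi> fun_eq_iff)
    then have p: "dph (mflux_ph \<phi>) x = 0" by (simp add: dph_def)
    have "mflux_th \<phi> = (\<lambda>x. sin (fst x) * mflux (deriv (phib \<theta>b) (fst x)))"
      by (simp add: mflux_th_def dth\<phi> dph\<phi> fun_eq_iff cgrad_def gsq_def mflux_def)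
    then have d: "dth (mflux_th \<phi>) x = deriv (\<lambda>t. sin t * mflux (deriv (phib \<theta>b) t)) (fst x)"
      by (simp add: dth_def)
    have "\<forall>\<^sub>F t in nhds (fst x). sin t * mflux (deriv (phib \<theta>b) t) = K"
      using ev[OF V[OF x]] by eventually_elim (use e1 branch_cases(3) I in \<open>simp add: mult.commute\<close>)
    then have "deriv (\<lambda>t. sin t * mflux (deriv (phib \<theta>b) t)) (fst x) = deriv (\<lambda>t. K) (fst x)"
      by (intro deriv_cong_ev) auto
    then show ?thesis
      using p d sin_pos[OF I(1)[OF V[OF x]]] flow_eq_iff[of x \<phi>] by simp
  qed
  have lim: "(cgrad \<phi> \<longlongrightarrow> (q (fst x), 0)) (at x within W)"
    if "isCont q (fst x)" "\<And>y. y \<in> W \<Longrightarrow> y \<in> V \<and> branch \<theta>b (fst y) = q (fst y)" for q x W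
  proof -
    have "((\<lambda>y. (q (fst y), 0::real)) \<longlongrightarrow> (q (fst x), 0)) (at x within W)"
    proof (intro tendsto_Pair tendsto_const isCont_tendsto_compose[OF that(1)])
      show "((\<lambda>y. fst y) \<longlongrightarrow> fst x) (at x within W)" by (intro tendsto_intros)
    qed
    moreover have "\<forall>\<^sub>F y in at x within W. (q (fst y), 0) = cgrad \<phi> y"
      using that(2) cg by (auto simp: eventually_at_filter)
    ultimately show ?thesis by (rule Lim_transform_eventually)
  qed
  show ?thesis
    unfolding transonic_shock_sol_def \<phi>_def[symmetric] V_def[symmetric]
  proof ((intro conjI; (rule exI[of _ "\<lambda>x. (ub (fst x), 0)"], rule exI[of _ "\<lambda>x. (usub 0 (fst x), 0)"])?);
      (intro conjI allI ballI)?)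
    show "(\<lambda>p. \<theta>b) C1_differentiable_on UNIV" by simp
    show "\<exists>L. L-lipschitz_on (Omega \<theta>0 \<theta>1) \<phi>" unfolding \<phi>_def by (rule Lipschitz_phib)
    show "C2_on V \<phi>" by (rule C2)
    show "\<phi> (t, p + 2 * pi) = \<phi> (t, p)" for t p by (simp add: \<phi>_def)
  next
    fix x assume x: "x \<in> Om_minus \<theta>0 (\<lambda>p. \<theta>b)"
    then have "x \<in> V" "fst x \<in> {\<theta>0..\<theta>1}" "fst x \<le> \<theta>b" using \<theta>b by (auto simp: V_def Om_minus_def)
    then show "cs < gnorm (fst x) (cgrad \<phi> x)" "gnorm (fst x) (cgrad \<phi> x) < qm"
      using branch_cases(1)[of "fst x"] cs_pos by (auto simp: cg gn)
  next
    fix x assume x: "x \<in> Om_plus \<theta>1 (\<lambda>p. \<theta>b)"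
    then have "x \<in> V" "fst x \<in> {\<theta>0..\<theta>1}" "\<theta>b < fst x" using \<theta>b by (auto simp: V_def Om_plus_def)
    then show "gnorm (fst x) (cgrad \<phi> x) < cs"
      using branch_cases(2)[of "fst x"] by (auto simp: cg gn)
  next
    show "flow_eq \<gamma> c0 \<phi> x" if "x \<in> V" for x by (rule feq[OF that])
  next
    fix x assume x: "x \<in> Cl_minus \<theta>0 (\<lambda>p. \<theta>b)"
    then have "fst x \<in> {\<theta>0..\<theta>1}" using \<theta>b by (auto simp: Cl_minus_def)
    from DERIV_isCont[OF ub(3)[OF this]]
    show "(cgrad \<phi> \<longlongrightarrow> (ub (fst x), 0)) (at x within Om_minus \<theta>0 (\<lambda>p. \<theta>b))"
      by (rule lim) (auto simp: V_def Om_minus_def branch_def)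
  next
    fix x assume x: "x \<in> Cl_plus \<theta>1 (\<lambda>p. \<theta>b)"
    then have "fst x \<in> {\<theta>0..\<theta>1}" using \<theta>b by (auto simp: Cl_plus_def)
    from DERIV_isCont[OF usub0(3)[OF this]]
    show "(cgrad \<phi> \<longlongrightarrow> (usub 0 (fst x), 0)) (at x within Om_plus \<theta>1 (\<lambda>p. \<theta>b))"
      by (rule lim) (auto simp: V_def Om_plus_def branch_def)
  next
    have t: "\<theta>1 \<in> {\<theta>0..\<theta>1}" "\<theta>0 \<in> {\<theta>0..\<theta>1}" "\<theta>b \<in> {\<theta>0..\<theta>1}" using \<theta>b by auto
    fix p :: real
    show "onb \<theta>0 (ub (fst (\<theta>0, p)), 0) = (u0, 0)" by (simp add: onb_def ub_\<theta>0)
    show "gnorm \<theta>1 (usub 0 (fst (\<theta>1, p)), 0) = c1" using usub0(1)[OF t(1)] by (simp add: gn c1)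
    show "0 \<le> fst (ub (fst (\<theta>0, p)), 0)" using ub(1)[OF t(2)] cs_pos by simp
    show "0 \<le> fst (usub 0 (fst (\<theta>1, p)), 0)" using usub0(1)[OF t(1)] by simp
    have "rr ((ub \<theta>b)\<^sup>2) * ub \<theta>b = rr ((usub 0 \<theta>b)\<^sup>2) * usub 0 \<theta>b"
      using mflux_branches[OF t(3)] by (simp add: mflux_def)
    \<comment> \<open>Bernoulli's law is built into \<open>csq\<close>: the Bernoulli quantity has
      the same value at every speed.\<close>
    moreover have "q\<^sup>2 / 2 + csq \<gamma> c0 q / (\<gamma> - 1) = c0\<^sup>2 / (\<gamma> - 1)" for q
      using gamma by (simp add: csq_def field_simps)
    ultimately show "let x = (\<theta>b, p); t = \<theta>b; qm = gnorm t (ub (fst x), 0); qp = gnorm t (usub 0 (fst x), 0)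
       in (rho \<gamma> c0 qm *\<^sub>R onb t (ub (fst x), 0) - rho \<gamma> c0 qp *\<^sub>R onb t (usub 0 (fst x), 0)) \<bullet> shock_normal (\<lambda>p. \<theta>b) p = 0 \<and>
          qm\<^sup>2 / 2 + csq \<gamma> c0 qm / (\<gamma> - 1) = qp\<^sup>2 / 2 + csq \<gamma> c0 qp / (\<gamma> - 1)"
      by (simp add: Let_def gn rho_eq_rho2 onb_def shock_normal_def)
  qed (use \<theta>b in auto)
qed

end

end

section \<open>From the definition of a solution to the theorem\<close>

lemma (in nozzle) transonic_shock_solD:
  assumes sol: "transonic_shock_sol \<gamma> c0 \<theta>0 \<theta>1 u0 c1 \<phi> \<theta>s" and c1: "0 < c1" "c1 < cs"
  shows "\<exists>Gm Gp. transonic \<gamma> c0 \<theta>0 \<theta>1 u0 \<phi> \<theta>s (deriv \<theta>s) Gm Gp c1"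
proof -
  note sol = sol[unfolded transonic_shock_sol_def]
  have C1: "\<theta>s C1_differentiable_on UNIV" using sol by blast
  then obtain D where D: "\<And>p. (\<theta>s has_vector_derivative D p) (at p)" "continuous_on UNIV D"
    unfolding C1_differentiable_on_def by auto
  have dD: "deriv \<theta>s = D"
    using D(1) by (intro ext DERIV_imp_deriv) (simp add: has_real_derivative_iff_has_vector_derivative)
  have th: "\<And>p. \<theta>s (p + 2 * pi) = \<theta>s p" "\<And>p. \<theta>0 < \<theta>s p" "\<And>p. \<theta>s p < \<theta>1"
    "\<And>t p. \<phi> (t, p + 2 * pi) = \<phi> (t, p)" using sol by blast+
  have cont: "continuous_on (Omega \<theta>0 \<theta>1) \<phi>" using sol lipschitz_on_continuous_on by blast
  have "C2_on (Om_minus \<theta>0 \<theta>s \<union> Om_plus \<theta>1 \<theta>s) \<phi>" using sol by blast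
  then have C2: "C2_on (Om_minus \<theta>0 \<theta>s) \<phi>" "C2_on (Om_plus \<theta>1 \<theta>s) \<phi>"
    unfolding C2_on_def C1_on_def by (auto elim: continuous_on_subset)
  have spd: "\<forall>x\<in>Om_minus \<theta>0 \<theta>s. cs < gnorm (fst x) (cgrad \<phi> x) \<and> gnorm (fst x) (cgrad \<phi> x) < qm"
    "\<forall>x\<in>Om_plus \<theta>1 \<theta>s. gnorm (fst x) (cgrad \<phi> x) < cs"
    "\<forall>x\<in>Om_minus \<theta>0 \<theta>s \<union> Om_plus \<theta>1 \<theta>s. flow_eq \<gamma> c0 \<phi> x" using sol by blast+
  obtain Gm Gp where
    lim: "\<forall>x\<in>Cl_minus \<theta>0 \<theta>s. (cgrad \<phi> \<longlongrightarrow> Gm x) (at x within Om_minus \<theta>0 \<theta>s)"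
      "\<forall>x\<in>Cl_plus \<theta>1 \<theta>s. (cgrad \<phi> \<longlongrightarrow> Gp x) (at x within Om_plus \<theta>1 \<theta>s)"
    and bc: "\<forall>p. onb \<theta>0 (Gm (\<theta>0, p)) = (u0, 0)" "\<forall>p. gnorm \<theta>1 (Gp (\<theta>1, p)) = c1" "\<forall>p. fst (Gp (\<theta>1, p)) \<ge> 0"
    and RH: "\<forall>p. let x = (\<theta>s p, p); t = \<theta>s p; qm = gnorm t (Gm x); qp = gnorm t (Gp x) in
             (rho \<gamma> c0 qm *\<^sub>R onb t (Gm x) - rho \<gamma> c0 qp *\<^sub>R onb t (Gp x)) \<bullet> shock_normal \<theta>s p = 0
           \<and> qm\<^sup>2 / 2 + csq \<gamma> c0 qm / (\<gamma> - 1) = qp\<^sup>2 / 2 + csq \<gamma> c0 qp / (\<gamma> - 1)"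
    using sol by blast
  have "transonic \<gamma> c0 \<theta>0 \<theta>1 u0 \<phi> \<theta>s (deriv \<theta>s) Gm Gp c1"
  \<comment> \<open>The cases treated separately are the regularity of the shock curve (1, 2), the
    squared speed bounds (10, 11), inlet and outlet data (16, 17) and the flux condition
    (21).\<close>
  proof (unfold_locales, goal_cases)
    case (1 p) show ?case using D(1)[of p] by (simp add: dD has_real_derivative_iff_has_vector_derivative)
  next
    case 2 show ?case using D(2) dD by simp
  next
    case (10 x)
    have "cs\<^sup>2 < (gnorm (fst x) (cgrad \<phi> x))\<^sup>2" "(gnorm (fst x) (cgrad \<phi> x))\<^sup>2 < qm\<^sup>2"
      using spd(1) 10 cs_pos gnorm_nonneg[of "fst x" "cgrad \<phi> x"] by (simp_all add: power_strict_mono)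
    then show ?case by (simp add: gnorm_sq)
  next
    case (11 x)
    have "(gnorm (fst x) (cgrad \<phi> x))\<^sup>2 < cs\<^sup>2"
      using spd(2) 11 gnorm_nonneg[of "fst x" "cgrad \<phi> x"] by (simp add: power_strict_mono)
    then show ?case by (simp add: gnorm_sq)
  next
    case (16 p)
    have "sin \<theta>0 \<noteq> 0" using sin_pos[of \<theta>0] theta by auto
    then show ?case using bc(1)[rule_format, of p] by (auto simp: onb_def prod_eq_iff)
  next
    case (17 p) show ?case using bc(2) by (simp add: gnorm_sq[symmetric])
  next
    case (21 p)
    \<comment> \<open>The length of the normal vector cancels, as the condition is homogeneous in
      it.\<close>
    define n where "n = norm (1::real, - deriv \<theta>s p / sin (\<theta>s p))"
    have n: "n \<noteq> 0" by (simp add: n_def zero_prod_def)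
    define g where "g = Gm (\<theta>s p, p)"
    define h where "h = Gp (\<theta>s p, p)"
    have "(rr (gsq (\<theta>s p) g) *\<^sub>R onb (\<theta>s p) g - rr (gsq (\<theta>s p) h) *\<^sub>R onb (\<theta>s p) h)
       \<bullet> ((1 / n) *\<^sub>R (1::real, - deriv \<theta>s p / sin (\<theta>s p))) = 0"
      using RH[rule_format, of p] unfolding Let_def rho_gnorm shock_normal_def n_def g_def h_def by blast
    then have "(rr (gsq (\<theta>s p) g) *\<^sub>R onb (\<theta>s p) g - rr (gsq (\<theta>s p) h) *\<^sub>R onb (\<theta>s p) h)
       \<bullet> (1::real, - deriv \<theta>s p / sin (\<theta>s p)) = 0"
      unfolding inner_scaleR_right using n by (simp only: mult_eq_0_iff) simp
    then show ?case
      unfolding g_def[symmetric] h_def[symmetric] onb_def by (simp add: inner_Pair algebra_simps)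
  qed (use th cont C2 spd(3) lim bc(3) c1 in auto)
  then show ?thesis by blast
qed

theorem theorem1p2:
  fixes \<gamma> c0 \<theta>0 \<theta>1 u0 u1 c1 :: real
  assumes hgamma: "\<gamma> > 1"
    and hc0: "c0 > 0"
    and htheta: "0 < \<theta>0" "\<theta>0 < \<theta>1" "\<theta>1 < pi"
    and hu0: "cstar \<gamma> c0 < u0" "u0 < qmax \<gamma> c0"
    and hstand: "rho \<gamma> c0 u0 * u0 * sin \<theta>0 < rho \<gamma> c0 (cstar \<gamma> c0) * cstar \<gamma> c0 * sin \<theta>1"
    and hu1: "0 < u1" "u1 < cstar \<gamma> c0"
      "rho \<gamma> c0 u1 * u1 * sin \<theta>1 = rho \<gamma> c0 u0 * u0 * sin \<theta>0"
    and hc1: "0 < c1" "c1 < cstar \<gamma> c0"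
  shows
    "((\<exists>\<phi> \<theta>s. transonic_shock_sol \<gamma> c0 \<theta>0 \<theta>1 u0 c1 \<phi> \<theta>s) \<longleftrightarrow> c1 = u1) \<and>
     (\<forall>\<phi> \<theta>s. transonic_shock_sol \<gamma> c0 \<theta>0 \<theta>1 u0 c1 \<phi> \<theta>s \<longrightarrow>
        (\<exists>\<theta>b\<in>{\<theta>0<..<\<theta>1}. (\<forall>p. \<theta>s p = \<theta>b) \<and>
           (\<exists>\<phi>b C. radial_shock_sol \<gamma> c0 \<theta>0 \<theta>1 u0 \<theta>b \<phi>b \<and>
              (\<forall>x\<in>Omega \<theta>0 \<theta>1. \<phi> x = \<phi>b (fst x) + C)))) \<and>
     (c1 = u1 \<longrightarrow>
        (\<forall>\<theta>b\<in>{\<theta>0<..<\<theta>1}. \<exists>\<phi>b.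
           radial_shock_sol \<gamma> c0 \<theta>0 \<theta>1 u0 \<theta>b \<phi>b \<and>
           transonic_shock_sol \<gamma> c0 \<theta>0 \<theta>1 u0 c1 (\<lambda>x. \<phi>b (fst x)) (\<lambda>p. \<theta>b)))"
proof -
  interpret gas \<gamma> c0 by unfold_locales (rule hgamma hc0)+
  have m: "rho \<gamma> c0 q * q = mflux q" for q by (simp add: mflux_def rho_eq_rho2)
  interpret nozzle \<gamma> c0 \<theta>0 \<theta>1 u0
    by unfold_locales (use htheta hu0 hstand in \<open>simp_all add: m\<close>)
  have t1: "\<theta>1 \<in> {\<theta>0..\<theta>1}" using htheta by simp
  have inj: "x = y" if "mflux x * sin \<theta>1 = K" "mflux y * sin \<theta>1 = K" "0 < x" "x < cs" "0 < y" "y < cs" for x y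
  proof (rule mflux_inj_sub)
    have "mflux x * sin \<theta>1 = mflux y * sin \<theta>1" using that by simp
    then show "mflux x = mflux y" using sin_pos[OF t1] by simp
  qed (use that in auto)
  have u1: "mflux u1 * sin \<theta>1 = K" using hu1(3) by (simp add: m K_def)
  \<comment> \<open>\<open>u1\<close> and the exit speed of the subsonic radial branch carry the
    same flux, and the flux is injective on subsonic speeds.\<close>
  have u1_eq: "u1 = usub 0 \<theta>1"
    by (rule inj[OF u1 usub0(2)[OF t1] hu1(1,2)]) (use usub0(1)[OF t1] in simp_all)
  have exist: "radial_shock_sol \<gamma> c0 \<theta>0 \<theta>1 u0 \<theta>b (phib \<theta>b) \<and>
      transonic_shock_sol \<gamma> c0 \<theta>0 \<theta>1 u0 c1 (\<lambda>x. phib \<theta>b (fst x)) (\<lambda>p. \<theta>b)"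
    if "c1 = u1" "\<theta>b \<in> {\<theta>0<..<\<theta>1}" for \<theta>b
    using radial_shock_sol_phib[of \<theta>b] transonic_shock_sol_phib[of \<theta>b c1] that u1_eq by simp
  have only: "c1 = u1 \<and> (\<exists>\<theta>b\<in>{\<theta>0<..<\<theta>1}. (\<forall>p. \<theta>s p = \<theta>b) \<and>
           (\<exists>\<phi>b C. radial_shock_sol \<gamma> c0 \<theta>0 \<theta>1 u0 \<theta>b \<phi>b \<and>
              (\<forall>x\<in>Omega \<theta>0 \<theta>1. \<phi> x = \<phi>b (fst x) + C)))"
    if sol: "transonic_shock_sol \<gamma> c0 \<theta>0 \<theta>1 u0 c1 \<phi> \<theta>s" for \<phi> \<theta>s
  proof -
    obtain Gm Gp where "transonic \<gamma> c0 \<theta>0 \<theta>1 u0 \<phi> \<theta>s (deriv \<theta>s) Gm Gp c1"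
      using transonic_shock_solD[OF sol hc1] by blast
    then interpret transonic \<gamma> c0 \<theta>0 \<theta>1 u0 \<phi> \<theta>s "deriv \<theta>s" Gm Gp c1 .
    have "c1 = u1" by (rule inj[OF outlet_speed u1 hc1 hu1(1,2)])
    moreover have "\<theta>s 0 \<in> {\<theta>0<..<\<theta>1}" using range_s by simp
    ultimately show ?thesis
      using radial radial_shock_sol_phib[OF range_s(1)[of 0] range_s(2)[of 0]] by blast
  qed
  have "(\<theta>0 + \<theta>1) / 2 \<in> {\<theta>0<..<\<theta>1}" using htheta by simp
  then show ?thesis using exist only by blast
qed

end
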